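(* Let $p\ge 3$ and let $A_i=T(a_i)+E_i\in\mathcal{QT}$ be positive definite, for $i=1,\ldots,p$. Put $(s_1,\ldots,s_{p-2},s_{p-1})=(1,\ldots,1,1/2)$. The operators $A_i^{(k)}$ generated by the ALM iteration $$A_i^{(0)}=A_i,\qquad A_i^{(k+1)}=A_i^{(k)}\#_{s_1}G_{s_2,\ldots,s_{p-1}}(A_1^{(k)},\ldots,A_{i-1}^{(k)},A_{i+1}^{(k)},\ldots,A_p^{(k)}),\quad i=1,\ldots,p,$$ and the ALM mean $G=G(A_1,\ldots,A_p)$ of $A_1,\ldots,A_p$ satisfy the following properties: 1. for any $k\ge 0$ and for $i=1,\ldots,p$, there exist $a_i^{(k)}\in C_{2\pi}$ and a compact operator $K_i^{(k)}$ on $\ell^2$ such that $A_i^{(k)}=T(a_i^{(k)})+K_i^{(k)}$, that is, $A_i^{(k)}\in\mathcal{QT}$; 2. there exist $g\in C_{2\pi}$ and a compact operator $K_G$ on $\ell^2$ such that $G=T(g)+K_G$, that is, $G\in\mathcal{QT}$; 3. $\lim_k\|a_i^{(k)}-g\|_\infty=0$ and $\lim_k\|K_i^{(k)}-K_G\|_2=0$, for $i=1,\ldots,p$; 4. the equation $a_i^{(k+1)}=a_i^{(k)}\#_{s_1}G_{s_2,\ldots,s_{p-1}}(a_1^{(k)},\ldots,a_{i-1}^{(k)},a_{i+1}^{(k)},\ldots,a_p^{(k)})$ is satisfied for $i=1,\ldots,p$ and for any $k$.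
   Context: $\ell^2$ is the complex Hilbert space of square-summable sequences indexed by the positive integers and $\|\cdot\|_2$ is the operator norm on $\mathcal B(\ell^2)$. $C_{2\pi}$ is the set of continuous $a:[0,2\pi]\to\mathbb C$ with $a(0)=a(2\pi)$, and $\|\cdot\|_\infty$ is the sup norm. For $a\in C_{2\pi}$ with Fourier series $\sum_{k}a_ke^{\mathrm{i}kt}$, $T(a)$ is the bounded operator on $\ell^2$ with matrix $(T(a))_{i,j}=a_{j-i}$, $i,j\ge1$. $\mathcal{QT}=\{T(a)+K: a\in C_{2\pi},\ K \text{ compact on }\ell^2\}$ is the $C^*$-subalgebra of $\mathcal B(\ell^2)$ of quasi-Toeplitz matrices; the decomposition $A=T(a)+K$ of $A\in\mathcal{QT}$ is unique and $a$ is called the symbol of $A$. A bounded operator $A$ is positive definite if it is self-adjoint and there is $\gamma>0$ with $v^*Av\ge\gamma\|v\|_2^2$ for all $v\in\ell^2$; its symbol, if $A\in\mathcal{QT}$, is then strictly positive. For positive definite operators $A,B$ and $t\in[0,1]$, $A\#_tB=A^{1/2}(A^{-1/2}BA^{-1/2})^tA^{1/2}$ (powers by continuous functional calculus); in particular $A\#_1B=B$. For two operators, $G_t(A,B)=A\#_tB$. For $p\ge3$ the mean $G_{s_1,\ldots,s_{p-1}}(A_1,\ldots,A_p)$ is defined recursively on $p$ as the common limit of the $p$ sequences $\{A_i^{(k)}\}_k$ generated by $A_i^{(0)}=A_i$, $A_i^{(k+1)}=A_i^{(k)}\#_{s_1}G_{s_2,\ldots,s_{p-1}}(A_1^{(k)},\ldots,A_{i-1}^{(k)},A_{i+1}^{(k)},\ldots,A_p^{(k)})$.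 The ALM mean is the case $(s_1,\ldots,s_{p-2},s_{p-1})=(1,\ldots,1,1/2)$; it is known that in this case the sequences converge, in the Thompson metric and hence in the operator norm, to a common positive definite limit, so the ALM mean is well defined for positive definite operators. For strictly positive functions the same constructions are applied pointwise to the positive real values of the functions, with $x\#_ty=x^{1-t}y^t$. *)

theory Defs
  imports "HOL-Analysis.Analysis" "HOL-Computational_Algebra.Polynomial"
begin

class scaleC =
  fixes scaleC :: "complex \<Rightarrow> 'a \<Rightarrow> 'a"  (infixr "*\<^sub>C" 75)

section \<open>The Hilbert space of square-summable complex sequences\<close>

text \<open>Sequences are indexed from 0, so index \<open>n\<close> stands for the positive integer \<open>n + 1\<close>.\<close>

typedef ell2 = "{x :: nat \<Rightarrow> complex. summable (\<lambda>n. (cmod (x n))\<^sup>2)}"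
  morphisms ell2_nth Abs_ell2
  by (rule exI[of _ "\<lambda>_. 0"]) simp

setup_lifting type_definition_ell2

lemma square_summable_add:
  fixes x y :: "nat \<Rightarrow> complex"
  assumes "summable (\<lambda>n. (cmod (x n))\<^sup>2)" "summable (\<lambda>n. (cmod (y n))\<^sup>2)"
  shows "summable (\<lambda>n. (cmod (x n + y n))\<^sup>2)"
proof (rule summable_comparison_test')
  show "summable (\<lambda>n. 2 * (cmod (x n))\<^sup>2 + 2 * (cmod (y n))\<^sup>2)"
    using assms by (intro summable_add summable_mult)
  fix n
  have "(cmod (x n + y n))\<^sup>2 \<le> (cmod (x n) + cmod (y n))\<^sup>2"
    by (intro power_mono norm_triangle_ineq) auto
  also have "\<dots> \<le> 2 * (cmod (x n))\<^sup>2 + 2 * (cmod (y n))\<^sup>2"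
    using sum_squares_bound[of "cmod (x n)" "cmod (y n)"] by (simp add: power2_sum)
  finally show "norm ((cmod (x n + y n))\<^sup>2) \<le> 2 * (cmod (x n))\<^sup>2 + 2 * (cmod (y n))\<^sup>2"
    by simp
qed

lemma square_summable_scale:
  fixes x :: "nat \<Rightarrow> complex"
  assumes "summable (\<lambda>n. (cmod (x n))\<^sup>2)"
  shows "summable (\<lambda>n. (cmod (c * x n))\<^sup>2)"
  using summable_mult[OF assms, of "(cmod c)\<^sup>2"] by (simp add: norm_mult power_mult_distrib)

lemma summable_square_ell2: "summable (\<lambda>n. (cmod (ell2_nth x n))\<^sup>2)"
  using ell2_nth[of x] by simp

lemma summable_norm_cnj_mult_ell2: "summable (\<lambda>n. norm (cnj (ell2_nth x n) * ell2_nth y n))"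
proof (rule summable_comparison_test')
  show "summable (\<lambda>n. (cmod (ell2_nth x n))\<^sup>2 + (cmod (ell2_nth y n))\<^sup>2)"
    by (intro summable_add summable_square_ell2)
  fix n
  have "0 \<le> (cmod (ell2_nth x n))\<^sup>2 + (cmod (ell2_nth y n))\<^sup>2
            - 2 * (cmod (ell2_nth x n) * cmod (ell2_nth y n))"
    using sum_squares_bound[of "cmod (ell2_nth x n)" "cmod (ell2_nth y n)"] by simp
  moreover have "0 \<le> cmod (ell2_nth x n) * cmod (ell2_nth y n)"
    by simp
  ultimately show "norm (norm (cnj (ell2_nth x n) * ell2_nth y n))
      \<le> (cmod (ell2_nth x n))\<^sup>2 + (cmod (ell2_nth y n))\<^sup>2"
    unfolding norm_mult complex_mod_cnj real_norm_def abs_mult abs_norm_cancel by linarith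
qed

lemma summable_cnj_mult_ell2: "summable (\<lambda>n. cnj (ell2_nth x n) * ell2_nth y n)"
  by (rule summable_norm_cancel) (rule summable_norm_cnj_mult_ell2)

text \<open>The inner product is conjugate-linear in the first argument: \<open>cinner v w = v\<^sup>* w\<close>.\<close>

definition cinner :: "ell2 \<Rightarrow> ell2 \<Rightarrow> complex" where
  "cinner x y = (\<Sum>n. cnj (ell2_nth x n) * ell2_nth y n)"

instantiation ell2 :: "{real_inner, scaleC}"
begin

lift_definition zero_ell2 :: ell2 is "\<lambda>_. 0" by simp
lift_definition plus_ell2 :: "ell2 \<Rightarrow> ell2 \<Rightarrow> ell2" is "\<lambda>x y n. x n + y n"
  by (rule square_summable_add)
lift_definition uminus_ell2 :: "ell2 \<Rightarrow> ell2" is "\<lambda>x n. - x n" by simp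
lift_definition minus_ell2 :: "ell2 \<Rightarrow> ell2 \<Rightarrow> ell2" is "\<lambda>x y n. x n - y n"
  using square_summable_add[where y = "\<lambda>n. - f n" for f] by simp
lift_definition scaleC_ell2 :: "complex \<Rightarrow> ell2 \<Rightarrow> ell2" is "\<lambda>c x n. c * x n"
  by (rule square_summable_scale)
lift_definition scaleR_ell2 :: "real \<Rightarrow> ell2 \<Rightarrow> ell2" is "\<lambda>r x n. complex_of_real r * x n"
  by (rule square_summable_scale)

definition inner_ell2 :: "ell2 \<Rightarrow> ell2 \<Rightarrow> real" where
  "inner_ell2 x y = Re (cinner x y)"
definition norm_ell2 :: "ell2 \<Rightarrow> real" where
  "norm_ell2 x = sqrt (\<Sum>n. (cmod (ell2_nth x n))\<^sup>2)"
definition dist_ell2 :: "ell2 \<Rightarrow> ell2 \<Rightarrow> real" where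
  "dist_ell2 x y = norm (x - y)"
definition sgn_ell2 :: "ell2 \<Rightarrow> ell2" where
  "sgn_ell2 x = inverse (norm x) *\<^sub>R x"
definition uniformity_ell2 :: "(ell2 \<times> ell2) filter" where
  "uniformity_ell2 = (INF e\<in>{0<..}. principal {(x, y). dist x y < e})"
definition open_ell2 :: "ell2 set \<Rightarrow> bool" where
  "open_ell2 S = (\<forall>x\<in>S. \<forall>\<^sub>F (x', y) in uniformity. x' = x \<longrightarrow> y \<in> S)"

lemma inner_ell2_self: "inner x x = (\<Sum>n. (cmod (ell2_nth x n))\<^sup>2)" for x :: ell2
proof -
  have "cnj (ell2_nth x n) * ell2_nth x n = complex_of_real ((cmod (ell2_nth x n))\<^sup>2)" for n
    by (simp only: mult.commute[of "cnj _"] complex_norm_square)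
  then have "cinner x x = complex_of_real (\<Sum>n. (cmod (ell2_nth x n))\<^sup>2)"
    by (simp only: cinner_def suminf_of_real[OF summable_square_ell2])
  then show ?thesis
    by (simp only: inner_ell2_def Re_complex_of_real)
qed

instance
proof
  fix x y z :: ell2 and r s :: real
  show "x + y + z = x + (y + z)" by transfer (simp add: add.assoc)
  show "x + y = y + x" by transfer (simp add: add.commute)
  show "0 + x = x" by transfer simp
  show "- x + x = 0" by transfer simp
  show "x - y = x + - y" by transfer simp
  show "r *\<^sub>R (x + y) = r *\<^sub>R x + r *\<^sub>R y" by transfer (simp add: distrib_left)
  show "(r + s) *\<^sub>R x = r *\<^sub>R x + s *\<^sub>R x" by transfer (simp add: distrib_right)
  show "r *\<^sub>R s *\<^sub>R x = (r * s) *\<^sub>R x" by transfer (simp add: mult.assoc)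
  show "1 *\<^sub>R x = x" by transfer simp
  show "sgn x = inverse (norm x) *\<^sub>R x" by (rule sgn_ell2_def)
  show "dist x y = norm (x - y)" by (rule dist_ell2_def)
  show "uniformity = (INF e\<in>{0<..}. principal {(x :: ell2, y). dist x y < e})"
    by (rule uniformity_ell2_def)
  show "open U = (\<forall>x\<in>U. \<forall>\<^sub>F (x', y) in uniformity. x' = x \<longrightarrow> y \<in> U)" for U :: "ell2 set"
    by (rule open_ell2_def)
  show "inner x y = inner y x"
  proof -
    have "Re (cnj a * b) = Re (cnj b * a)" for a b :: complex by simp
    then show ?thesis
      by (simp only: inner_ell2_def cinner_def Re_suminf[OF summable_cnj_mult_ell2])
  qed
  show "inner (x + y) z = inner x z + inner y z"
    by (simp add: inner_ell2_def cinner_def plus_ell2.rep_eq distrib_right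
        suminf_add[OF summable_cnj_mult_ell2 summable_cnj_mult_ell2] flip: plus_complex.sel)
  show "inner (r *\<^sub>R x) y = r * inner x y"
    by (simp add: inner_ell2_def cinner_def scaleR_ell2.rep_eq mult.assoc
        suminf_mult[OF summable_cnj_mult_ell2])
  show "0 \<le> inner x x"
    unfolding inner_ell2_self by (intro suminf_nonneg summable_square_ell2) simp
  show "inner x x = 0 \<longleftrightarrow> x = 0"
  proof
    assume "inner x x = 0"
    then have "(cmod (ell2_nth x n))\<^sup>2 = 0" for n
      unfolding inner_ell2_self using suminf_eq_zero_iff[OF summable_square_ell2] by simp
    then show "x = 0" by transfer auto
  qed (simp add: inner_ell2_self zero_ell2.rep_eq)
  show "norm x = sqrt (inner x x)"
    by (simp only: norm_ell2_def inner_ell2_self)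
qed

end

lift_definition unit_ell2 :: "nat \<Rightarrow> ell2" is "\<lambda>j n. if n = j then 1 else 0"
proof -
  fix j
  have "summable (\<lambda>n. if n = j then 1 else (0 :: real))" by (rule summable_single)
  also have "(\<lambda>n. if n = j then 1 else 0) = (\<lambda>n. (cmod (if n = j then 1 else 0))\<^sup>2)" by auto
  finally show "summable (\<lambda>n. (cmod (if n = j then 1 else 0))\<^sup>2)" .
qed

lemma ell2_nontrivial: "\<exists>x :: ell2. x \<noteq> 0"
proof
  show "unit_ell2 0 \<noteq> 0" by transfer (auto dest: fun_cong[of _ _ 0])
qed

section \<open>The algebra of bounded complex-linear operators\<close>

typedef l2op = "{A :: ell2 \<Rightarrow>\<^sub>L ell2. \<forall>c x. blinfun_apply A (c *\<^sub>C x) = c *\<^sub>C blinfun_apply A x}"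
  morphisms blinfun_of_l2op l2op_of_blinfun
proof
  show "0 \<in> {A :: ell2 \<Rightarrow>\<^sub>L ell2. \<forall>c x. blinfun_apply A (c *\<^sub>C x) = c *\<^sub>C blinfun_apply A x}"
    by simp (transfer, simp)
qed

setup_lifting type_definition_l2op

definition op_apply :: "l2op \<Rightarrow> ell2 \<Rightarrow> ell2" where
  "op_apply A = blinfun_apply (blinfun_of_l2op A)"

lemma scaleC_ell2_simps:
  fixes x y :: ell2
  shows "c *\<^sub>C (x + y) = c *\<^sub>C x + c *\<^sub>C y"
    and "c *\<^sub>C (x - y) = c *\<^sub>C x - c *\<^sub>C y"
    and "c *\<^sub>C (- x) = - (c *\<^sub>C x)"
    and "c *\<^sub>C (r *\<^sub>R x) = r *\<^sub>R (c *\<^sub>C x)"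
    and "c *\<^sub>C (d *\<^sub>C x) = d *\<^sub>C (c *\<^sub>C x)"
    and "c *\<^sub>C (0 :: ell2) = 0"
  by (transfer, simp add: algebra_simps)+

lemma norm_scaleC_ell2: "norm (c *\<^sub>C x) = cmod c * norm x" for x :: ell2
  by (simp add: norm_ell2_def scaleC_ell2.rep_eq norm_mult power_mult_distrib
      suminf_mult[OF summable_square_ell2] real_sqrt_mult)

lemma bounded_linear_scaleC_ell2: "bounded_linear (\<lambda>x :: ell2. c *\<^sub>C x)"
  by (rule bounded_linear_intro[of _ "cmod c"]) (simp_all add: scaleC_ell2_simps norm_scaleC_ell2)

definition scaleC_blinfun_ell2 :: "complex \<Rightarrow> (ell2 \<Rightarrow>\<^sub>L ell2) \<Rightarrow> (ell2 \<Rightarrow>\<^sub>L ell2)" where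
  "scaleC_blinfun_ell2 c A = Blinfun (\<lambda>x. c *\<^sub>C x) o\<^sub>L A"

lemma blinfun_apply_scaleC_blinfun_ell2:
  "blinfun_apply (scaleC_blinfun_ell2 c A) x = c *\<^sub>C blinfun_apply A x"
  by (simp add: scaleC_blinfun_ell2_def bounded_linear_Blinfun_apply[OF bounded_linear_scaleC_ell2])

instantiation l2op :: "{real_normed_algebra_1, scaleC}"
begin

lift_definition zero_l2op :: l2op is 0
  by (simp add: scaleC_ell2_simps)
lift_definition one_l2op :: l2op is id_blinfun
  by simp
lift_definition plus_l2op :: "l2op \<Rightarrow> l2op \<Rightarrow> l2op" is "(+)"
  by (simp add: blinfun.add_left scaleC_ell2_simps)
lift_definition uminus_l2op :: "l2op \<Rightarrow> l2op" is uminus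
  by (simp add: blinfun.minus_left scaleC_ell2_simps)
lift_definition minus_l2op :: "l2op \<Rightarrow> l2op \<Rightarrow> l2op" is "(-)"
  by (simp add: blinfun.diff_left scaleC_ell2_simps)
lift_definition times_l2op :: "l2op \<Rightarrow> l2op \<Rightarrow> l2op" is "(o\<^sub>L)"
  by simp
lift_definition scaleR_l2op :: "real \<Rightarrow> l2op \<Rightarrow> l2op" is scaleR
  by (simp add: blinfun.scaleR_left scaleC_ell2_simps)
lift_definition scaleC_l2op :: "complex \<Rightarrow> l2op \<Rightarrow> l2op" is scaleC_blinfun_ell2
  by (simp add: blinfun_apply_scaleC_blinfun_ell2 scaleC_ell2_simps)
lift_definition norm_l2op :: "l2op \<Rightarrow> real" is norm .

definition dist_l2op :: "l2op \<Rightarrow> l2op \<Rightarrow> real" where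
  "dist_l2op A B = norm (A - B)"
definition sgn_l2op :: "l2op \<Rightarrow> l2op" where
  "sgn_l2op A = inverse (norm A) *\<^sub>R A"
definition uniformity_l2op :: "(l2op \<times> l2op) filter" where
  "uniformity_l2op = (INF e\<in>{0<..}. principal {(A, B). dist A B < e})"
definition open_l2op :: "l2op set \<Rightarrow> bool" where
  "open_l2op S = (\<forall>A\<in>S. \<forall>\<^sub>F (A', B) in uniformity. A' = A \<longrightarrow> B \<in> S)"

lemma norm_id_blinfun_ell2: "norm (id_blinfun :: ell2 \<Rightarrow>\<^sub>L ell2) = 1"
proof (rule antisym)
  show "norm (id_blinfun :: ell2 \<Rightarrow>\<^sub>L ell2) \<le> 1" by (rule norm_blinfun_id_le)
  obtain x :: ell2 where "x \<noteq> 0" using ell2_nontrivial by blast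
  then show "1 \<le> norm (id_blinfun :: ell2 \<Rightarrow>\<^sub>L ell2)"
    using norm_blinfun[of id_blinfun x] by simp
qed

instance
proof
  fix A B C :: l2op and r s :: real
  show "A + B + C = A + (B + C)" by transfer (simp add: add.assoc)
  show "A + B = B + A" by transfer (simp add: add.commute)
  show "0 + A = A" by transfer simp
  show "- A + A = 0" by transfer simp
  show "A - B = A + - B" by transfer simp
  show "r *\<^sub>R (A + B) = r *\<^sub>R A + r *\<^sub>R B" by transfer (simp add: scaleR_add_right)
  show "(r + s) *\<^sub>R A = r *\<^sub>R A + s *\<^sub>R A" by transfer (simp add: scaleR_add_left)
  show "r *\<^sub>R s *\<^sub>R A = (r * s) *\<^sub>R A" by transfer simp
  show "1 *\<^sub>R A = A" by transfer simp
  show "A * B * C = A * (B * C)" by transfer (auto intro: blinfun_eqI)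
  show "1 * A = A" by transfer (auto intro: blinfun_eqI)
  show "A * 1 = A" by transfer (auto intro: blinfun_eqI)
  show "(A + B) * C = A * C + B * C"
    by transfer (auto intro: blinfun_eqI simp: blinfun.add_left)
  show "A * (B + C) = A * B + A * C"
    by transfer (auto intro: blinfun_eqI simp: blinfun.add_left blinfun.add_right)
  show "r *\<^sub>R A * B = r *\<^sub>R (A * B)"
    by transfer (auto intro: blinfun_eqI simp: blinfun.scaleR_left)
  show "A * r *\<^sub>R B = r *\<^sub>R (A * B)"
    by transfer (auto intro: blinfun_eqI simp: blinfun.scaleR_left blinfun.scaleR_right)
  show "norm A = 0 \<longleftrightarrow> A = 0" by transfer simp
  show "norm (A + B) \<le> norm A + norm B" by transfer (rule norm_triangle_ineq)
  show "norm (r *\<^sub>R A) = \<bar>r\<bar> * norm A" by transfer simp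
  show "norm (A * B) \<le> norm A * norm B" by transfer (rule norm_blinfun_compose)
  show "norm (1 :: l2op) = 1" by transfer (rule norm_id_blinfun_ell2)
  show "(0 :: l2op) \<noteq> 1"
    using norm_id_blinfun_ell2 by transfer force
  show "sgn A = inverse (norm A) *\<^sub>R A" by (rule sgn_l2op_def)
  show "dist A B = norm (A - B)" by (rule dist_l2op_def)
  show "uniformity = (INF e\<in>{0<..}. principal {(A :: l2op, B). dist A B < e})"
    by (rule uniformity_l2op_def)
  show "open U = (\<forall>A\<in>U. \<forall>\<^sub>F (A', B) in uniformity. A' = A \<longrightarrow> B \<in> U)" for U :: "l2op set"
    by (rule open_l2op_def)
qed

end

definition compact_op :: "l2op \<Rightarrow> bool" where
  "compact_op A \<longleftrightarrow> compact (closure (op_apply A ` cball 0 1))"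

definition self_adjoint :: "l2op \<Rightarrow> bool" where
  "self_adjoint A \<longleftrightarrow> (\<forall>x y. cinner (op_apply A x) y = cinner x (op_apply A y))"

text \<open>For self-adjoint \<open>A\<close> the number \<open>cinner v (op_apply A v)\<close> is real.\<close>

definition positive_definite :: "l2op \<Rightarrow> bool" where
  "positive_definite A \<longleftrightarrow>
     self_adjoint A \<and> (\<exists>\<gamma>>0. \<forall>v. \<gamma> * (norm v)\<^sup>2 \<le> Re (cinner v (op_apply A v)))"

section \<open>Continuous functional calculus\<close>

definition spectrum :: "l2op \<Rightarrow> complex set" where
  "spectrum A = {z. \<not> (\<exists>X. X * (A - z *\<^sub>C 1) = 1 \<and> (A - z *\<^sub>C 1) * X = 1)}"

definition poly_op :: "complex poly \<Rightarrow> l2op \<Rightarrow> l2op" where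
  "poly_op q A = (\<Sum>i\<le>degree q. coeff q i *\<^sub>C A ^ i)"

text \<open>
  For self-adjoint \<open>A\<close> and \<open>f\<close> continuous on the spectrum, which is then a compact set of reals,
  \<open>f(A)\<close> is the norm limit of \<open>q\<^sub>n(A)\<close> for any polynomials \<open>q\<^sub>n\<close> that converge to \<open>f\<close> uniformly
  on the spectrum; such polynomials exist by the Weierstrass approximation theorem.
\<close>

definition cfc :: "(complex \<Rightarrow> complex) \<Rightarrow> l2op \<Rightarrow> l2op" where
  "cfc f A = (THE X. \<forall>q. uniform_limit (spectrum A) (\<lambda>n. poly (q n)) f sequentially
                        \<longrightarrow> (\<lambda>n. poly_op (q n) A) \<longlonglongrightarrow> X)"

definition op_powr :: "l2op \<Rightarrow> real \<Rightarrow> l2op" where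
  "op_powr A t = cfc (\<lambda>z. z powr complex_of_real t) A"

definition op_gm :: "real \<Rightarrow> l2op \<Rightarrow> l2op \<Rightarrow> l2op" where
  "op_gm t A B =
     op_powr A (1/2) * op_powr (op_powr A (-1/2) * B * op_powr A (-1/2)) t * op_powr A (1/2)"

section \<open>Toeplitz and quasi-Toeplitz operators\<close>

text \<open>Only the values of a symbol on \<open>{0..2 * pi}\<close> matter.\<close>

definition C2pi :: "(real \<Rightarrow> complex) set" where
  "C2pi = {a. continuous_on {0..2 * pi} a \<and> a 0 = a (2 * pi)}"

definition sup_norm :: "(real \<Rightarrow> complex) \<Rightarrow> real" where
  "sup_norm a = (SUP t\<in>{0..2 * pi}. cmod (a t))"

definition fourier_coeff :: "(real \<Rightarrow> complex) \<Rightarrow> int \<Rightarrow> complex" where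
  "fourier_coeff a k =
     integral {0..2 * pi} (\<lambda>t. a t * exp (- (\<i> * of_int k * of_real t))) / of_real (2 * pi)"

text \<open>
  Row \<open>i\<close>, column \<open>j\<close> of the matrix of \<open>T\<close> is entry \<open>i\<close> of \<open>T e\<^sub>j\<close>; since only \<open>j - i\<close> enters,
  counting rows and columns from 0 instead of 1 makes no difference.
\<close>

definition toeplitz :: "(real \<Rightarrow> complex) \<Rightarrow> l2op" where
  "toeplitz a = (THE T. \<forall>i j. ell2_nth (op_apply T (unit_ell2 j)) i
                               = fourier_coeff a (int j - int i))"

section \<open>Means of several variables\<close>

definition delete_nth :: "nat \<Rightarrow> 'a list \<Rightarrow> 'a list" where
  "delete_nth i xs = take i xs @ drop (Suc i) xs"

text \<open>
  \<open>mean_iter m s M As k\<close> is the list of the \<open>A\<^sub>i\<^sup>(\<^sup>k\<^sup>)\<close>, where \<open>m\<close> is the weighted two-variable mean,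
  \<open>s\<close> the first weight and \<open>M\<close> the mean of one variable less.
\<close>

primrec mean_iter ::
    "(real \<Rightarrow> 'a \<Rightarrow> 'a \<Rightarrow> 'a) \<Rightarrow> real \<Rightarrow> ('a list \<Rightarrow> 'a) \<Rightarrow> 'a list \<Rightarrow> nat \<Rightarrow> 'a list" where
  "mean_iter m s M As 0 = As"
| "mean_iter m s M As (Suc k) =
     (let Bs = mean_iter m s M As k
      in map (\<lambda>i. m s (Bs ! i) (M (delete_nth i Bs))) [0..<length Bs])"

text \<open>
  \<open>gmean m ss As\<close> is meant for \<open>length As = length ss + 1 \<ge> 2\<close>.  The same recursion serves for
  operators (with the norm topology) and for positive reals.
\<close>

fun gmean :: "(real \<Rightarrow> 'a \<Rightarrow> 'a \<Rightarrow> 'a) \<Rightarrow> real list \<Rightarrow> 'a list \<Rightarrow> 'a :: topological_space" where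
  "gmean m [s] As = m s (As ! 0) (As ! 1)"
| "gmean m (s # s' # ss) As =
     (THE L. \<forall>i<length As. (\<lambda>k. mean_iter m s (\<lambda>Bs. gmean m (s' # ss) Bs) As k ! i) \<longlonglongrightarrow> L)"

definition real_gm :: "real \<Rightarrow> real \<Rightarrow> real \<Rightarrow> real" where
  "real_gm t x y = x powr (1 - t) * y powr t"

text \<open>
  Strictly positive symbols are stored as complex-valued functions; the means act on their
  positive real values.
\<close>

definition strictly_positive :: "(real \<Rightarrow> complex) \<Rightarrow> bool" where
  "strictly_positive a \<longleftrightarrow> (\<forall>t\<in>{0..2 * pi}. a t \<in> \<real> \<and> 0 < Re (a t))"

definition fun_gm :: "real \<Rightarrow> (real \<Rightarrow> complex) \<Rightarrow> (real \<Rightarrow> complex) \<Rightarrow> real \<Rightarrow> complex" where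
  "fun_gm s a b = (\<lambda>t. complex_of_real (real_gm s (Re (a t)) (Re (b t))))"

definition fun_gmean :: "real list \<Rightarrow> (real \<Rightarrow> complex) list \<Rightarrow> real \<Rightarrow> complex" where
  "fun_gmean ss as = (\<lambda>t. complex_of_real (gmean real_gm ss (map (\<lambda>a. Re (a t)) as)))"

definition alm_weights :: "nat \<Rightarrow> real list" where
  "alm_weights p = replicate (p - 2) 1 @ [1/2]"

end

theory Submission
  imports Defs "HOL-Computational_Algebra.Fundamental_Theorem_Algebra"
begin

text \<open>
  With the weights \<open>(1, \<dots>, 1, 1/2)\<close> one step of the iteration replaces \<open>A\<^sub>i\<close> by the mean of the other
  \<open>p - 1\<close> operators.  In the Thompson metric the geometric mean \<open>A #\<^sub>1\<^sub>/\<^sub>2 B\<close> is a nonexpansive midpoint,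
  because it is monotone and homogeneous as the solution of \<open>X A\<^sup>-\<^sup>1 X = B\<close>.  By induction the mean of
  \<open>p - 1\<close> operators contracts by \<open>1 / (p - 1)\<close> in each argument, so distances between neighbours
  \<open>A\<^sub>i, A\<^sub>i\<^sub>+\<^sub>1\<close> shrink geometrically and the iteration converges in norm.

  Operators \<open>T(a) + K\<close> form a closed algebra, since \<open>T(a) T(b) - T(a b)\<close> is compact; hence they are stable
  under the functional calculus, with the calculus acting pointwise on the symbol.  Each value
  \<open>a(s)\<close> is an approximate eigenvalue of \<open>T(a) + K\<close>.  This makes the symbol map contractive, so that
  the symbols of the iterates converge uniformly, and the compact parts converge as differences.
\<close>

section \<open>Sequence space and operators\<close>

text \<open>The space is complex, but the estimates run over the real \<open>inner\<close>, and no
  adjoint operation is introduced: conjugating coefficients gives the adjoint of a polynomial in a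
  self-adjoint operator. \<open>cfc\<close> and \<open>gmean\<close> are definite descriptions, so
  each value requires existence and uniqueness of a limit before anything can be said about it. The
  geometric mean is not nonexpansive in the operator norm, which is why the contraction argument
  lives in the Thompson metric; norm convergence is recovered from upper and lower bounds that are
  uniform along the sequence. The rate 1/2 is the coarse form of \<open>1 / N\<close> for
  \<open>N \<ge> 2\<close>. For symbols there is no second convergence proof: the pointwise means
  are themselves defined as limits, and these limits exist because the symbols inherit the Cauchy
  property from the operators. Hence the induction on the number of variables carries the operator
  mean and its symbol together.\<close>

lemmas ell2_nth_simps [simp] = plus_ell2.rep_eq minus_ell2.rep_eq uminus_ell2.rep_eq
  zero_ell2.rep_eq scaleC_ell2.rep_eq scaleR_ell2.rep_eq

lemma ell2_eqI: "(\<And>n. ell2_nth x n = ell2_nth y n) \<Longrightarrow> x = y"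
  by (metis ell2_nth_inject ext)

lemma scaleC_add_left_ell2: "(c + d) *\<^sub>C (x :: ell2) = c *\<^sub>C x + d *\<^sub>C x"
  and scaleC_one_ell2 [simp]: "1 *\<^sub>C (x :: ell2) = x"
  and scaleC_zero_ell2 [simp]: "0 *\<^sub>C (x :: ell2) = 0"
  and scaleC_mult_ell2 [simp]: "c *\<^sub>C d *\<^sub>C (x :: ell2) = (c * d) *\<^sub>C x"
  and scaleC_of_real_ell2: "complex_of_real r *\<^sub>C (x :: ell2) = r *\<^sub>R x"
  and scaleC_minus_left_ell2 [simp]: "(- c) *\<^sub>C (x :: ell2) = - (c *\<^sub>C x)"
  by (rule ell2_eqI; simp add: algebra_simps)+

lemma norm_power2_ell2: "(norm x)\<^sup>2 = (\<Sum>n. (cmod (ell2_nth x n))\<^sup>2)" for x :: ell2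
  by (simp add: norm_ell2_def suminf_nonneg summable_square_ell2)

lemma sum_le_norm_ell2: "(\<Sum>i\<in>F. (cmod (ell2_nth x i))\<^sup>2) \<le> (norm x)\<^sup>2" if "finite F" for x :: ell2
  unfolding norm_power2_ell2 by (rule sum_le_suminf) (auto simp: summable_square_ell2 that)

lemma nth_le_norm_ell2: "cmod (ell2_nth x n) \<le> norm x" for x :: ell2
  using sum_le_norm_ell2[of "{n}" x] by (simp add: power2_le_iff_abs_le)

text \<open>A bound on partial sums that is uniform in \<open>N\<close> yields membership and the
  norm estimate at once; completeness and both shifts build their vectors this way.\<close>

lemma ell2_ofI:
  assumes "\<And>N. (\<Sum>n<N. (cmod (f n))\<^sup>2) \<le> c\<^sup>2" "0 \<le> c"
  obtains x :: ell2 where "ell2_nth x = f" "norm x \<le> c"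
proof -
  have s: "summable (\<lambda>n. (cmod (f n))\<^sup>2)"
    by (rule summableI_nonneg_bounded[where x = "c\<^sup>2"]) (use assms in auto)
  then have nth: "ell2_nth (Abs_ell2 f) = f"
    by (simp add: Abs_ell2_inverse)
  have "(norm (Abs_ell2 f))\<^sup>2 \<le> c\<^sup>2"
    unfolding norm_power2_ell2 nth by (rule suminf_le_const) (use s assms in auto)
  then show thesis
    using that[OF nth] assms(2) power2_le_imp_le by blast
qed

instance ell2 :: complete_space
proof
  fix X :: "nat \<Rightarrow> ell2" assume X: "Cauchy X"
  have "Cauchy (\<lambda>m. ell2_nth (X m) n)" for n
  proof (rule metric_CauchyI)
    fix e :: real assume "0 < e"
    from metric_CauchyD[OF X this] obtain M where "\<forall>m\<ge>M. \<forall>k\<ge>M. dist (X m) (X k) < e" by blast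
    moreover have "dist (ell2_nth (X m) n) (ell2_nth (X k) n) \<le> dist (X m) (X k)" for m k
      using nth_le_norm_ell2[of "X m - X k" n] by (simp add: dist_norm)
    ultimately show "\<exists>M. \<forall>m\<ge>M. \<forall>k\<ge>M. dist (ell2_nth (X m) n) (ell2_nth (X k) n) < e"
      by (meson order.strict_trans1)
  qed
  then have "\<forall>n. \<exists>l. (\<lambda>m. ell2_nth (X m) n) \<longlonglongrightarrow> l"
    using Cauchy_convergent_iff convergent_def by blast
  then obtain l where l: "\<And>n. (\<lambda>m. ell2_nth (X m) n) \<longlonglongrightarrow> l n" by metis
  \<comment> \<open>The estimate stays on finite sums, where the limit in \<open>k\<close> may be
    taken coordinate by coordinate; \<open>l\<close> is not yet known to be square summable.\<close>
  have tail: "\<exists>M. \<forall>m\<ge>M. \<forall>N. (\<Sum>n<N. (cmod (ell2_nth (X m) n - l n))\<^sup>2) \<le> e\<^sup>2" if "0 < e" for e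
  proof -
    from metric_CauchyD[OF X that] obtain M where M: "\<forall>m\<ge>M. \<forall>k\<ge>M. dist (X m) (X k) < e" by blast
    have "(\<Sum>n<N. (cmod (ell2_nth (X m) n - l n))\<^sup>2) \<le> e\<^sup>2" if m: "m \<ge> M" for m N
    proof (rule tendsto_upperbound)
      show "(\<lambda>k. \<Sum>n<N. (cmod (ell2_nth (X m) n - ell2_nth (X k) n))\<^sup>2)
              \<longlonglongrightarrow> (\<Sum>n<N. (cmod (ell2_nth (X m) n - l n))\<^sup>2)"
        by (intro tendsto_intros l)
      show "\<forall>\<^sub>F k in sequentially. (\<Sum>n<N. (cmod (ell2_nth (X m) n - ell2_nth (X k) n))\<^sup>2) \<le> e\<^sup>2"
        using eventually_ge_at_top[of M]
      proof eventually_elim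
        case (elim k)
        have "(\<Sum>n<N. (cmod (ell2_nth (X m - X k) n))\<^sup>2) \<le> (norm (X m - X k))\<^sup>2"
          by (rule sum_le_norm_ell2) simp
        also have "\<dots> \<le> e\<^sup>2"
          using M[rule_format, OF m elim] by (intro power_mono) (auto simp: dist_norm)
        finally show ?case by simp
      qed
    qed simp
    then show ?thesis by blast
  qed
  obtain M1 where M1: "\<And>N. (\<Sum>n<N. (cmod (ell2_nth (X M1) n - l n))\<^sup>2) \<le> 1\<^sup>2"
    using tail[of 1] by auto
  obtain y :: ell2 where y: "ell2_nth y = (\<lambda>n. ell2_nth (X M1) n - l n)"
    by (rule ell2_ofI[OF M1]) auto
  \<comment> \<open>Square summability is available for the difference \<open>X M1 - l\<close>, so
    the limit vector \<open>l\<close> is written as \<open>X M1 - y\<close>.\<close>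
  have "X \<longlonglongrightarrow> X M1 - y"
  proof (rule metric_LIMSEQ_I)
    fix r :: real assume r: "0 < r"
    obtain M where M: "\<And>m N. m \<ge> M \<Longrightarrow> (\<Sum>n<N. (cmod (ell2_nth (X m) n - l n))\<^sup>2) \<le> (r/2)\<^sup>2"
      using tail[of "r/2"] r by auto
    have "dist (X m) (X M1 - y) < r" if "m \<ge> M" for m
    proof -
      have "norm (X m - (X M1 - y)) \<le> r / 2"
        by (rule ell2_ofI[OF M[OF that]]) (use r y in \<open>auto intro!: arg_cong[where f = norm]
          ell2_eqI elim!: order_trans[OF eq_refl, rotated]\<close>)
      then show ?thesis using r by (simp add: dist_norm)
    qed
    then show "\<exists>no. \<forall>m\<ge>no. dist (X m) (X M1 - y) < r" by blast
  qed
  then show "convergent X" unfolding convergent_def by blast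
qed

instance ell2 :: banach ..

lemma op_apply_simps [simp]:
  "op_apply (A + B) x = op_apply A x + op_apply B x"
  "op_apply (A - B) x = op_apply A x - op_apply B x"
  "op_apply (- A) x = - op_apply A x"
  "op_apply 0 x = 0"
  "op_apply 1 x = x"
  "op_apply (A * B) x = op_apply A (op_apply B x)"
  "op_apply (r *\<^sub>R A) x = r *\<^sub>R op_apply A x"
  "op_apply (c *\<^sub>C A) x = c *\<^sub>C op_apply A x"
  by (simp_all add: op_apply_def plus_l2op.rep_eq minus_l2op.rep_eq uminus_l2op.rep_eq
      zero_l2op.rep_eq one_l2op.rep_eq times_l2op.rep_eq scaleR_l2op.rep_eq scaleC_l2op.rep_eq
      blinfun.add_left blinfun.diff_left blinfun.minus_left blinfun.scaleR_left
      blinfun_apply_scaleC_blinfun_ell2)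

lemma op_apply_linear [simp]:
  "op_apply A (x + y) = op_apply A x + op_apply A y"
  "op_apply A (x - y) = op_apply A x - op_apply A y"
  "op_apply A (- x) = - op_apply A x"
  "op_apply A 0 = 0"
  "op_apply A (r *\<^sub>R x) = r *\<^sub>R op_apply A x"
  "op_apply A (c *\<^sub>C x) = c *\<^sub>C op_apply A x"
  using blinfun_of_l2op[of A]
  by (simp_all add: op_apply_def blinfun.add_right blinfun.diff_right blinfun.minus_right
      blinfun.scaleR_right)

lemma op_apply_sum_right: "op_apply A (sum f S) = (\<Sum>i\<in>S. op_apply A (f i))"
  by (induction S rule: infinite_finite_induct) auto

lemma l2op_eqI: "(\<And>x. op_apply A x = op_apply B x) \<Longrightarrow> A = B"
  by (metis op_apply_def blinfun_eqI blinfun_of_l2op_inject)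

lemma norm_op_apply_le: "norm (op_apply A x) \<le> norm A * norm x"
  unfolding op_apply_def norm_l2op.rep_eq by (rule norm_blinfun)

lemma norm_l2op_leI: "0 \<le> c \<Longrightarrow> (\<And>x. norm (op_apply A x) \<le> c * norm x) \<Longrightarrow> norm A \<le> c"
  unfolding op_apply_def norm_l2op.rep_eq by (rule norm_blinfun_bound)

lemma bounded_linear_op_apply: "bounded_linear (op_apply A)"
  unfolding op_apply_def by (rule blinfun.bounded_linear_right)

lemma l2op_ofI:
  assumes "\<And>x y. f (x + y) = f x + f y" "\<And>c x. f (c *\<^sub>C x) = c *\<^sub>C f x"
    "\<And>x. norm (f x) \<le> c * norm x"
  obtains A where "op_apply A = f"
proof -
  have "f (r *\<^sub>R x) = r *\<^sub>R f x" for r x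
    using assms(2)[of "complex_of_real r" x] by (simp add: scaleC_of_real_ell2)
  then have bl: "bounded_linear f"
    by (intro bounded_linear_intro[where K = c]) (use assms in \<open>auto simp: mult.commute\<close>)
  have "op_apply (l2op_of_blinfun (Blinfun f)) = f"
    unfolding op_apply_def
    by (subst l2op_of_blinfun_inverse) (auto simp: bounded_linear_Blinfun_apply bl assms(2))
  then show thesis using that by blast
qed

lemma tendsto_op_apply: "X \<longlonglongrightarrow> A \<Longrightarrow> (\<lambda>n. op_apply (X n) x) \<longlonglongrightarrow> op_apply A x"
proof -
  assume "X \<longlonglongrightarrow> A"
  then have "(\<lambda>n. norm (X n - A) * norm x) \<longlonglongrightarrow> 0"
    by (intro tendsto_mult_left_zero) (simp add: LIM_zero tendsto_norm_zero)
  then have "(\<lambda>n. op_apply (X n) x - op_apply A x) \<longlonglongrightarrow> 0"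
  proof (rule Lim_null_comparison[OF always_eventually, rotated], intro allI)
    show "norm (op_apply (X n) x - op_apply A x) \<le> norm (X n - A) * norm x" for n
      using norm_op_apply_le[of "X n - A" x] by simp
  qed
  then show ?thesis by (simp add: LIM_zero_iff)
qed

text \<open>Complex linearity survives pointwise limits, so these operators are closed in the Banach
  space of bounded real-linear maps.\<close>

instance l2op :: complete_space
proof
  fix X :: "nat \<Rightarrow> l2op" assume X: "Cauchy X"
  have "Cauchy (\<lambda>n. blinfun_of_l2op (X n))"
    using X by (simp add: Cauchy_def dist_norm norm_l2op.rep_eq minus_l2op.rep_eq)
  then obtain L where L: "(\<lambda>n. blinfun_of_l2op (X n)) \<longlonglongrightarrow> L"
    using Cauchy_convergent_iff convergent_def by blast
  have ap: "(\<lambda>n. op_apply (X n) x) \<longlonglongrightarrow> blinfun_apply L x" for x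
    unfolding op_apply_def by (intro tendsto_intros L)
  have "blinfun_apply L (c *\<^sub>C x) = c *\<^sub>C blinfun_apply L x" for c x
  proof (rule LIMSEQ_unique[OF ap])
    show "(\<lambda>n. op_apply (X n) (c *\<^sub>C x)) \<longlonglongrightarrow> c *\<^sub>C blinfun_apply L x"
      using bounded_linear.tendsto[OF bounded_linear_scaleC_ell2 ap[of x]] by simp
  qed
  then have inv: "blinfun_of_l2op (l2op_of_blinfun L) = L"
    by (simp add: l2op_of_blinfun_inverse)
  have "X \<longlonglongrightarrow> l2op_of_blinfun L"
    using L by (simp add: tendsto_dist_iff[of _ L] tendsto_dist_iff[of _ "l2op_of_blinfun L"]
        dist_norm norm_l2op.rep_eq minus_l2op.rep_eq inv)
  then show "convergent X" unfolding convergent_def by blast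
qed

instance l2op :: banach ..

lemma scaleC_l2op_simps:
  fixes A B :: l2op
  shows "c *\<^sub>C (A * B) = (c *\<^sub>C A) * B" "A * (c *\<^sub>C B) = c *\<^sub>C (A * B)"
    "(c + d) *\<^sub>C A = c *\<^sub>C A + d *\<^sub>C A" "c *\<^sub>C (A + B) = c *\<^sub>C A + c *\<^sub>C B"
    "(c * d) *\<^sub>C A = c *\<^sub>C d *\<^sub>C A" "0 *\<^sub>C A = 0" "1 *\<^sub>C A = A" "c *\<^sub>C (0 :: l2op) = 0"
    "complex_of_real r *\<^sub>C A = r *\<^sub>R A" "(- c) *\<^sub>C A = - (c *\<^sub>C A)"
  by (rule l2op_eqI; simp add: scaleC_ell2_simps(1) scaleC_add_left_ell2 scaleC_of_real_ell2
      scaleC_ell2_simps(6) del: plus_complex.sel)+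

lemma norm_scaleC_l2op: "norm (c *\<^sub>C A) \<le> cmod c * norm A" for A :: l2op
  by (rule norm_l2op_leI) (auto simp: norm_scaleC_ell2 mult.assoc intro!: mult_left_mono norm_op_apply_le)

section \<open>Self-adjoint operators\<close>

lemma Re_cinner: "Re (cinner x y) = inner x y"
  by (simp add: inner_ell2_def)

text \<open>The imaginary part of \<open>cinner\<close> is a real inner product with a rotated
  argument, so the real structure determines the complex one.\<close>

lemma inner_scaleC_ii: "inner (\<i> *\<^sub>C x) y = Im (cinner x y)"
proof -
  have "cinner (\<i> *\<^sub>C x) y = - \<i> * cinner x y"
    by (simp add: cinner_def suminf_mult[OF summable_cnj_mult_ell2, symmetric] mult.assoc
        suminf_minus summable_mult summable_cnj_mult_ell2)
  then show ?thesis by (simp add: inner_ell2_def)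
qed

lemma cinner_eq: "cinner x y = Complex (inner x y) (inner (\<i> *\<^sub>C x) y)"
  by (simp add: complex_eq_iff Re_cinner inner_scaleC_ii)

text \<open>Since \<open>A\<close> commutes with multiplication by \<i>, the real identity at
  \<open>x\<close> and at the rotated vector gives both parts of the complex one.\<close>

lemma self_adjoint_iff: "self_adjoint A \<longleftrightarrow> (\<forall>x y. inner (op_apply A x) y = inner x (op_apply A y))"
proof
  assume "self_adjoint A"
  then show "\<forall>x y. inner (op_apply A x) y = inner x (op_apply A y)"
    unfolding self_adjoint_def by (metis Re_cinner)
next
  assume *: "\<forall>x y. inner (op_apply A x) y = inner x (op_apply A y)"
  show "self_adjoint A"
    unfolding self_adjoint_def cinner_eq using * by (metis op_apply_linear(6))
qed

lemma self_adjointD: "self_adjoint A \<Longrightarrow> inner (op_apply A x) y = inner x (op_apply A y)"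
  by (simp add: self_adjoint_iff)

lemma self_adjoint_intros:
  "self_adjoint A \<Longrightarrow> self_adjoint B \<Longrightarrow> self_adjoint (A + B)"
  "self_adjoint A \<Longrightarrow> self_adjoint B \<Longrightarrow> self_adjoint (A - B)"
  "self_adjoint A \<Longrightarrow> self_adjoint (r *\<^sub>R A)"
  "self_adjoint 1"
  by (simp_all add: self_adjoint_iff inner_simps)

lemma self_adjoint_sandwich: "self_adjoint R \<Longrightarrow> self_adjoint B \<Longrightarrow> self_adjoint (R * B * R)"
  by (simp add: self_adjoint_iff)

lemma self_adjoint_limit:
  assumes "\<And>n. self_adjoint (X n)" "X \<longlonglongrightarrow> A"
  shows "self_adjoint A"
  unfolding self_adjoint_iff
proof (intro allI, rule LIMSEQ_unique)
  fix x y
  show "(\<lambda>n. inner (op_apply (X n) x) y) \<longlonglongrightarrow> inner (op_apply A x) y"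
    by (intro tendsto_intros tendsto_op_apply assms)
  have "(\<lambda>n. inner x (op_apply (X n) y)) \<longlonglongrightarrow> inner x (op_apply A y)"
    by (intro tendsto_intros tendsto_op_apply assms)
  then show "(\<lambda>n. inner (op_apply (X n) x) y) \<longlonglongrightarrow> inner x (op_apply A y)"
    by (simp add: self_adjointD assms)
qed

text \<open>Only quadratic forms are compared, so antisymmetry holds for self-adjoint operators but
  not in general.\<close>

definition loewner_le :: "l2op \<Rightarrow> l2op \<Rightarrow> bool" (infix "\<sqsubseteq>" 50) where
  "A \<sqsubseteq> B \<longleftrightarrow> (\<forall>v. inner v (op_apply A v) \<le> inner v (op_apply B v))"

lemma loewner_leD: "A \<sqsubseteq> B \<Longrightarrow> inner v (op_apply A v) \<le> inner v (op_apply B v)"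
  by (simp add: loewner_le_def)

lemma loewner_trans: "A \<sqsubseteq> B \<Longrightarrow> B \<sqsubseteq> C \<Longrightarrow> A \<sqsubseteq> C"
  unfolding loewner_le_def by (meson order_trans)

lemma loewner_scaleR: "A \<sqsubseteq> B \<Longrightarrow> 0 \<le> r \<Longrightarrow> r *\<^sub>R A \<sqsubseteq> r *\<^sub>R B"
  by (simp add: loewner_le_def mult_left_mono)

lemma posdef_iff:
  "positive_definite A \<longleftrightarrow> self_adjoint A \<and> (\<exists>\<gamma>>0. \<gamma> *\<^sub>R 1 \<sqsubseteq> A)"
  by (simp add: positive_definite_def Re_cinner loewner_le_def power2_norm_eq_inner)

lemma positive_definiteE:
  assumes "positive_definite A"
  obtains \<gamma> where "0 < \<gamma>" "\<And>v. \<gamma> * (norm v)\<^sup>2 \<le> inner v (op_apply A v)"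
  using assms by (auto simp: positive_definite_def Re_cinner)

lemma posdef_self_adjoint: "positive_definite A \<Longrightarrow> self_adjoint A"
  by (simp add: positive_definite_def)

lemma inner_op_le: "\<bar>inner v (op_apply A v)\<bar> \<le> norm A * (norm v)\<^sup>2"
proof -
  have "\<bar>inner v (op_apply A v)\<bar> \<le> norm v * norm (op_apply A v)"
    by (rule Cauchy_Schwarz_ineq2)
  also have "\<dots> \<le> norm v * (norm A * norm v)"
    by (intro mult_left_mono norm_op_apply_le) auto
  finally show ?thesis by (simp add: power2_eq_square mult_ac)
qed

lemma loewner_le_norm: "A \<sqsubseteq> norm A *\<^sub>R 1"
  unfolding loewner_le_def
proof
  fix v show "inner v (op_apply A v) \<le> inner v (op_apply (norm A *\<^sub>R 1) v)"
    using inner_op_le[of v A] by (simp add: power2_norm_eq_inner)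
qed

lemma norm_op_le_of_form:
  assumes "0 \<le> c" "\<And>x y. inner y (op_apply A x) \<le> c * ((norm x)\<^sup>2 + (norm y)\<^sup>2) / 2"
  shows "norm A \<le> c"
proof (rule norm_l2op_leI[OF assms(1)])
  fix x
  show "norm (op_apply A x) \<le> c * norm x"
  proof (cases "x = 0 \<or> op_apply A x = 0")
    case True then show ?thesis using assms(1) by auto
  next
    case False
    let ?n = "norm (op_apply A x)"
    have n: "?n > 0" "norm x > 0" using False by auto
    \<comment> \<open>The test vector has the length of \<open>x\<close>; there the arithmetic mean
      of the squared norms equals their product.\<close>
    have "norm x * ?n = inner ((norm x / ?n) *\<^sub>R op_apply A x) (op_apply A x)"
      using n by (simp add: power2_norm_eq_inner[symmetric] power2_eq_square)
    also have "\<dots> \<le> c * ((norm x)\<^sup>2 + (norm ((norm x / ?n) *\<^sub>R op_apply A x))\<^sup>2) / 2"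
      by (rule assms(2))
    also have "norm ((norm x / ?n) *\<^sub>R op_apply A x) = norm x"
      using n by simp
    finally have "norm x * ?n \<le> norm x * (c * norm x)"
      by (simp add: power2_eq_square mult_ac)
    then show ?thesis using n by (simp only: mult_le_cancel_left_pos)
  qed
qed

text \<open>Polarization expresses the bilinear form by quadratic ones, and the parallelogram law
  adds up their bounds.\<close>

lemma norm_self_adjoint_le:
  assumes A: "self_adjoint A" and c: "0 \<le> c"
    and f: "\<And>v. \<bar>inner v (op_apply A v)\<bar> \<le> c * (norm v)\<^sup>2"
  shows "norm A \<le> c"
proof (rule norm_op_le_of_form[OF c])
  fix x y
  have "4 * inner y (op_apply A x)
      = inner (x + y) (op_apply A (x + y)) - inner (x - y) (op_apply A (x - y))"
    using self_adjointD[OF A, of y x] by (simp add: inner_simps inner_commute)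
  also have "\<dots> \<le> c * (norm (x + y))\<^sup>2 + c * (norm (x - y))\<^sup>2"
    using f[of "x + y"] f[of "x - y"] by linarith
  also have "\<dots> = 2 * (c * ((norm x)\<^sup>2 + (norm y)\<^sup>2))"
    by (simp add: power2_norm_eq_inner inner_simps algebra_simps inner_commute)
  finally show "inner y (op_apply A x) \<le> c * ((norm x)\<^sup>2 + (norm y)\<^sup>2) / 2" by simp
qed

lemma neumann_inverse:
  fixes C :: l2op
  assumes "norm (1 - C) < 1"
  shows "\<exists>X. X * C = 1 \<and> C * X = 1"
proof -
  let ?N = "1 - C"
  have s: "summable (\<lambda>n. ?N ^ n)"
    by (rule complete_algebra_summable_geometric[OF assms])
  let ?X = "\<Sum>n. ?N ^ n"
  have tl: "(\<Sum>n. ?N ^ Suc n) = ?X - 1"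
    using suminf_split_head[OF s] by simp
  have "?X * ?N = (\<Sum>n. ?N ^ n * ?N)" by (rule suminf_mult2[OF s])
  also have "\<dots> = ?X - 1" using tl by (simp only: power_Suc2)
  finally have 1: "?X * C = 1" by (simp add: algebra_simps)
  have "?N * ?X = (\<Sum>n. ?N * ?N ^ n)" by (rule suminf_mult[OF s, symmetric])
  also have "\<dots> = ?X - 1" using tl by (simp only: power_Suc)
  finally have "C * ?X = 1" by (simp add: algebra_simps)
  with 1 show ?thesis by blast
qed

text \<open>After division by \<open>norm A\<close> the form of \<open>1 - ?C\<close> lies between 0
  and \<open>1 - \<gamma> / norm A\<close>, so the Neumann series applies.\<close>

lemma posdef_inverse:
  assumes "positive_definite A"
  obtains X where "X * A = 1" "A * X = 1"
proof -
  obtain \<gamma> where g: "0 < \<gamma>" "\<And>v. \<gamma> * (norm v)\<^sup>2 \<le> inner v (op_apply A v)"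
    using positive_definiteE[OF assms] by blast
  obtain u :: ell2 where u: "u \<noteq> 0" using ell2_nontrivial by blast
  have ub: "inner v (op_apply A v) \<le> norm A * (norm v)\<^sup>2" for v
    using inner_op_le[of v A] by linarith
  have "\<gamma> * (norm u)\<^sup>2 \<le> norm A * (norm u)\<^sup>2" using g(2)[of u] ub[of u] by linarith
  then have gA: "\<gamma> \<le> norm A" using u by simp
  then have A0: "norm A > 0" using g(1) by linarith
  let ?C = "(1 / norm A) *\<^sub>R A"
  have "norm (1 - ?C) \<le> 1 - \<gamma> / norm A"
  proof (rule norm_self_adjoint_le)
    show "self_adjoint (1 - ?C)"
      by (intro self_adjoint_intros posdef_self_adjoint assms)
    show "0 \<le> 1 - \<gamma> / norm A" using gA A0 by simp
    fix v
    have "inner v (op_apply (1 - ?C) v) = (norm v)\<^sup>2 - inner v (op_apply A v) / norm A"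
      by (simp add: inner_simps power2_norm_eq_inner)
    moreover have "inner v (op_apply A v) / norm A \<le> (norm v)\<^sup>2"
      using ub[of v] A0 by (simp add: field_simps)
    moreover have "inner v (op_apply A v) / norm A \<ge> \<gamma> / norm A * (norm v)\<^sup>2"
      using g(2)[of v] A0 by (simp add: field_simps)
    ultimately show "\<bar>inner v (op_apply (1 - ?C) v)\<bar> \<le> (1 - \<gamma> / norm A) * (norm v)\<^sup>2"
      by (simp add: left_diff_distrib)
  qed
  also have "\<dots> < 1" using g A0 by simp
  finally obtain X where X: "X * ?C = 1" "?C * X = 1" using neumann_inverse by blast
  show thesis
    by (rule that[of "(1 / norm A) *\<^sub>R X"]) (use X in auto)
qed

section \<open>Polynomials of an operator and the functional calculus\<close>

lemma inner_scaleC_left: "inner (c *\<^sub>C x) y = inner x (cnj c *\<^sub>C y)" for x y :: ell2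
  by (simp add: inner_ell2_def cinner_def mult_ac)

lemma poly_op_0 [simp]: "poly_op 0 A = 0"
  by (simp add: poly_op_def scaleC_l2op_simps)

text \<open>Horner's rule replaces the sum up to the degree by a recursion, on which the algebraic
  identities for \<open>poly_op\<close> rest.\<close>

lemma poly_op_pCons: "poly_op (pCons c p) A = c *\<^sub>C 1 + A * poly_op p A"
proof (cases "p = 0")
  case True
  then show ?thesis by (simp add: poly_op_def scaleC_l2op_simps)
next
  case False
  have "poly_op (pCons c p) A = c *\<^sub>C 1 + (\<Sum>i\<le>degree p. coeff p i *\<^sub>C (A * A ^ i))"
    using False by (simp add: poly_op_def sum.atMost_Suc_shift del: sum.atMost_Suc)
  also have "(\<Sum>i\<le>degree p. coeff p i *\<^sub>C (A * A ^ i)) = A * poly_op p A"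
    by (simp add: poly_op_def sum_distrib_left scaleC_l2op_simps)
  finally show ?thesis .
qed

lemma poly_op_add: "poly_op (p + q) A = poly_op p A + poly_op q A"
  by (induction p q rule: poly_induct2)
    (simp_all add: poly_op_pCons scaleC_l2op_simps distrib_left)

lemma poly_op_smult: "poly_op (smult c p) A = c *\<^sub>C poly_op p A"
  by (induction p) (simp_all add: poly_op_pCons scaleC_l2op_simps)

lemma poly_op_diff: "poly_op (p - q) A = poly_op p A - poly_op q A"
  using poly_op_add[of p "smult (-1) q" A] poly_op_smult[of "-1" q A]
  by (simp add: scaleC_l2op_simps)

lemma poly_op_mult: "poly_op (p * q) A = poly_op p A * poly_op q A"
  by (induction p)
    (simp_all add: poly_op_pCons poly_op_add poly_op_smult scaleC_l2op_simps distrib_right mult.assoc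
      flip: scaleC_l2op_simps(1))

lemma poly_op_commute: "A * poly_op p A = poly_op p A * A"
proof -
  have "poly_op [:0, 1:] A = A" by (simp add: poly_op_pCons scaleC_l2op_simps)
  then show ?thesis using poly_op_mult[of "[:0, 1:]" p A] poly_op_mult[of p "[:0, 1:]" A]
    by (simp only: mult.commute)
qed

text \<open>Moving \<open>A\<close> across the inner product one factor at a time reverses the order
  of the factors, which \<open>poly_op_commute\<close> restores.\<close>

lemma poly_op_adjoint:
  assumes "self_adjoint A"
  shows "inner (op_apply (poly_op p A) x) y = inner x (op_apply (poly_op (map_poly cnj p) A) y)"
proof (induction p arbitrary: x y)
  case (pCons c p)
  let ?q = "poly_op (map_poly cnj p) A"
  have "op_apply A (op_apply ?q y) = op_apply ?q (op_apply A y)"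
    using arg_cong[OF poly_op_commute, of "\<lambda>B. op_apply B y"] by simp
  then show ?case
    using pCons by (simp add: map_poly_pCons poly_op_pCons inner_simps inner_scaleC_left
        self_adjointD[OF assms])
qed simp

lemma poly_map_poly_cnj: "poly (map_poly cnj p) (complex_of_real r) = cnj (poly p (complex_of_real r))"
  by (induction p) (simp_all add: map_poly_pCons)

section \<open>Approximate eigenvalues and the norm of a polynomial in a self-adjoint
  operator\<close>

definition bounded_below :: "l2op \<Rightarrow> bool" where
  "bounded_below B \<longleftrightarrow> (\<exists>c>0. \<forall>x. c * norm x \<le> norm (op_apply B x))"

lemma bounded_below_mult: "bounded_below B \<Longrightarrow> bounded_below C \<Longrightarrow> bounded_below (B * C)"
proof -
  assume "bounded_below B" "bounded_below C"
  then obtain b c where b: "b > 0" "\<And>x. b * norm x \<le> norm (op_apply B x)"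
    and c: "c > 0" "\<And>x. c * norm x \<le> norm (op_apply C x)"
    unfolding bounded_below_def by blast
  have "b * c * norm x \<le> norm (op_apply (B * C) x)" for x
  proof -
    have "b * (c * norm x) \<le> b * norm (op_apply C x)"
      using b(1) c(2) by (intro mult_left_mono) auto
    also have "\<dots> \<le> norm (op_apply (B * C) x)" using b(2) by simp
    finally show ?thesis by (simp add: mult.assoc)
  qed
  then show ?thesis unfolding bounded_below_def using b c by (intro exI[of _ "b * c"]) auto
qed

lemma bounded_below_left_inverse: "X * B = 1 \<Longrightarrow> bounded_below B"
proof -
  assume X: "X * B = 1"
  have "1 / (norm X + 1) * norm x \<le> norm (op_apply B x)" for x
  proof -
    have "norm x = norm (op_apply X (op_apply B x))"
      using arg_cong[OF X, of "\<lambda>Y. op_apply Y x"] by simp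
    also have "\<dots> \<le> norm X * norm (op_apply B x)" by (rule norm_op_apply_le)
    also have "\<dots> \<le> (norm X + 1) * norm (op_apply B x)" by (intro mult_right_mono) auto
    finally have "norm x \<le> norm (op_apply B x) * (norm X + 1)" by (simp add: mult.commute)
    moreover have "norm X + 1 > 0" by (simp add: add_nonneg_pos)
    ultimately show ?thesis by (simp add: pos_divide_le_eq)
  qed
  moreover have "1 / (norm X + 1) > 0" by (simp add: add_nonneg_pos)
  ultimately show ?thesis unfolding bounded_below_def by blast
qed

text \<open>The hypothesis says that \<open>z\<close> is an approximate eigenvalue; an inverse would
  supply a lower bound.\<close>

lemma not_bounded_below_in_spectrum: "\<not> bounded_below (A - z *\<^sub>C 1) \<Longrightarrow> z \<in> spectrum A"
  using bounded_below_left_inverse unfolding spectrum_def by blast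

text \<open>Over the complex numbers \<open>p\<close> splits into linear factors, and a product of
  operators that are bounded below is bounded below.\<close>

lemma poly_op_bounded_below:
  "p \<noteq> 0 \<Longrightarrow> (\<And>z. poly p z = 0 \<Longrightarrow> bounded_below (A - z *\<^sub>C 1)) \<Longrightarrow> bounded_below (poly_op p A)"
proof (induction "degree p" arbitrary: p)
  case 0
  then obtain c where p: "p = [:c:]" "c \<noteq> 0" by (metis degree_eq_zeroE pCons_0_0)
  show ?case unfolding bounded_below_def p poly_op_pCons
    by (rule exI[of _ "cmod c"]) (auto simp: p norm_scaleC_ell2)
next
  case (Suc n)
  have "\<not> constant (poly p)" using Suc(2) by (simp add: constant_degree)
  then obtain z where z: "poly p z = 0" using fundamental_theorem_of_algebra by blast
  then obtain q where q: "p = [:-z, 1:] * q" by (metis dvdE poly_eq_0_iff_dvd)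
  have q0: "q \<noteq> 0" using q Suc(3) by auto
  have "degree p = Suc (degree q)" using q0 unfolding q by (subst degree_mult_eq) auto
  then have "bounded_below (poly_op q A)"
    using Suc q0 unfolding q by (intro Suc(1)) auto
  moreover have "poly_op p A = (A - z *\<^sub>C 1) * poly_op q A"
    unfolding q poly_op_mult by (simp add: poly_op_pCons scaleC_l2op_simps)
  ultimately show ?case using Suc(4)[OF z] bounded_below_mult by metis
qed

text \<open>\<open>\<parallel>p(A)\<parallel>\<^sup>2\<close> is an approximate eigenvalue of \<open>p(A)\<^sup>*p(A)\<close>; factoring
  \<open>cnj p * p - \<parallel>p(A)\<parallel>\<^sup>2\<close> into linear factors moves it to an approximate eigenvalue of \<open>A\<close>.\<close>

lemma norm_poly_op_attained:
  assumes A: "self_adjoint A" and spec: "spectrum A \<subseteq> \<real>" and deg: "degree p > 0"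
  shows "\<exists>z. \<not> bounded_below (A - z *\<^sub>C 1) \<and> norm (poly_op p A) \<le> cmod (poly p z)"
proof -
  define P Q l where "P = poly_op p A" and "Q = poly_op (map_poly cnj p) A" and "l = (norm P)\<^sup>2"
  have adj: "inner (op_apply P x) y = inner x (op_apply Q y)" for x y
    unfolding P_def Q_def by (rule poly_op_adjoint[OF A])
  have Q: "norm Q \<le> norm P"
  proof (rule norm_l2op_leI)
    fix x
    have "(norm (op_apply Q x))\<^sup>2 = inner (op_apply P (op_apply Q x)) x"
      by (simp add: adj power2_norm_eq_inner)
    also have "\<dots> \<le> norm (op_apply P (op_apply Q x)) * norm x" by (rule norm_cauchy_schwarz)
    also have "\<dots> \<le> norm P * norm (op_apply Q x) * norm x"
      by (intro mult_right_mono norm_op_apply_le) auto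
    finally have "norm (op_apply Q x) * norm (op_apply Q x) \<le> norm (op_apply Q x) * (norm P * norm x)"
      by (simp add: power2_eq_square mult_ac)
    then show "norm (op_apply Q x) \<le> norm P * norm x"
      by (cases "norm (op_apply Q x) = 0") (auto simp: mult_le_cancel_left)
  qed simp
  define r where "r = map_poly cnj p * p - [:complex_of_real l:]"
  have r: "poly_op r A = Q * P - l *\<^sub>R 1"
    by (simp add: r_def poly_op_diff poly_op_mult poly_op_pCons P_def Q_def scaleC_l2op_simps)
  have "\<not> bounded_below (poly_op r A)"
  proof
    assume "bounded_below (poly_op r A)"
    then obtain c where c: "c > 0" "\<And>x. c * norm x \<le> norm (op_apply (poly_op r A) x)"
      unfolding bounded_below_def by blast
    \<comment> \<open>Expand the square of \<open>norm (?b - l *\<^sub>R x)\<close> and use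
      \<open>norm ?b \<le> l * norm x\<close>. Solved for \<open>norm (op_apply P x)\<close>, this
      replaces \<open>l\<close> by the smaller \<open>k\<close>, although \<open>l\<close> is the
      square of \<open>norm P\<close>.\<close>
    have key: "c\<^sup>2 * (norm x)\<^sup>2 + 2 * l * (norm (op_apply P x))\<^sup>2 \<le> 2 * l\<^sup>2 * (norm x)\<^sup>2" for x
    proof -
      let ?b = "op_apply Q (op_apply P x)"
      have "norm ?b \<le> norm Q * norm (op_apply P x)" by (rule norm_op_apply_le)
      also have "\<dots> \<le> norm P * (norm P * norm x)"
        using Q by (intro mult_mono norm_op_apply_le) auto
      finally have b: "norm ?b \<le> l * norm x" by (simp add: l_def power2_eq_square mult.assoc)
      have "c\<^sup>2 * (norm x)\<^sup>2 \<le> (norm (?b - l *\<^sub>R x))\<^sup>2"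
        using power_mono[OF c(2)[of x], of 2] c(1) by (simp add: r power_mult_distrib)
      also have "\<dots> = (norm ?b)\<^sup>2 - 2 * l * (norm (op_apply P x))\<^sup>2 + l\<^sup>2 * (norm x)\<^sup>2"
      proof -
        have "inner ?b x = (norm (op_apply P x))\<^sup>2"
          by (simp only: inner_commute[of ?b x] adj[symmetric] power2_norm_eq_inner)
        moreover have "(norm (?b - l *\<^sub>R x))\<^sup>2 = (norm ?b)\<^sup>2 - 2 * l * inner ?b x + l\<^sup>2 * (norm x)\<^sup>2"
          unfolding power2_norm_eq_inner
          by (simp add: inner_diff_left inner_diff_right inner_commute[of x ?b] power2_eq_square
              algebra_simps)
        ultimately show ?thesis by simp
      qed
      also have "(norm ?b)\<^sup>2 \<le> l\<^sup>2 * (norm x)\<^sup>2"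
        using power_mono[OF b, of 2] by (simp add: power_mult_distrib)
      finally show ?thesis by simp
    qed
    obtain u :: ell2 where u: "u \<noteq> 0" using ell2_nontrivial by blast
    have l0: "l \<ge> 0" by (simp add: l_def)
    have "c\<^sup>2 * (norm u)\<^sup>2 > 0" using u c(1) by simp
    then have "l \<noteq> 0" using key[of u] by (intro notI) simp
    then have l: "l > 0" using l0 by simp
    define k where "k = l - c\<^sup>2 / (2 * l)"
    have k: "(norm (op_apply P x))\<^sup>2 \<le> k * (norm x)\<^sup>2" for x
    proof -
      have "2 * l * k = 2 * l\<^sup>2 - c\<^sup>2" using l by (simp add: k_def field_simps power2_eq_square)
      then have "2 * l * (k * (norm x)\<^sup>2) = 2 * l\<^sup>2 * (norm x)\<^sup>2 - c\<^sup>2 * (norm x)\<^sup>2"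
        by (metis left_diff_distrib mult.assoc)
      then have "2 * l * (norm (op_apply P x))\<^sup>2 \<le> 2 * l * (k * (norm x)\<^sup>2)"
        using key[of x] by linarith
      then show ?thesis by (rule mult_left_le_imp_le) (use l in simp)
    qed
    have k0: "k \<ge> 0"
    proof -
      have "0 \<le> k * (norm u)\<^sup>2" using k[of u] zero_le_power2[of "norm (op_apply P u)"] by linarith
      then show ?thesis using u by (simp add: zero_le_mult_iff)
    qed
    have "norm P \<le> sqrt k"
    proof (rule norm_l2op_leI)
      fix x show "norm (op_apply P x) \<le> sqrt k * norm x"
        by (rule power2_le_imp_le) (use k[of x] k0 in \<open>auto simp: power_mult_distrib\<close>)
    qed (use k0 in simp)
    then have "l \<le> k" unfolding l_def using k0 by (metis norm_ge_zero power_mono real_sqrt_pow2)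
    moreover have "c\<^sup>2 / (2 * l) > 0" using c(1) l by simp
    ultimately show False by (simp add: k_def)
  qed
  \<comment> \<open>Factoring requires a nonzero polynomial; positive degree of \<open>p\<close>
    prevents \<open>map_poly cnj p * p\<close> from being constant.\<close>
  moreover have "r \<noteq> 0"
  proof
    assume "r = 0"
    then have "degree (map_poly cnj p * p) = 0" by (simp add: r_def)
    moreover have "map_poly cnj p \<noteq> 0"
    proof
      assume "map_poly cnj p = 0"
      then have "coeff (map_poly cnj p) (degree p) = 0" by simp
      then show False using deg by (auto simp: coeff_map_poly)
    qed
    ultimately show False using deg by (subst (asm) degree_mult_eq) auto
  qed
  ultimately obtain z where z: "poly r z = 0" "\<not> bounded_below (A - z *\<^sub>C 1)"
    using poly_op_bounded_below by blast
  then have zs: "z \<in> spectrum A" by (simp add: not_bounded_below_in_spectrum)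
  \<comment> \<open>At a real point conjugated coefficients give the conjugate value, so
    \<open>poly r z = 0\<close> reads \<open>(cmod (poly p z))\<^sup>2 = l\<close>.\<close>
  then obtain t where t: "z = complex_of_real t" using spec by (auto elim: Reals_cases)
  have "cnj (poly p z) * poly p z = complex_of_real l"
    using z(1) by (simp add: r_def t poly_map_poly_cnj)
  then have "complex_of_real ((cmod (poly p z))\<^sup>2) = complex_of_real l"
    by (simp only: complex_norm_square mult.commute[of "poly p z"])
  then have "(cmod (poly p z))\<^sup>2 = (norm P)\<^sup>2" unfolding l_def of_real_eq_iff .
  then have "norm P = cmod (poly p z)" by simp
  then show ?thesis using z(2) unfolding P_def by auto
qed

lemma norm_poly_op_le:
  assumes A: "self_adjoint A" and spec: "spectrum A \<subseteq> \<real>"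
    and b: "\<And>z. z \<in> spectrum A \<Longrightarrow> cmod (poly p z) \<le> c"
  shows "norm (poly_op p A) \<le> c"
proof (cases "degree p > 0")
  case True
  then show ?thesis
    using norm_poly_op_attained[OF A spec True] b not_bounded_below_in_spectrum by (meson order_trans)
next
  case False
  then obtain k where k: "p = [:k:]" by (auto elim: degree_eq_zeroE)
  \<comment> \<open>For a constant polynomial the bound on the spectrum says something only if the
    spectrum is nonempty, which the identity polynomial shows.\<close>
  obtain z where "z \<in> spectrum A"
    using norm_poly_op_attained[OF A spec, of "[:0, 1:]"] not_bounded_below_in_spectrum by auto
  then have "cmod k \<le> c" using b[of z] k by simp
  moreover have "norm (poly_op p A) \<le> cmod k"
    using norm_scaleC_l2op[of k 1] by (simp add: k poly_op_pCons)
  ultimately show ?thesis by simp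
qed

section \<open>Location of the spectrum of a self-adjoint operator\<close>

definition op_between :: "real \<Rightarrow> real \<Rightarrow> l2op \<Rightarrow> bool" where
  "op_between l u A \<longleftrightarrow> self_adjoint A \<and> l *\<^sub>R 1 \<sqsubseteq> A \<and> A \<sqsubseteq> u *\<^sub>R 1"

lemma posdef_between:
  assumes "positive_definite A" obtains l u where "0 < l" "l \<le> u" "op_between l u A"
proof -
  obtain l where l: "0 < l" "l *\<^sub>R 1 \<sqsubseteq> A" using assms by (auto simp: posdef_iff)
  have lu: "l *\<^sub>R 1 \<sqsubseteq> norm A *\<^sub>R 1" using loewner_trans[OF l(2) loewner_le_norm] .
  obtain v :: ell2 where v: "v \<noteq> 0" using ell2_nontrivial by blast
  have "l \<le> norm A" using loewner_leD[OF lu, of v] v by (simp add: inner_simps)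
  then show thesis using that[of l "norm A"] l loewner_le_norm assms
    by (simp add: op_between_def posdef_self_adjoint)
qed

text \<open>Commutation turns an inverse of the product into a left and a right inverse of
  \<open>L\<close>, and these coincide.\<close>

lemma posdef_invertible:
  "positive_definite (L * R) \<Longrightarrow> L * R = R * L \<Longrightarrow> \<exists>X. X * L = 1 \<and> L * X = 1"
proof -
  assume "positive_definite (L * R)" and c: "L * R = R * L"
  then obtain X where X: "X * (L * R) = 1" "L * R * X = 1" by (metis posdef_inverse)
  have "X * R * L = 1" "L * (R * X) = 1" using X c by (metis mult.assoc)+
  moreover then have "X * R = R * X" by (metis mult.assoc mult.left_neutral mult.right_neutral)
  ultimately show ?thesis by metis
qed

text \<open>Off the real axis, (A - z)(A - cnj z) is a square plus \<open>(Im z)\<^sup>2\<close>,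
  hence positive definite; at a real \<open>t\<close> outside the interval, \<open>A - t\<close> or
  \<open>t - A\<close> is. Approximation can then be done on \<open>{l..u}\<close> without knowing
  the spectrum itself.\<close>

lemma op_between_spectrum:
  assumes A: "op_between l u A"
  shows "spectrum A \<subseteq> complex_of_real ` {l..u}"
proof
  fix z assume z: "z \<in> spectrum A"
  have sa: "self_adjoint A" and lA: "\<And>v. l * (norm v)\<^sup>2 \<le> inner v (op_apply A v)"
    and uA: "\<And>v. inner v (op_apply A v) \<le> u * (norm v)\<^sup>2"
    using A by (auto simp: op_between_def loewner_le_def power2_norm_eq_inner)
  have ninv: "\<not> (\<exists>X. X * (A - z *\<^sub>C 1) = 1 \<and> (A - z *\<^sub>C 1) * X = 1)"
    using z by (simp add: spectrum_def)
  have im: "Im z = 0"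
  proof (rule ccontr)
    assume im: "Im z \<noteq> 0"
    define B where "B = A - Re z *\<^sub>R 1"
    have B: "self_adjoint B" unfolding B_def by (intro self_adjoint_intros sa)
    have zz: "z + cnj z = 2 * complex_of_real (Re z)"
      "z * cnj z = (complex_of_real (Re z))\<^sup>2 + (complex_of_real (Im z))\<^sup>2"
      by (auto simp: complex_eq_iff power2_eq_square)
    have BB: "ell2_nth (op_apply (B * B + (Im z)\<^sup>2 *\<^sub>R 1) x) n = ell2_nth (op_apply A (op_apply A x)) n
        - (z + cnj z) * ell2_nth (op_apply A x) n + z * cnj z * ell2_nth x n" for x n
      unfolding zz by (simp add: B_def algebra_simps power2_eq_square)
    have "(A - z *\<^sub>C 1) * (A - cnj z *\<^sub>C 1) = B * B + (Im z)\<^sup>2 *\<^sub>R 1"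
      by (intro l2op_eqI ell2_eqI, subst BB) (simp add: algebra_simps)
    moreover have "(A - cnj z *\<^sub>C 1) * (A - z *\<^sub>C 1) = B * B + (Im z)\<^sup>2 *\<^sub>R 1"
      by (intro l2op_eqI ell2_eqI, subst BB) (simp add: algebra_simps)
    moreover have BB': "0 \<le> inner v (op_apply B (op_apply B v))" for v
      using self_adjointD[OF B, of v "op_apply B v"] inner_ge_zero[of "op_apply B v"] by simp
    have "positive_definite (B * B + (Im z)\<^sup>2 *\<^sub>R 1)"
      unfolding posdef_iff
    proof
      show "self_adjoint (B * B + (Im z)\<^sup>2 *\<^sub>R 1)"
        using B by (simp add: self_adjoint_iff inner_simps)
      have "(Im z)\<^sup>2 *\<^sub>R 1 \<sqsubseteq> B * B + (Im z)\<^sup>2 *\<^sub>R 1"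
        unfolding loewner_le_def by (auto simp: inner_add_right intro: BB')
      then show "\<exists>\<gamma>>0. \<gamma> *\<^sub>R 1 \<sqsubseteq> B * B + (Im z)\<^sup>2 *\<^sub>R 1"
        using im by (intro exI[of _ "(Im z)\<^sup>2"]) auto
    qed
    ultimately show False using posdef_invertible ninv by metis
  qed
  define t where "t = Re z"
  have zt: "z = complex_of_real t" using im by (simp add: complex_eq_iff t_def)
  then have ninv': "\<not> (\<exists>X. X * (A - t *\<^sub>R 1) = 1 \<and> (A - t *\<^sub>R 1) * X = 1)"
    using ninv by (simp add: scaleC_l2op_simps)
  have "l \<le> t"
  proof (rule ccontr)
    assume "\<not> l \<le> t"
    moreover have "(l - t) *\<^sub>R 1 \<sqsubseteq> A - t *\<^sub>R 1" unfolding loewner_le_def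
      using lA by (simp add: inner_simps algebra_simps power2_norm_eq_inner)
    ultimately have "positive_definite (A - t *\<^sub>R 1)"
      unfolding posdef_iff by (auto intro!: self_adjoint_intros sa exI[of _ "l - t"])
    then show False using posdef_inverse ninv' by metis
  qed
  moreover have "t \<le> u"
  proof (rule ccontr)
    assume "\<not> t \<le> u"
    moreover have "(t - u) *\<^sub>R 1 \<sqsubseteq> t *\<^sub>R 1 - A" unfolding loewner_le_def
      using uA by (simp add: inner_simps algebra_simps power2_norm_eq_inner)
    ultimately have "positive_definite (t *\<^sub>R 1 - A)"
      unfolding posdef_iff by (auto intro!: self_adjoint_intros sa exI[of _ "t - u"])
    then obtain X where "X * (t *\<^sub>R 1 - A) = 1" "(t *\<^sub>R 1 - A) * X = 1"
      using posdef_inverse by metis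
    then have "(- X) * (A - t *\<^sub>R 1) = 1 \<and> (A - t *\<^sub>R 1) * (- X) = 1"
      by (simp add: algebra_simps)
    then show False using ninv' by blast
  qed
  ultimately show "z \<in> complex_of_real ` {l..u}" using zt by auto
qed

section \<open>Continuous functional calculus over an interval\<close>

lemma uniform_limit_le:
  assumes "uniform_limit S q a sequentially" "0 < e"
  obtains N where "\<And>n t. n \<ge> N \<Longrightarrow> t \<in> S \<Longrightarrow> dist (q n t) (a t) < e"
  using uniform_limitD[OF assms] unfolding eventually_sequentially by blast

text \<open>The norm bound makes \<open>poly_op (q n) A\<close> Cauchy and forces every other
  approximating sequence to the same limit, which is what the definite description in
  \<open>cfc\<close> asks for.\<close>

lemma cfc_LIMSEQ:
  assumes A: "op_between l u A"
    and q: "uniform_limit (complex_of_real ` {l..u}) (\<lambda>n. poly (q n)) f sequentially"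
  shows "(\<lambda>n. poly_op (q n) A) \<longlonglongrightarrow> cfc f A"
proof -
  note S = op_between_spectrum[OF A]
  have sa: "self_adjoint A" and real: "spectrum A \<subseteq> \<real>"
    using A S by (auto simp: op_between_def)
  have qs: "uniform_limit (spectrum A) (\<lambda>n. poly (q n)) f sequentially"
    by (rule uniform_limit_on_subset[OF q S])
  have close: "\<exists>N. \<forall>m\<ge>N. \<forall>n\<ge>N. dist (poly_op (r m) A) (poly_op (q n) A) < e"
    if r: "uniform_limit (spectrum A) (\<lambda>n. poly (r n)) f sequentially" and e: "e > 0" for r e
  proof -
    obtain N where N: "\<And>n z. n \<ge> N \<Longrightarrow> z \<in> spectrum A \<Longrightarrow> dist (poly (q n) z) (f z) < e/3"
      using uniform_limit_le[OF qs, of "e/3"] e by auto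
    obtain M where M: "\<And>n z. n \<ge> M \<Longrightarrow> z \<in> spectrum A \<Longrightarrow> dist (poly (r n) z) (f z) < e/3"
      using uniform_limit_le[OF r, of "e/3"] e by auto
    have "dist (poly_op (r m) A) (poly_op (q n) A) < e" if "m \<ge> max N M" "n \<ge> max N M" for m n
    proof -
      have "norm (poly_op (r m - q n) A) \<le> 2 * e / 3"
      proof (rule norm_poly_op_le[OF sa real])
        fix z assume z: "z \<in> spectrum A"
        then show "cmod (poly (r m - q n) z) \<le> 2 * e / 3"
          using N[of n z] M[of m z] that dist_triangle2[of "poly (r m) z" "poly (q n) z" "f z"]
          by (simp add: dist_norm)
      qed
      then show ?thesis using e by (simp add: dist_norm poly_op_diff)
    qed
    then show ?thesis by blast
  qed
  have "Cauchy (\<lambda>n. poly_op (q n) A)"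
    by (rule metric_CauchyI) (rule close[OF qs])
  then obtain X where X: "(\<lambda>n. poly_op (q n) A) \<longlonglongrightarrow> X"
    using Cauchy_convergent_iff convergent_def by blast
  have all: "(\<lambda>n. poly_op (r n) A) \<longlonglongrightarrow> X"
    if r: "uniform_limit (spectrum A) (\<lambda>n. poly (r n)) f sequentially" for r
  proof -
    have "(\<lambda>n. poly_op (r n) A - poly_op (q n) A) \<longlonglongrightarrow> 0"
    proof (rule metric_LIMSEQ_I)
      fix e :: real assume "0 < e"
      from close[OF r this] show "\<exists>no. \<forall>n\<ge>no. dist (poly_op (r n) A - poly_op (q n) A) 0 < e"
        by (auto simp: dist_norm)
    qed
    from tendsto_add[OF this X] show ?thesis by simp
  qed
  have "cfc f A = X" unfolding cfc_def
    by (rule the_equality) (use all LIMSEQ_unique qs in blast)+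
  then show ?thesis using X by simp
qed

text \<open>Real coefficients make each approximant of a self-adjoint operator self-adjoint, so that
  self-adjointness passes to the limit.\<close>

lemma real_poly_approx:
  fixes g :: "real \<Rightarrow> real"
  assumes g: "continuous_on {l..u} g"
  obtains q where "\<And>n. map_poly cnj (q n) = q n"
    "uniform_limit (complex_of_real ` {l..u}) (\<lambda>n. poly (q n)) (\<lambda>z. complex_of_real (g (Re z))) sequentially"
proof -
  obtain h where h: "uniform_limit {l..u} h g sequentially" "\<And>n. polynomial_function (h n)"
    using Stone_Weierstrass_uniform_limit[OF _ g] by blast
  have "\<exists>q. map_poly cnj q = q \<and> (\<forall>x. poly q (complex_of_real x) = complex_of_real (h n x))" for n
  proof -
    obtain a N where a: "h n = (\<lambda>x. \<Sum>i\<le>N. a i * x ^ i)"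
      using h(2)[of n] real_polynomial_function_iff_sum real_polynomial_function_eq by metis
    show ?thesis
      by (intro exI[of _ "\<Sum>i\<le>N. monom (complex_of_real (a i)) i"])
        (auto intro!: poly_eqI simp: coeff_map_poly coeff_sum a poly_sum poly_monom)
  qed
  then obtain q where q: "\<And>n. map_poly cnj (q n) = q n"
    "\<And>n x. poly (q n) (complex_of_real x) = complex_of_real (h n x)" by metis
  have "uniform_limit (complex_of_real ` {l..u}) (\<lambda>n. poly (q n)) (\<lambda>z. complex_of_real (g (Re z))) sequentially"
  proof (rule uniform_limitI)
    fix e :: real assume "0 < e"
    from uniform_limitD[OF h(1) this]
    show "\<forall>\<^sub>F n in sequentially. \<forall>z\<in>complex_of_real ` {l..u}. dist (poly (q n) z) (complex_of_real (g (Re z))) < e"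
      by eventually_elim (auto simp: q(2) dist_norm simp flip: of_real_diff)
  qed
  then show thesis using that q(1) by blast
qed

context
  fixes l u A assumes A: "op_between l u A"
begin

text \<open>This brings a complex function into the form covered by \<open>real_poly_approx\<close>;
  agreement on an interval around the spectrum is enough.\<close>

lemma cfc_cong: "(\<And>x. x \<in> {l..u} \<Longrightarrow> f (complex_of_real x) = complex_of_real (g x))
    \<Longrightarrow> continuous_on {l..u} g \<Longrightarrow> cfc f A = cfc (\<lambda>z. complex_of_real (g (Re z))) A"
proof -
  assume f: "\<And>x. x \<in> {l..u} \<Longrightarrow> f (complex_of_real x) = complex_of_real (g x)"
    and "continuous_on {l..u} g"
  then obtain q where q: "uniform_limit (complex_of_real ` {l..u}) (\<lambda>n. poly (q n))
      (\<lambda>z. complex_of_real (g (Re z))) sequentially" using real_poly_approx by metis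
  moreover then have "uniform_limit (complex_of_real ` {l..u}) (\<lambda>n. poly (q n)) f sequentially"
    by (rule uniform_limit_cong'[THEN iffD1, rotated -1]) (auto simp: f)
  ultimately show ?thesis using cfc_LIMSEQ[OF A] LIMSEQ_unique by blast
qed

lemma self_adjoint_cfc: "continuous_on {l..u} g \<Longrightarrow> self_adjoint (cfc (\<lambda>z. complex_of_real (g (Re z))) A)"
proof -
  assume "continuous_on {l..u} g"
  then obtain q where q: "\<And>n. map_poly cnj (q n) = q n"
    "uniform_limit (complex_of_real ` {l..u}) (\<lambda>n. poly (q n)) (\<lambda>z. complex_of_real (g (Re z))) sequentially"
    using real_poly_approx by metis
  have "self_adjoint (poly_op (q n) A)" for n
    using poly_op_adjoint[of A "q n"] A by (simp add: self_adjoint_iff op_between_def q(1))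
  then show ?thesis using cfc_LIMSEQ[OF A q(2)] by (rule self_adjoint_limit)
qed

text \<open>Polynomials multiply under \<open>poly_op\<close>; compactness of the interval bounds
  both functions, so that products of uniform limits converge uniformly.\<close>

lemma cfc_mult:
  assumes g: "continuous_on {l..u} g" and h: "continuous_on {l..u} h"
  shows "cfc (\<lambda>z. complex_of_real (g (Re z))) A * cfc (\<lambda>z. complex_of_real (h (Re z))) A
    = cfc (\<lambda>z. complex_of_real (g (Re z) * h (Re z))) A"
proof -
  let ?S = "complex_of_real ` {l..u}"
  obtain q where q: "uniform_limit ?S (\<lambda>n. poly (q n)) (\<lambda>z. complex_of_real (g (Re z))) sequentially"
    using real_poly_approx[OF g] by metis
  obtain r where r: "uniform_limit ?S (\<lambda>n. poly (r n)) (\<lambda>z. complex_of_real (h (Re z))) sequentially"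
    using real_poly_approx[OF h] by metis
  have bdd: "bounded ((\<lambda>z. complex_of_real (k (Re z))) ` ?S)" if "continuous_on {l..u} k" for k
  proof -
    have "compact ((\<lambda>x. complex_of_real (k x)) ` {l..u})"
      by (intro compact_continuous_image continuous_intros that) auto
    then show ?thesis by (simp add: image_image compact_imp_bounded)
  qed
  have "uniform_limit ?S (\<lambda>n z. poly (q n) z * poly (r n) z)
      (\<lambda>z. complex_of_real (g (Re z)) * complex_of_real (h (Re z))) sequentially"
    by (rule uniform_lim_mult[OF q r bdd[OF g] bdd[OF h]])
  then have "uniform_limit ?S (\<lambda>n. poly (q n * r n)) (\<lambda>z. complex_of_real (g (Re z) * h (Re z))) sequentially"
    by (simp add: poly_mult[abs_def])
  from cfc_LIMSEQ[OF A this] show ?thesis unfolding poly_op_mult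
    using tendsto_mult[OF cfc_LIMSEQ[OF A q] cfc_LIMSEQ[OF A r]] LIMSEQ_unique by blast
qed

lemma cfc_id: "cfc (\<lambda>z. complex_of_real (Re z)) A = A"
proof -
  have "uniform_limit (complex_of_real ` {l..u}) (\<lambda>n. poly [:0, 1:]) (\<lambda>z. complex_of_real (Re z)) sequentially"
    by (rule uniform_limitI) auto
  from cfc_LIMSEQ[OF A this] show ?thesis
    by (simp add: poly_op_pCons scaleC_l2op_simps LIMSEQ_const_iff)
qed

lemma cfc_one: "cfc (\<lambda>z. complex_of_real 1) A = 1"
proof -
  have "uniform_limit (complex_of_real ` {l..u}) (\<lambda>n. poly [:1:]) (\<lambda>z. complex_of_real 1) sequentially"
    by (rule uniform_limitI) auto
  from cfc_LIMSEQ[OF A this] show ?thesis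
    by (simp add: poly_op_pCons scaleC_l2op_simps LIMSEQ_const_iff)
qed

end

section \<open>Powers and the geometric mean of positive definite operators\<close>

lemma op_powr_eq_cfc:
  assumes "op_between l u A" "0 < l"
  shows "op_powr A t = cfc (\<lambda>z. complex_of_real (Re z powr t)) A"
  unfolding op_powr_def
  by (rule cfc_cong[OF assms(1)]) (use assms(2) in \<open>auto simp: powr_of_real intro!: continuous_intros\<close>)

lemma continuous_on_powr_pos: "0 < l \<Longrightarrow> continuous_on {l..u} (\<lambda>x. x powr t :: real)"
  by (auto intro!: continuous_intros)

lemma op_powr_add:
  assumes "positive_definite A" shows "op_powr A s * op_powr A t = op_powr A (s + t)"
proof -
  obtain l u where lu: "0 < l" "op_between l u A" using posdef_between[OF assms] by metis
  show ?thesis unfolding op_powr_eq_cfc[OF lu(2,1)]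
    by (subst cfc_mult[OF lu(2)]) (auto simp: powr_add continuous_on_powr_pos lu)
qed

lemma op_powr_one: assumes "positive_definite A" shows "op_powr A 1 = A"
proof -
  obtain l u where lu: "0 < l" "op_between l u A" using posdef_between[OF assms] by metis
  have "op_powr A 1 = cfc (\<lambda>z. complex_of_real (Re z)) A" unfolding op_powr_def
    by (rule cfc_cong[OF lu(2)]) (use lu in \<open>auto intro!: continuous_intros\<close>)
  then show ?thesis using cfc_id[OF lu(2)] by simp
qed

lemma op_powr_zero: assumes "positive_definite A" shows "op_powr A 0 = 1"
proof -
  obtain l u where lu: "0 < l" "op_between l u A" using posdef_between[OF assms] by metis
  have "op_powr A 0 = cfc (\<lambda>z. complex_of_real 1) A" unfolding op_powr_def
    by (rule cfc_cong[OF lu(2)]) (use lu in \<open>auto intro!: continuous_intros\<close>)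
  then show ?thesis using cfc_one[OF lu(2)] by simp
qed

lemma op_powr_inverse:
  assumes "positive_definite A"
  shows "op_powr A t * op_powr A (- t) = 1" "op_powr A (- t) * op_powr A t = 1"
  by (simp_all add: op_powr_add op_powr_zero assms)

lemma self_adjoint_op_powr: assumes "positive_definite A" shows "self_adjoint (op_powr A t)"
proof -
  obtain l u where lu: "0 < l" "op_between l u A" using posdef_between[OF assms] by metis
  show ?thesis unfolding op_powr_eq_cfc[OF lu(2,1)]
    by (rule self_adjoint_cfc[OF lu(2)]) (use lu in \<open>auto simp: continuous_on_powr_pos\<close>)
qed

lemma posdef_one: "positive_definite 1"
  unfolding posdef_iff
  by (auto intro!: exI[of _ 1] self_adjoint_intros simp: loewner_le_def)

text \<open>The left inverse \<open>V\<close> bounds \<open>R\<close> below, which transports the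
  lower bound of the form of \<open>B\<close>.\<close>

lemma posdef_sandwich:
  assumes R: "self_adjoint R" and V: "V * R = 1" and B: "positive_definite B"
  shows "positive_definite (R * B * R)"
proof -
  obtain g where g: "0 < g" "\<And>v. g * (norm v)\<^sup>2 \<le> inner v (op_apply B v)"
    using positive_definiteE[OF B] by blast
  obtain c where c: "c > 0" "\<And>v. c * norm v \<le> norm (op_apply R v)"
    using bounded_below_left_inverse[OF V] unfolding bounded_below_def by blast
  have "(g * c\<^sup>2) * (norm v)\<^sup>2 \<le> inner v (op_apply (R * B * R) v)" for v
  proof -
    have "(c * norm v)\<^sup>2 \<le> (norm (op_apply R v))\<^sup>2" using c by (intro power_mono) auto
    then have "g * (c\<^sup>2 * (norm v)\<^sup>2) \<le> g * (norm (op_apply R v))\<^sup>2"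
      using g(1) by (simp add: power_mult_distrib)
    also have "\<dots> \<le> inner (op_apply R v) (op_apply B (op_apply R v))" by (rule g(2))
    finally show ?thesis by (simp add: mult.assoc self_adjointD[OF R])
  qed
  moreover have "g * c\<^sup>2 > 0" using g c by simp
  ultimately show ?thesis unfolding positive_definite_def Re_cinner
    using self_adjoint_sandwich[OF R posdef_self_adjoint[OF B]] by blast
qed

text \<open>A power is the square of its half power, hence a congruence of the identity by an
  invertible self-adjoint operator.\<close>

lemma posdef_op_powr: assumes "positive_definite A" shows "positive_definite (op_powr A t)"
proof -
  have "positive_definite (op_powr A (t/2) * 1 * op_powr A (t/2))"
    by (rule posdef_sandwich[OF self_adjoint_op_powr op_powr_inverse(2) posdef_one])
      (rule assms)+
  then show ?thesis by (simp add: op_powr_add assms)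
qed

section \<open>Loewner order under congruence, square roots and inversion\<close>

lemma loewner_sandwich: "self_adjoint R \<Longrightarrow> A \<sqsubseteq> B \<Longrightarrow> R * A * R \<sqsubseteq> R * B * R"
  unfolding loewner_le_def by (simp flip: self_adjointD)

lemma posdef_add:
  assumes A: "positive_definite A" and B: "positive_definite B"
  shows "positive_definite (A + B)"
proof -
  obtain a b where ab: "0 < a" "a *\<^sub>R 1 \<sqsubseteq> A" "0 < b" "b *\<^sub>R 1 \<sqsubseteq> B"
    using A B unfolding posdef_iff by blast
  then have "(a + b) *\<^sub>R 1 \<sqsubseteq> A + B"
    unfolding loewner_le_def by (simp add: inner_simps distrib_right add_mono)
  then show ?thesis
    using A B ab by (auto simp: posdef_iff intro!: self_adjoint_intros exI[of _ "a + b"])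
qed

lemma posdef_scaleR:
  assumes A: "positive_definite A" and r: "0 < r"
  shows "positive_definite (r *\<^sub>R A)"
proof -
  obtain a where a: "0 < a" "a *\<^sub>R 1 \<sqsubseteq> A" using A unfolding posdef_iff by blast
  then have "(r * a) *\<^sub>R 1 \<sqsubseteq> r *\<^sub>R A" using loewner_scaleR[of "a *\<^sub>R 1" A r] r by simp
  then show ?thesis
    using A a r by (auto simp: posdef_iff intro!: self_adjoint_intros exI[of _ "r * a"])
qed

text \<open>With \<open>D = Y - X\<close> and \<open>S = X + Y\<close> the hypothesis reads \<open>SD + DS \<ge> 0\<close>, so that
  \<open>\<langle>Sv, (D + \<mu>)v\<rangle> \<ge> \<mu>\<langle>Sv, v\<rangle>\<close> and no \<open>- \<mu> < 0\<close> is an approximate eigenvalue of \<open>D\<close>.\<close>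

lemma loewner_le_of_squares:
  assumes X: "self_adjoint X" and Y: "self_adjoint Y" and S: "positive_definite (X + Y)"
    and le: "X * X \<sqsubseteq> Y * Y"
  shows "X \<sqsubseteq> Y"
proof -
  define D where "D = Y - X"
  define M where "M = norm D"
  have D: "self_adjoint D" unfolding D_def by (intro self_adjoint_intros X Y)
  have bet: "op_between (- M) M D"
    unfolding op_between_def
  proof (intro conjI D)
    show "D \<sqsubseteq> M *\<^sub>R 1" unfolding M_def by (rule loewner_le_norm)
    show "- M *\<^sub>R 1 \<sqsubseteq> D" unfolding loewner_le_def
    proof
      fix v show "inner v (op_apply (- M *\<^sub>R 1) v) \<le> inner v (op_apply D v)"
        using inner_op_le[of v D] by (simp add: M_def power2_norm_eq_inner)
    qed
  qed
  note spec = op_between_spectrum[OF bet]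
  obtain g where g: "0 < g" "\<And>v. g * (norm v)\<^sup>2 \<le> inner v (op_apply (X + Y) v)"
    using positive_definiteE[OF S] by blast
  have "spectrum D \<subseteq> \<real>" using spec by auto
  \<comment> \<open>The polynomial \<open>M - x\<close> is largest at the low end of the spectrum:
    once its extremal point \<open>t\<close> is nonnegative,
    \<open>norm (M *\<^sub>R 1 - D) \<le> M\<close>, which says that \<open>D\<close> has
    nonnegative form.\<close>
  then obtain z where z: "\<not> bounded_below (D - z *\<^sub>C 1)"
    "norm (poly_op [:complex_of_real M, -1:] D) \<le> cmod (poly [:complex_of_real M, -1:] z)"
    using norm_poly_op_attained[OF D, of "[:complex_of_real M, -1:]"] by auto
  obtain t where t: "z = complex_of_real t" "t \<le> M"
    using not_bounded_below_in_spectrum[OF z(1)] spec by auto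
  have SD: "0 \<le> inner (op_apply (X + Y) v) (op_apply D v)" for v
  proof -
    have "inner v (op_apply X (op_apply X v)) \<le> inner v (op_apply Y (op_apply Y v))"
      using loewner_leD[OF le, of v] by simp
    then have "inner (op_apply X v) (op_apply X v) \<le> inner (op_apply Y v) (op_apply Y v)"
      using self_adjointD[OF X, of v "op_apply X v"] self_adjointD[OF Y, of v "op_apply Y v"] by simp
    then show ?thesis unfolding D_def
      using inner_commute[of "op_apply X v" "op_apply Y v"]
      by (simp add: inner_add_left inner_diff_right)
  qed
  have "t \<ge> 0"
  proof (rule ccontr)
    assume "\<not> t \<ge> 0"
    define m where "m = - t"
    have m: "m > 0" using \<open>\<not> t \<ge> 0\<close> by (simp add: m_def)
    \<comment> \<open>An upper bound for \<open>norm (X + Y)\<close> to divide by after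
      Cauchy-Schwarz; the 1 keeps it positive.\<close>
    define s where "s = norm (X + Y) + 1"
    have s: "s > 0" by (simp add: s_def add_nonneg_pos)
    have "m * g / s * norm v \<le> norm (op_apply (D - z *\<^sub>C 1) v)" for v
    proof (cases "v = 0")
      case False
      let ?w = "op_apply (D - z *\<^sub>C 1) v"
      have w: "?w = op_apply D v + m *\<^sub>R v" by (simp add: t m_def scaleC_of_real_ell2)
      have "m * (g * (norm v)\<^sup>2) \<le> m * inner v (op_apply (X + Y) v)"
        using m g(2) by (intro mult_left_mono) auto
      also have "\<dots> \<le> inner (op_apply (X + Y) v) ?w"
        using SD[of v] inner_commute[of v "op_apply (X + Y) v"] unfolding w by (simp add: inner_add_right)
      also have "\<dots> \<le> norm (op_apply (X + Y) v) * norm ?w" by (rule norm_cauchy_schwarz)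
      also have "\<dots> \<le> s * norm v * norm ?w"
      proof (rule mult_right_mono)
        have "norm (op_apply (X + Y) v) \<le> norm (X + Y) * norm v" by (rule norm_op_apply_le)
        also have "\<dots> \<le> s * norm v" unfolding s_def by (intro mult_right_mono) auto
        finally show "norm (op_apply (X + Y) v) \<le> s * norm v" .
      qed simp
      finally have "norm v * (m * g * norm v) \<le> norm v * (norm ?w * s)"
        by (simp add: power2_eq_square mult_ac)
      then have "m * g * norm v \<le> norm ?w * s" using False by simp
      then show ?thesis using s by (simp add: field_simps)
    qed simp
    moreover have "m * g / s > 0" using m g s by simp
    ultimately show False using z(1) unfolding bounded_below_def by blast
  qed
  then have "norm (M *\<^sub>R 1 - D) \<le> M"
  proof -
    have "poly_op [:complex_of_real M, -1:] D = M *\<^sub>R 1 - D"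
      by (simp add: poly_op_pCons scaleC_l2op_simps)
    moreover have "cmod (poly [:complex_of_real M, -1:] z) \<le> M"
      using \<open>t \<ge> 0\<close> t by (simp flip: of_real_diff)
    ultimately show ?thesis using z(2) by simp
  qed
  then have "inner v (op_apply (M *\<^sub>R 1 - D) v) \<le> M * (norm v)\<^sup>2" for v
    using inner_op_le[of v "M *\<^sub>R 1 - D"] by (meson abs_le_D1 mult_right_mono order_trans zero_le_power2)
  then show ?thesis unfolding loewner_le_def D_def
    by (simp add: inner_simps power2_norm_eq_inner)
qed

text \<open>The form of \<open>A\<close> at \<open>?y - ?w\<close> is nonnegative. Expanding it,
  \<open>A \<sqsubseteq> C\<close> bounds the last term by \<open>inner v ?w\<close>, which cancels
  one of the two mixed terms.\<close>

lemma loewner_inverse_antitone: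
  assumes A: "positive_definite A" and le: "A \<sqsubseteq> C" and A': "A * A' = 1" and C': "C * C' = 1"
  shows "C' \<sqsubseteq> A'"
  unfolding loewner_le_def
proof
  fix v
  let ?w = "op_apply C' v" and ?y = "op_apply A' v"
  have w: "op_apply C ?w = v" using arg_cong[OF C', of "\<lambda>B. op_apply B v"] by simp
  have y: "op_apply A ?y = v" using arg_cong[OF A', of "\<lambda>B. op_apply B v"] by simp
  have "0 \<le> inner (?y - ?w) (op_apply A (?y - ?w))"
    using positive_definiteE[OF A] by (metis mult_nonneg_nonneg less_imp_le order_trans zero_le_power2)
  also have "\<dots> = inner v ?y - 2 * inner v ?w + inner ?w (op_apply A ?w)"
    using self_adjointD[OF posdef_self_adjoint[OF A], of ?y ?w]
    using inner_commute[of "?y" v] inner_commute[of ?w v]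
    by (simp add: inner_diff_left inner_diff_right y)
  also have "\<dots> \<le> inner v ?y - 2 * inner v ?w + inner ?w (op_apply C ?w)"
    using loewner_leD[OF le, of ?w] by simp
  finally show "inner v ?w \<le> inner v ?y" by (simp add: w inner_commute)
qed

text \<open>The geometric mean of \<open>A\<close> and \<open>B\<close> is the positive definite solution of \<open>X A\<^sup>-\<^sup>1 X = B\<close>.\<close>

definition riccati :: "l2op \<Rightarrow> l2op \<Rightarrow> l2op \<Rightarrow> bool" where
  "riccati A B X \<longleftrightarrow> positive_definite A \<and> positive_definite X \<and>
     (\<exists>A'. A' * A = 1 \<and> A * A' = 1 \<and> X * A' * X = B)"

text \<open>With \<open>R * R\<close> as the inverse of \<open>A\<close>, the inner factors
  \<open>S * R\<close> and \<open>R * S\<close> cancel and leave \<open>S * (Q * Q) * S\<close>,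
  which is \<open>B\<close>.\<close>

lemma riccati_gm:
  assumes A: "positive_definite A" and B: "positive_definite B"
  shows "riccati A B (op_gm (1/2) A B)"
proof -
  define S R where "S = op_powr A (1/2)" and "R = op_powr A (-1/2)"
  have SR: "S * R = 1" "R * S = 1" using op_powr_inverse[OF A, of "1/2"] by (simp_all add: S_def R_def)
  have SS: "S * S = A" by (simp add: S_def op_powr_add op_powr_one A)
  have sa: "self_adjoint S" "self_adjoint R" unfolding S_def R_def by (simp_all add: self_adjoint_op_powr A)
  have RBR: "positive_definite (R * B * R)"
    by (rule posdef_sandwich[OF sa(2) SR(1) B])
  define Q where "Q = op_powr (R * B * R) (1/2)"
  have Q: "positive_definite Q" unfolding Q_def by (rule posdef_op_powr[OF RBR])
  have QQ: "Q * Q = R * B * R" by (simp add: Q_def op_powr_add op_powr_one RBR)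
  have gm: "op_gm (1/2) A B = S * Q * S" by (simp add: op_gm_def S_def R_def Q_def)
  have "R * R * A = 1" "A * (R * R) = 1" unfolding SS[symmetric]
    by (metis SR mult.assoc mult.left_neutral)+
  moreover have "S * Q * S * (R * R) * (S * Q * S) = B"
  proof -
    have "S * Q * S * (R * R) * (S * Q * S) = S * Q * (S * R) * (R * S) * Q * S"
      by (simp only: mult.assoc)
    also have "\<dots> = S * (Q * Q) * S" by (simp only: SR mult_1_right mult.assoc)
    also have "\<dots> = (S * R) * B * (R * S)" by (simp only: QQ mult.assoc)
    finally show ?thesis by (simp add: SR)
  qed
  moreover have "positive_definite (S * Q * S)"
    by (rule posdef_sandwich[OF sa(1) SR(2) Q])
  ultimately show ?thesis unfolding riccati_def gm using A by blast
qed

text \<open>Antitone inversion gives \<open>X * C' * X \<sqsubseteq> X * A' * X\<close>, that is, at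
  most \<open>B\<close>, hence at most \<open>D = Y * C' * Y\<close>. Congruence by
  \<open>W\<close>, a square root of \<open>C'\<close>, turns both ends into squares, to which
  \<open>loewner_le_of_squares\<close> applies.\<close>

lemma riccati_mono:
  assumes X: "riccati A B X" and Y: "riccati C D Y" and AC: "A \<sqsubseteq> C" and BD: "B \<sqsubseteq> D"
  shows "X \<sqsubseteq> Y"
proof -
  obtain A' where A': "A' * A = 1" "A * A' = 1" "X * A' * X = B" and A: "positive_definite A"
    and pX: "positive_definite X"
    using X unfolding riccati_def by blast
  obtain C' where C': "C' * C = 1" "C * C' = 1" "Y * C' * Y = D" and C: "positive_definite C"
    and pY: "positive_definite Y"
    using Y unfolding riccati_def by blast
  define V W where "V = op_powr C (1/2)" and "W = op_powr C (-1/2)"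
  have VW: "V * W = 1" "W * V = 1" using op_powr_inverse[OF C, of "1/2"] by (simp_all add: V_def W_def)
  have VV: "V * V = C" by (simp add: V_def op_powr_add op_powr_one C)
  have sa: "self_adjoint V" "self_adjoint W" unfolding V_def W_def by (simp_all add: self_adjoint_op_powr C)
  note saX = posdef_self_adjoint[OF pX]
  have "C' = C' * (V * V) * (W * W)"
    by (metis VW mult.assoc mult.right_neutral)
  then have WW: "W * W = C'" using C'(1) VV by simp
  have "W * (X * C' * X) * W \<sqsubseteq> W * (X * A' * X) * W"
    by (intro loewner_sandwich sa saX loewner_inverse_antitone[OF A AC A'(2) C'(2)])
  also have "W * (X * A' * X) * W = W * B * W" by (simp only: A'(3))
  finally have "W * (X * C' * X) * W \<sqsubseteq> W * D * W"
    using loewner_trans loewner_sandwich[OF sa(2) BD] by blast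
  moreover have "(W * X * W) * (W * X * W) = W * (X * C' * X) * W"
    by (simp only: WW[symmetric] mult.assoc)
  moreover have "(W * Y * W) * (W * Y * W) = W * D * W"
    by (simp only: WW[symmetric] C'(3)[symmetric] mult.assoc)
  moreover have pd: "positive_definite (W * X * W)" "positive_definite (W * Y * W)"
    using posdef_sandwich[OF sa(2) VW(1)] pX pY by blast+
  ultimately have "(W * X * W) * (W * X * W) \<sqsubseteq> (W * Y * W) * (W * Y * W)" by presburger
  then have "W * X * W \<sqsubseteq> W * Y * W"
    by (rule loewner_le_of_squares[OF pd[THEN posdef_self_adjoint] posdef_add[OF pd]])
  then have "V * (W * X * W) * V \<sqsubseteq> V * (W * Y * W) * V"
    by (rule loewner_sandwich[OF sa(1)])
  moreover have "V * (W * Z * W) * V = Z" for Z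
  proof -
    have "V * (W * Z * W) * V = (V * W) * Z * (W * V)" by (simp only: mult.assoc)
    then show ?thesis by (simp add: VW)
  qed
  ultimately show ?thesis by simp
qed

text \<open>Homogeneity of degree 1/2 in each argument, with factors written as exponentials to
  match the Thompson metric.\<close>

lemma riccati_scaleR:
  assumes "riccati A B X"
  shows "riccati (exp r *\<^sub>R A) (exp s *\<^sub>R B) (exp ((r + s) / 2) *\<^sub>R X)"
proof -
  obtain A' where A': "A' * A = 1" "A * A' = 1" "X * A' * X = B"
    using assms unfolding riccati_def by blast
  have e: "exp (- r) * exp r = (1 :: real)" by (simp flip: exp_add)
  have "exp ((r + s) / 2) * (exp (- r) * exp ((r + s) / 2)) = exp s"
    by (simp flip: exp_add) (simp add: field_simps)
  then have "(exp ((r + s) / 2) *\<^sub>R X) * (exp (- r) *\<^sub>R A') * (exp ((r + s) / 2) *\<^sub>R X) = exp s *\<^sub>R B"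
    using A' by (simp add: mult_ac)
  then show ?thesis using assms A' e unfolding riccati_def
    by (intro conjI posdef_scaleR exI[of _ "exp (- r) *\<^sub>R A'"]) (auto simp: mult.commute)
qed

lemma loewner_antisym: "self_adjoint A \<Longrightarrow> self_adjoint B \<Longrightarrow> A \<sqsubseteq> B \<Longrightarrow> B \<sqsubseteq> A \<Longrightarrow> A = B"
proof -
  assume sa: "self_adjoint A" "self_adjoint B" and "A \<sqsubseteq> B" "B \<sqsubseteq> A"
  then have "inner v (op_apply (A - B) v) = 0" for v
    using loewner_leD[of A B v] loewner_leD[of B A v] by (simp add: inner_diff_right)
  then have "norm (A - B) \<le> 0"
    by (intro norm_self_adjoint_le self_adjoint_intros sa) auto
  then show ?thesis by simp
qed

lemma posdef_gm: "positive_definite A \<Longrightarrow> positive_definite B \<Longrightarrow> positive_definite (op_gm (1/2) A B)"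
  using riccati_gm unfolding riccati_def by blast

text \<open>\<open>A\<close> itself solves the equation, and \<open>riccati_mono\<close> in both
  directions makes the solution unique.\<close>

lemma op_gm_idem: assumes A: "positive_definite A" shows "op_gm (1/2) A A = A"
proof -
  obtain A' where A': "A' * A = 1" "A * A' = 1" using posdef_inverse[OF A] by blast
  have r: "riccati A A A" unfolding riccati_def using A A' by (auto intro!: exI[of _ A'])
  have refl: "A \<sqsubseteq> A" by (simp add: loewner_le_def)
  show ?thesis
    using riccati_mono[OF r riccati_gm[OF A A] refl refl] riccati_mono[OF riccati_gm[OF A A] r refl refl]
    by (intro loewner_antisym posdef_self_adjoint posdef_gm A)
qed

lemma op_gm_one: assumes A: "positive_definite A" and B: "positive_definite B" shows "op_gm 1 A B = B"
proof -
  define S R where "S = op_powr A (1/2)" and "R = op_powr A (-1/2)"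
  have SR: "S * R = 1" "R * S = 1" using op_powr_inverse[OF A, of "1/2"] by (simp_all add: S_def R_def)
  have "positive_definite (R * B * R)"
    by (rule posdef_sandwich[OF _ SR(1) B]) (simp add: R_def self_adjoint_op_powr A)
  then have "op_gm 1 A B = S * (R * B * R) * S"
    unfolding op_gm_def S_def[symmetric] R_def[symmetric] by (simp add: op_powr_one)
  also have "\<dots> = (S * R) * B * (R * S)" by (simp only: mult.assoc)
  finally show ?thesis by (simp add: SR)
qed

section \<open>The Thompson metric\<close>

text \<open>The least factor by which each operator dominates the other, on the logarithmic scale;
  \<open>0 \<le> r\<close> keeps the set bounded below for arbitrary arguments.\<close>

definition thompson :: "l2op \<Rightarrow> l2op \<Rightarrow> real" where
  "thompson A B = Inf {r. 0 \<le> r \<and> A \<sqsubseteq> exp r *\<^sub>R B \<and> B \<sqsubseteq> exp r *\<^sub>R A}"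

lemma thompson_le: "0 \<le> r \<Longrightarrow> A \<sqsubseteq> exp r *\<^sub>R B \<Longrightarrow> B \<sqsubseteq> exp r *\<^sub>R A \<Longrightarrow> thompson A B \<le> r"
  unfolding thompson_def by (rule cInf_lower) (auto intro: bdd_belowI)

lemma thompson_sym: "thompson A B = thompson B A"
  unfolding thompson_def by (rule arg_cong[where f = Inf]) auto

lemma posdef_inner_pos: "positive_definite A \<Longrightarrow> v \<noteq> 0 \<Longrightarrow> 0 < inner v (op_apply A v)"
proof -
  assume A: "positive_definite A" and v: "v \<noteq> 0"
  obtain g where "0 < g" "\<And>v. g * (norm v)\<^sup>2 \<le> inner v (op_apply A v)"
    using positive_definiteE[OF A] by blast
  moreover then have "0 < g * (norm v)\<^sup>2" using v by simp
  ultimately show ?thesis using order_less_le_trans by blast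
qed

lemma posdef_inner_nonneg: "positive_definite A \<Longrightarrow> 0 \<le> inner v (op_apply A v)"
  using posdef_inner_pos[of A v] by (cases "v = 0") auto

lemma loewner_le_exp:
  assumes "positive_definite A" "positive_definite B"
  obtains r where "0 \<le> r" "A \<sqsubseteq> exp r *\<^sub>R B"
proof -
  obtain b where b: "0 < b" "\<And>v. b * (norm v)\<^sup>2 \<le> inner v (op_apply B v)"
    using positive_definiteE[OF assms(2)] by blast
  define r where "r = norm A / b"
  have r: "0 \<le> r" using b by (simp add: r_def)
  have "inner v (op_apply A v) \<le> exp r * inner v (op_apply B v)" for v
  proof -
    have "inner v (op_apply A v) \<le> norm A * (norm v)\<^sup>2" using inner_op_le[of v A] by simp
    also have "\<dots> = r * (b * (norm v)\<^sup>2)" using b by (simp add: r_def)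
    also have "\<dots> \<le> exp r * inner v (op_apply B v)"
    proof (intro mult_mono b)
      show "r \<le> exp r" using exp_ge_add_one_self[of r] by linarith
    qed (use b in auto)
    finally show ?thesis .
  qed
  then show thesis using that r by (simp add: loewner_le_def)
qed

lemma loewner_exp_mono:
  assumes "A \<sqsubseteq> exp r *\<^sub>R B" "r \<le> s" "positive_definite B" shows "A \<sqsubseteq> exp s *\<^sub>R B"
  unfolding loewner_le_def
proof
  fix v
  have "inner v (op_apply A v) \<le> exp r * inner v (op_apply B v)"
    using loewner_leD[OF assms(1), of v] by simp
  also have "\<dots> \<le> exp s * inner v (op_apply B v)"
    using assms(2) posdef_inner_nonneg[OF assms(3)] by (intro mult_right_mono) auto
  finally show "inner v (op_apply A v) \<le> inner v (op_apply (exp s *\<^sub>R B) v)" by simp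
qed

text \<open>For each single vector the condition on \<open>r\<close> is a closed one,
  \<open>ln (?p / ?q) \<le> r\<close>, and therefore survives the infimum.\<close>

lemma thompson_attained:
  assumes A: "positive_definite A" and B: "positive_definite B"
  shows "0 \<le> thompson A B" "A \<sqsubseteq> exp (thompson A B) *\<^sub>R B" "B \<sqsubseteq> exp (thompson A B) *\<^sub>R A"
proof -
  let ?T = "{r. 0 \<le> r \<and> A \<sqsubseteq> exp r *\<^sub>R B \<and> B \<sqsubseteq> exp r *\<^sub>R A}"
  obtain r s where "0 \<le> r" "A \<sqsubseteq> exp r *\<^sub>R B" "0 \<le> s" "B \<sqsubseteq> exp s *\<^sub>R A"
    using loewner_le_exp A B by metis
  then have "max r s \<in> ?T" using loewner_exp_mono A B by auto
  then have ne: "?T \<noteq> {}" by blast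
  show "0 \<le> thompson A B" unfolding thompson_def by (rule cInf_greatest[OF ne]) auto
  have *: "P \<sqsubseteq> exp (thompson A B) *\<^sub>R Q" if P: "positive_definite P" and Q: "positive_definite Q"
    and T: "\<And>r. r \<in> ?T \<Longrightarrow> P \<sqsubseteq> exp r *\<^sub>R Q" for P Q
    unfolding loewner_le_def
  proof
    fix v show "inner v (op_apply P v) \<le> inner v (op_apply (exp (thompson A B) *\<^sub>R Q) v)"
    proof (cases "v = 0")
      case False
      let ?p = "inner v (op_apply P v)" and ?q = "inner v (op_apply Q v)"
      have pq: "0 < ?p" "0 < ?q" using posdef_inner_pos P Q False by auto
      have ln_le: "ln x \<le> r \<longleftrightarrow> x \<le> exp r" if "0 < x" for x r :: real
        using that by (metis exp_le_cancel_iff exp_ln)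
      have "ln (?p / ?q) \<le> thompson A B" unfolding thompson_def
      proof (rule cInf_greatest[OF ne])
        fix r assume "r \<in> ?T"
        from loewner_leD[OF T[OF this], of v] have "?p / ?q \<le> exp r"
          using pq by (simp add: field_simps)
        then show "ln (?p / ?q) \<le> r" using pq by (simp only: ln_le divide_pos_pos)
      qed
      then have "?p / ?q \<le> exp (thompson A B)" using pq by (simp only: ln_le divide_pos_pos)
      then show ?thesis using pq by (simp add: field_simps)
    qed simp
  qed
  show "A \<sqsubseteq> exp (thompson A B) *\<^sub>R B" "B \<sqsubseteq> exp (thompson A B) *\<^sub>R A"
    by (rule *; use A B in auto)+
qed

lemma thompson_self: "thompson A A = 0" if "positive_definite A"
  using thompson_le[of 0 A A] thompson_attained(1)[OF that that] by (simp add: loewner_le_def)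

lemma loewner_exp_trans:
  assumes "A \<sqsubseteq> exp r *\<^sub>R B" "B \<sqsubseteq> exp s *\<^sub>R C" shows "A \<sqsubseteq> exp (r + s) *\<^sub>R C"
  using loewner_trans[OF assms(1) loewner_scaleR[OF assms(2), of "exp r"]] by (simp add: exp_add)

lemma thompson_triangle:
  assumes A: "positive_definite A" and B: "positive_definite B" and C: "positive_definite C"
  shows "thompson A C \<le> thompson A B + thompson B C"
proof (rule thompson_le)
  show "0 \<le> thompson A B + thompson B C" using thompson_attained(1) A B C by simp
  show "A \<sqsubseteq> exp (thompson A B + thompson B C) *\<^sub>R C"
    by (rule loewner_exp_trans) (rule thompson_attained A B C)+
  show "C \<sqsubseteq> exp (thompson A B + thompson B C) *\<^sub>R A"
    by (subst add.commute, rule loewner_exp_trans) (rule thompson_attained A B C)+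
qed

text \<open>Each argument is dominated by a scaled copy of its partner; monotonicity compares the
  means and homogeneity averages the two exponents.\<close>

lemma thompson_gm:
  assumes A: "positive_definite A" and B: "positive_definite B" and C: "positive_definite C" and D: "positive_definite D"
  shows "thompson (op_gm (1/2) A B) (op_gm (1/2) C D) \<le> (thompson A C + thompson B D) / 2"
proof (rule thompson_le)
  show "0 \<le> (thompson A C + thompson B D) / 2" using thompson_attained(1) A B C D by simp
  show "op_gm (1/2) A B \<sqsubseteq> exp ((thompson A C + thompson B D) / 2) *\<^sub>R op_gm (1/2) C D"
    by (rule riccati_mono[OF riccati_gm[OF A B] riccati_scaleR[OF riccati_gm[OF C D]]])
      (rule thompson_attained A B C D)+
  show "op_gm (1/2) C D \<sqsubseteq> exp ((thompson A C + thompson B D) / 2) *\<^sub>R op_gm (1/2) A B"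
    by (rule riccati_mono[OF riccati_gm[OF C D] riccati_scaleR[OF riccati_gm[OF A B]]])
      (rule thompson_attained A B C D)+
qed

lemma norm_diff_le_thompson:
  assumes A: "positive_definite A" and B: "positive_definite B"
  shows "norm (A - B) \<le> (exp (thompson A B) - 1) * norm B"
proof (rule norm_self_adjoint_le)
  let ?d = "thompson A B"
  show "self_adjoint (A - B)" by (intro self_adjoint_intros posdef_self_adjoint A B)
  have d: "0 \<le> ?d" by (rule thompson_attained(1)[OF A B])
  then show "0 \<le> (exp ?d - 1) * norm B" by simp
  fix v
  let ?a = "inner v (op_apply A v)" and ?b = "inner v (op_apply B v)"
  have b: "0 \<le> ?b" "?b \<le> norm B * (norm v)\<^sup>2"
    using posdef_inner_nonneg[OF B] inner_op_le[of v B] by auto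
  have "?a - ?b \<le> (exp ?d - 1) * ?b"
    using loewner_leD[OF thompson_attained(2)[OF A B], of v] by (simp add: left_diff_distrib)
  moreover have "?b - ?a \<le> (exp ?d - 1) * ?b"
  proof -
    have "exp (- ?d) * ?b \<le> exp (- ?d) * (exp ?d * ?a)"
      using loewner_leD[OF thompson_attained(3)[OF A B], of v] by (intro mult_left_mono) auto
    then have "exp (- ?d) * ?b \<le> ?a" by (simp add: exp_minus field_simps)
    \<comment> \<open>Adding the tangent bounds at \<open>?d\<close> and \<open>- ?d\<close> gives
      \<open>2 \<le> exp ?d + exp (- ?d)\<close>; so the estimate from below costs no more than the
      one from above.\<close>
    moreover have "1 - exp (- ?d) \<le> exp ?d - 1"
      using exp_ge_add_one_self[of ?d] exp_ge_add_one_self[of "- ?d"] by linarith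
    then have "(1 - exp (- ?d)) * ?b \<le> (exp ?d - 1) * ?b" using b by (intro mult_right_mono) auto
    ultimately show ?thesis by (simp add: left_diff_distrib)
  qed
  moreover have "(exp ?d - 1) * ?b \<le> (exp ?d - 1) * norm B * (norm v)\<^sup>2"
    using b(2) d by (simp add: mult.assoc mult_left_mono)
  ultimately show "\<bar>inner v (op_apply (A - B) v)\<bar> \<le> (exp ?d - 1) * norm B * (norm v)\<^sup>2"
    by (simp add: inner_diff_right)
qed

text \<open>The common lower bound \<open>g\<close> turns an absolute error into a relative one, and
  \<open>1 + r \<le> exp r\<close> turns that into an exponent.\<close>

lemma thompson_le_norm_diff:
  assumes A: "\<And>v. g * (norm v)\<^sup>2 \<le> inner v (op_apply A v)"
    and B: "\<And>v. g * (norm v)\<^sup>2 \<le> inner v (op_apply B v)" and g: "0 < g"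
  shows "thompson A B \<le> norm (A - B) / g"
proof (rule thompson_le)
  show "0 \<le> norm (A - B) / g" using g by simp
  have *: "P \<sqsubseteq> exp (norm (P - Q) / g) *\<^sub>R Q" if Q: "\<And>v. g * (norm v)\<^sup>2 \<le> inner v (op_apply Q v)" for P Q
    unfolding loewner_le_def
  proof
    fix v
    let ?r = "norm (P - Q) / g"
    have "inner v (op_apply P v) - inner v (op_apply Q v) \<le> norm (P - Q) * (norm v)\<^sup>2"
      using inner_op_le[of v "P - Q"] by (simp add: inner_diff_right)
    also have "\<dots> = ?r * (g * (norm v)\<^sup>2)" using g by simp
    also have "\<dots> \<le> ?r * inner v (op_apply Q v)" using g by (intro mult_left_mono Q) auto
    finally have "inner v (op_apply P v) \<le> (1 + ?r) * inner v (op_apply Q v)" by (simp add: distrib_right)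
    also have "\<dots> \<le> exp ?r * inner v (op_apply Q v)"
    proof (intro mult_right_mono exp_ge_add_one_self)
      show "0 \<le> inner v (op_apply Q v)" using Q[of v] g by (meson less_imp_le mult_nonneg_nonneg order_trans zero_le_power2)
    qed
    finally show "inner v (op_apply P v) \<le> inner v (op_apply (exp ?r *\<^sub>R Q) v)" by simp
  qed
  show "A \<sqsubseteq> exp (norm (A - B) / g) *\<^sub>R B" by (rule *[OF B])
  show "B \<sqsubseteq> exp (norm (A - B) / g) *\<^sub>R A" using *[OF A, of B] by (simp add: norm_minus_commute)
qed

lemma thompson_tendsto_imp_LIMSEQ:
  assumes "\<And>k. positive_definite (X k)" "positive_definite L" "(\<lambda>k. thompson (X k) L) \<longlonglongrightarrow> 0"
  shows "X \<longlonglongrightarrow> L"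
proof -
  have "(\<lambda>k. (exp (thompson (X k) L) - 1) * norm L) \<longlonglongrightarrow> (exp 0 - 1) * norm L"
    by (intro tendsto_intros assms)
  then have "(\<lambda>k. (exp (thompson (X k) L) - 1) * norm L) \<longlonglongrightarrow> 0" by simp
  then have "(\<lambda>k. X k - L) \<longlonglongrightarrow> 0"
    by (rule Lim_null_comparison[OF always_eventually, rotated]) (intro allI norm_diff_le_thompson assms)
  then show ?thesis by (simp add: LIM_zero_iff)
qed

text \<open>The total Thompson displacement is at most \<open>2 * C\<close>, which bounds all
  \<open>X k\<close> above in norm and below in form. The steps are then summable in norm, and the
  uniform lower bound converts the norm limit back into a Thompson limit.\<close>

lemma thompson_complete:
  assumes X: "\<And>k. positive_definite (X k)"
    and step: "\<And>k. thompson (X k) (X (Suc k)) \<le> C * (1/2) ^ k"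
  shows "\<exists>L. positive_definite L \<and> (\<lambda>k. thompson (X k) L) \<longlonglongrightarrow> 0"
proof -
  note tri = thompson_triangle[OF X X X] and nn = thompson_attained(1)[OF X X]
  have C0: "0 \<le> C" using order_trans[OF nn step[of 0]] by simp
  \<comment> \<open>The second factor is the partial sum of the geometric series with ratio
    1/2.\<close>
  have "thompson (X 0) (X k) \<le> C * (2 - 2 * (1/2) ^ k)" for k
  proof (induction k)
    case (Suc k)
    have "thompson (X 0) (X (Suc k)) \<le> C * (2 - 2 * (1/2) ^ k) + C * (1/2) ^ k"
      using tri[of 0 "Suc k" k] Suc step[of k] by linarith
    also have "\<dots> = C * (2 - 2 * (1/2) ^ Suc k)" by (simp add: algebra_simps)
    finally show ?case .
  qed (simp add: thompson_self X)
  then have d0: "thompson (X 0) (X k) \<le> 2 * C" for k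
  proof -
    assume a: "\<And>k. thompson (X 0) (X k) \<le> C * (2 - 2 * (1/2) ^ k)"
    have "C * (2 - 2 * (1/2) ^ k) \<le> C * 2" using C0 by (intro mult_left_mono) auto
    then show ?thesis using a[of k] by simp
  qed
  define M where "M = (exp (2 * C)) * norm (X 0)"
  have M: "norm (X k) \<le> M" for k
  proof -
    have "norm (X k) \<le> norm (X k - X 0) + norm (X 0)" using norm_triangle_sub[of "X k" "X 0"] by simp
    also have "\<dots> \<le> exp (thompson (X k) (X 0)) * norm (X 0)"
      using norm_diff_le_thompson[OF X X, of k 0] by (simp add: left_diff_distrib)
    also have "\<dots> \<le> M" unfolding M_def
      using d0[of k] by (intro mult_right_mono) (auto simp: thompson_sym[of "X k"])
    finally show ?thesis .
  qed
  obtain g0 where g0: "0 < g0" "\<And>v. g0 * (norm v)\<^sup>2 \<le> inner v (op_apply (X 0) v)"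
    using positive_definiteE[OF X] by blast
  define g where "g = exp (- (2 * C)) * g0"
  have g: "0 < g" using g0 by (simp add: g_def)
  \<comment> \<open>Each \<open>X k\<close> dominates \<open>exp (- (2 * C)) *\<^sub>R X 0\<close>;
    this uniform bound is what keeps the limit positive definite.\<close>
  have gX: "g * (norm v)\<^sup>2 \<le> inner v (op_apply (X k) v)" for k v
  proof -
    have "inner v (op_apply (X 0) v) \<le> exp (2 * C) * inner v (op_apply (X k) v)"
      using loewner_leD[OF loewner_exp_mono[OF thompson_attained(2)[OF X X] d0 X], of v] by simp
    then have "g0 * (norm v)\<^sup>2 \<le> exp (2 * C) * inner v (op_apply (X k) v)"
      using g0(2)[of v] by linarith
    then have "exp (- (2 * C)) * (g0 * (norm v)\<^sup>2) \<le> exp (- (2 * C)) * (exp (2 * C) * inner v (op_apply (X k) v))"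
      by (intro mult_left_mono) auto
    then show ?thesis by (simp add: g_def exp_minus field_simps)
  qed
  have "norm (X (Suc k) - X k) \<le> exp C * M * C * (1/2) ^ k" for k
  proof -
    define d where "d = thompson (X (Suc k)) (X k)"
    have d: "0 \<le> d" "d \<le> C * (1/2) ^ k" using nn step[of k] by (auto simp: d_def thompson_sym)
    have "C * (1/2) ^ k \<le> C" using C0 by (simp add: mult_left_le power_le_one)
    then have dC: "d \<le> C" using d by simp
    have "1 + (- d) \<le> exp (- d)" by (rule exp_ge_add_one_self)
    then have "exp d * (1 - d) \<le> exp d * exp (- d)" by (intro mult_left_mono) auto
    then have "exp d - 1 \<le> exp d * d" by (simp add: algebra_simps flip: exp_add)
    also have "\<dots> \<le> exp C * (C * (1/2) ^ k)" using d dC by (intro mult_mono) auto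
    finally have "(exp d - 1) * norm (X k) \<le> exp C * (C * (1/2) ^ k) * M"
      using M[of k] C0 by (intro mult_mono) auto
    then show ?thesis using norm_diff_le_thompson[OF X X, of "Suc k" k]
      by (simp add: d_def mult_ac)
  qed
  note ineq = this
  have "summable (\<lambda>k. exp C * M * C * (1/2) ^ k)"
    by (rule summable_mult, rule summable_geometric) simp
  then have "summable (\<lambda>k. X (Suc k) - X k)"
    by (rule summable_comparison_test'[where N = 0]) (rule ineq)
  then have "convergent (\<lambda>n. \<Sum>k<n. X (Suc k) - X k)" by (simp add: summable_iff_convergent)
  then obtain L0 where "(\<lambda>n. \<Sum>k<n. X (Suc k) - X k) \<longlonglongrightarrow> L0" by (auto simp: convergent_def)
  then have "(\<lambda>n. X n - X 0) \<longlonglongrightarrow> L0" by (simp add: sum_lessThan_telescope)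
  from tendsto_add[OF this tendsto_const[of "X 0"]] obtain L where L: "X \<longlonglongrightarrow> L" by auto
  have gL: "g * (norm v)\<^sup>2 \<le> inner v (op_apply L v)" for v
    by (rule LIMSEQ_le_const[OF tendsto_inner[OF tendsto_const tendsto_op_apply[OF L]]])
      (use gX in auto)
  have "positive_definite L" unfolding positive_definite_def Re_cinner
    using self_adjoint_limit[OF posdef_self_adjoint[OF X] L] g gL by blast
  moreover have "(\<lambda>k. thompson (X k) L) \<longlonglongrightarrow> 0"
  proof (rule Lim_null_comparison[OF always_eventually])
    show "\<forall>k. norm (thompson (X k) L) \<le> norm (X k - L) / g"
      using thompson_le_norm_diff[OF gX gL g] thompson_attained(1)[OF X \<open>positive_definite L\<close>] by simp
    have "(\<lambda>k. norm (X k - L)) \<longlonglongrightarrow> 0" using L by (simp add: LIM_zero tendsto_norm_zero)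
    then show "(\<lambda>k. norm (X k - L) / g) \<longlonglongrightarrow> 0" using tendsto_divide[OF _ tendsto_const, of _ 0 _ g] g by simp
  qed
  ultimately show ?thesis by blast
qed

section \<open>Convergence of the iteration in a metric space with a midpoint mean\<close>

lemma length_delete_nth: "i < length xs \<Longrightarrow> length (delete_nth i xs) = length xs - 1"
  by (simp add: delete_nth_def)

lemma nth_delete_nth:
  "i < length xs \<Longrightarrow> l < length xs - 1 \<Longrightarrow> delete_nth i xs ! l = xs ! (if l < i then l else Suc l)"
  by (auto simp: delete_nth_def nth_append)

lemma set_delete_nth: "set (delete_nth i xs) \<subseteq> set xs"
  by (auto simp: delete_nth_def dest: in_set_takeD in_set_dropD)

lemma delete_nth_replicate: "i < Suc n \<Longrightarrow> delete_nth i (replicate (Suc n) x) = replicate n x"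
  by (rule nth_equalityI) (simp_all add: length_delete_nth nth_delete_nth del: replicate_Suc)

lemma map_delete_nth: "map f (delete_nth i xs) = delete_nth i (map f xs)"
  by (simp add: delete_nth_def take_map drop_map)

text \<open>The index map is that of \<open>nth_delete_nth\<close>, so this evaluates sums over a
  list with one entry removed.\<close>

lemma sum_skip:
  fixes f :: "nat \<Rightarrow> real"
  shows "i \<le> n \<Longrightarrow> (\<Sum>l<n. f (if l < i then l else Suc l)) = (\<Sum>j<Suc n. f j) - f i"
proof (induction n)
  case (Suc n)
  show ?case
  proof (cases "i \<le> n")
    case True
    then show ?thesis using Suc(1) by simp
  next
    case False
    then have "i = Suc n" using Suc(2) by simp
    then show ?thesis by simp
  qed
qed simp

lemma length_mean_iter [simp]: "length (mean_iter m s M As k) = length As"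
  by (induction k) (simp_all add: Let_def)

lemma nth_mean_iter_Suc:
  "i < length As \<Longrightarrow> mean_iter m s M As (Suc k) ! i
     = m s (mean_iter m s M As k ! i) (M (delete_nth i (mean_iter m s M As k)))"
  by (simp add: Let_def)

text \<open>These are the weights of a mean of \<open>n + 2\<close> variables.\<close>

abbreviation ones_half :: "nat \<Rightarrow> real list" where "ones_half n \<equiv> replicate n 1 @ [1/2]"

lemma gmean_Suc:
  "gmean m (ones_half (Suc n)) As
    = (THE L. \<forall>i<length As. (\<lambda>k. mean_iter m 1 (gmean m (ones_half n)) As k ! i) \<longlonglongrightarrow> L)"
  by (cases n) simp_all

text \<open>The metric is kept apart from the topology of the type, in which \<open>gmean\<close>
  takes its limits; \<open>d_LIMSEQ\<close> connects them. Completeness is asked only for steps that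
  decay geometrically, which is how the iteration converges.\<close>

locale alm_space =
  fixes P :: "'a :: t2_space set" and d :: "'a \<Rightarrow> 'a \<Rightarrow> real" and m :: "real \<Rightarrow> 'a \<Rightarrow> 'a \<Rightarrow> 'a"
  assumes d_nonneg: "x \<in> P \<Longrightarrow> y \<in> P \<Longrightarrow> 0 \<le> d x y"
    and d_self: "x \<in> P \<Longrightarrow> d x x = 0"
    and d_sym: "d x y = d y x"
    and d_tri: "x \<in> P \<Longrightarrow> y \<in> P \<Longrightarrow> z \<in> P \<Longrightarrow> d x z \<le> d x y + d y z"
    and d_complete: "(\<And>k. X k \<in> P) \<Longrightarrow> (\<And>k. d (X k) (X (Suc k)) \<le> C * (1/2) ^ k) \<Longrightarrow>
      \<exists>L\<in>P. (\<lambda>k. d (X k) L) \<longlonglongrightarrow> 0"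
    and d_LIMSEQ: "(\<And>k. X k \<in> P) \<Longrightarrow> L \<in> P \<Longrightarrow> (\<lambda>k. d (X k) L) \<longlonglongrightarrow> 0 \<Longrightarrow> X \<longlonglongrightarrow> L"
    and m_one: "x \<in> P \<Longrightarrow> y \<in> P \<Longrightarrow> m 1 x y = y"
    and m_half_in: "x \<in> P \<Longrightarrow> y \<in> P \<Longrightarrow> m (1/2) x y \<in> P"
    and m_half_idem: "x \<in> P \<Longrightarrow> m (1/2) x x = x"
    and m_half_contr: "x \<in> P \<Longrightarrow> y \<in> P \<Longrightarrow> x' \<in> P \<Longrightarrow> y' \<in> P \<Longrightarrow>
      d (m (1/2) x y) (m (1/2) x' y') \<le> (d x x' + d y y') / 2"
begin

text \<open>The invariant of the induction on the number of variables; its last clause is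
  contraction by \<open>1 / N\<close> in each argument, multiplied out.\<close>

definition contracting_mean :: "nat \<Rightarrow> ('a list \<Rightarrow> 'a) \<Rightarrow> bool" where
  "contracting_mean N M \<longleftrightarrow>
     (\<forall>As. length As = N \<and> set As \<subseteq> P \<longrightarrow> M As \<in> P) \<and>
     (\<forall>x\<in>P. M (replicate N x) = x) \<and>
     (\<forall>As Bs. length As = N \<and> length Bs = N \<and> set As \<subseteq> P \<and> set Bs \<subseteq> P \<longrightarrow>
        real N * d (M As) (M Bs) \<le> (\<Sum>i<N. d (As ! i) (Bs ! i)))"

context
  fixes N :: nat and M :: "'a list \<Rightarrow> 'a"
  assumes N: "2 \<le> N" and M: "contracting_mean N M"
begin

abbreviation iter :: "'a list \<Rightarrow> nat \<Rightarrow> 'a list" where "iter \<equiv> mean_iter m 1 M"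

lemma M_in: "length As = N \<Longrightarrow> set As \<subseteq> P \<Longrightarrow> M As \<in> P"
  and M_idem: "x \<in> P \<Longrightarrow> M (replicate N x) = x"
  and M_contr: "length As = N \<Longrightarrow> length Bs = N \<Longrightarrow> set As \<subseteq> P \<Longrightarrow> set Bs \<subseteq> P \<Longrightarrow>
        real N * d (M As) (M Bs) \<le> (\<Sum>i<N. d (As ! i) (Bs ! i))"
  using M unfolding contracting_mean_def by blast+

lemma iter_in: "length As = Suc N \<Longrightarrow> set As \<subseteq> P \<Longrightarrow> set (iter As k) \<subseteq> P"
proof (induction k)
  case (Suc k)
  let ?B = "iter As k"
  have B: "set ?B \<subseteq> P" using Suc by blast
  have "iter As (Suc k) ! i \<in> P" if "i < Suc N" for i
  proof -
    have "M (delete_nth i ?B) \<in> P"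
      using that Suc(2) B set_delete_nth[of i ?B] by (intro M_in) (auto simp: length_delete_nth)
    moreover have "?B ! i \<in> P" using B that Suc(2) by (auto intro: nth_mem)
    ultimately show ?thesis using that Suc(2) by (simp add: nth_mean_iter_Suc m_one del: mean_iter.simps)
  qed
  then show ?case using Suc(2) by (auto simp: in_set_conv_nth simp del: mean_iter.simps)
qed simp

context
  fixes As assumes len: "length As = Suc N" and As: "set As \<subseteq> P"
begin

lemma iter_nth_in: "i < Suc N \<Longrightarrow> iter As k ! i \<in> P"
  using iter_in[OF len As, of k] len by (auto intro: nth_mem)

lemma iter_delete:
  assumes "i < Suc N"
  shows "length (delete_nth i (iter As k)) = N" "set (delete_nth i (iter As k)) \<subseteq> P"
  using assms len iter_in[OF len As, of k] set_delete_nth by (force simp: length_delete_nth)+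

lemma iter_Suc: "i < Suc N \<Longrightarrow> iter As (Suc k) ! i = M (delete_nth i (iter As k))"
  using iter_nth_in iter_delete by (simp add: nth_mean_iter_Suc len m_one M_in del: mean_iter.simps)

lemma nth_iter_delete:
  "i < Suc N \<Longrightarrow> l < N \<Longrightarrow> delete_nth i (iter As k) ! l
     = iter As k ! (if l < i then l else Suc l)"
  by (simp add: nth_delete_nth len)

text \<open>Deleting the entry \<open>i\<close> or the entry \<open>i + 1\<close> gives lists that differ in one position only,
  so distances of adjacent entries shrink by the factor \<open>1 / N\<close>.\<close>

lemma iter_adjacent:
  assumes i: "i < N"
  shows "d (iter As k ! i) (iter As k ! Suc i)
    \<le> (\<Sum>l<N. d (As ! l) (As ! Suc l)) * (1/2) ^ k"
proof (induction k)
  case 0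
  have "\<And>l. l < N \<Longrightarrow> 0 \<le> d (As ! l) (As ! Suc l)"
    using As len by (intro d_nonneg) (auto intro!: nth_mem[THEN subsetD[OF As]])
  then show ?case using i by (auto intro!: member_le_sum)
next
  case (Suc k)
  let ?B = "iter As k"
  have "real N * d (M (delete_nth i ?B)) (M (delete_nth (Suc i) ?B))
      \<le> (\<Sum>l<N. d (delete_nth i ?B ! l) (delete_nth (Suc i) ?B ! l))"
    using i by (intro M_contr iter_delete) auto
  also have "\<dots> = (\<Sum>l<N. if l = i then d (?B ! Suc i) (?B ! i) else 0)"
  proof (intro sum.cong refl)
    fix l assume l: "l \<in> {..<N}"
    consider "l < i" | "l = i" | "i < l" by linarith
    then show "d (delete_nth i ?B ! l) (delete_nth (Suc i) ?B ! l)
        = (if l = i then d (?B ! Suc i) (?B ! i) else 0)"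
      by cases (use i l in \<open>simp_all add: nth_iter_delete d_self iter_nth_in\<close>)
  qed
  also have "\<dots> = d (?B ! i) (?B ! Suc i)" using i by (simp add: d_sym)
  also have "\<dots> \<le> (\<Sum>l<N. d (As ! l) (As ! Suc l)) * (1/2) ^ k" by (rule Suc)
  finally have *: "real N * d (iter As (Suc k) ! i) (iter As (Suc k) ! Suc i)
      \<le> (\<Sum>l<N. d (As ! l) (As ! Suc l)) * (1/2) ^ k"
    using i by (simp only: iter_Suc less_SucI Suc_less_eq)
  \<comment> \<open>Here \<open>1 / N\<close> is weakened to the rate 1/2 of
    \<open>d_complete\<close>.\<close>
  have "2 * d (iter As (Suc k) ! i) (iter As (Suc k) ! Suc i)
      \<le> real N * d (iter As (Suc k) ! i) (iter As (Suc k) ! Suc i)"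
    using N i by (intro mult_right_mono d_nonneg iter_nth_in) auto
  with * show ?case by (simp del: mean_iter.simps)
qed

text \<open>At most \<open>N\<close> adjacent steps join two entries.\<close>

lemma iter_diameter:
  obtains C where "0 \<le> C"
    "\<And>i j k. i < Suc N \<Longrightarrow> j < Suc N \<Longrightarrow> d (iter As k ! i) (iter As k ! j) \<le> C * (1/2) ^ k"
proof
  let ?D = "\<Sum>l<N. d (As ! l) (As ! Suc l)"
  have D: "0 \<le> ?D" using len by (intro sum_nonneg d_nonneg) (auto intro!: nth_mem[THEN subsetD[OF As]])
  then show "0 \<le> real N * ?D" by simp
  have *: "d (iter As k ! i) (iter As k ! j) \<le> real (j - i) * (?D * (1/2) ^ k)"
    if "i \<le> j" "j < Suc N" for i j k
    using that
  proof (induction j rule: dec_induct)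
    case base
    then show ?case by (simp add: d_self iter_nth_in)
  next
    case (step j)
    have "d (iter As k ! i) (iter As k ! Suc j)
        \<le> d (iter As k ! i) (iter As k ! j)
          + d (iter As k ! j) (iter As k ! Suc j)"
      using step by (intro d_tri iter_nth_in) auto
    also have "\<dots> \<le> real (j - i) * (?D * (1/2) ^ k) + ?D * (1/2) ^ k"
      using step by (intro add_mono iter_adjacent) auto
    also have "\<dots> = real (Suc j - i) * (?D * (1/2) ^ k)"
      using step by (simp add: Suc_diff_le distrib_right)
    finally show ?case .
  qed
  have **: "d (iter As k ! i) (iter As k ! j) \<le> real N * ?D * (1/2) ^ k"
    if "i \<le> j" "j < Suc N" for i j k
  proof -
    have "real (j - i) * (?D * (1/2) ^ k) \<le> real N * (?D * (1/2) ^ k)"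
      using that D by (intro mult_right_mono) auto
    then show ?thesis using *[OF that, of k] by (simp add: mult.assoc)
  qed
  fix i j k assume "i < Suc N" "j < Suc N"
  then show "d (iter As k ! i) (iter As k ! j) \<le> real N * ?D * (1/2) ^ k"
    using **[of i j k] **[of j i k] d_sym by (cases "i \<le> j") auto
qed

lemma iter_limit:
  "\<exists>L\<in>P. \<forall>i<Suc N. (\<lambda>k. d (iter As k ! i) L) \<longlonglongrightarrow> 0"
proof -
  obtain C where C: "0 \<le> C" "\<And>i j k. i < Suc N \<Longrightarrow> j < Suc N \<Longrightarrow>
      d (iter As k ! i) (iter As k ! j) \<le> C * (1/2) ^ k"
    using iter_diameter by blast
  have step: "d (iter As k ! 0) (iter As (Suc k) ! 0) \<le> C * (1/2) ^ k" for k
  proof -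
    let ?B = "iter As k"
    have B0: "?B ! 0 \<in> P" by (rule iter_nth_in) simp
    \<comment> \<open>By idempotence the old entry is itself a mean of \<open>N\<close> copies, so
      contraction compares it with the new entry; the error is the diameter of the current
      list.\<close>
    have "real N * d (M (delete_nth 0 ?B)) (M (replicate N (?B ! 0)))
        \<le> (\<Sum>l<N. d (delete_nth 0 ?B ! l) (replicate N (?B ! 0) ! l))"
      using B0 by (intro M_contr iter_delete) auto
    also have "\<dots> \<le> (\<Sum>l<N. C * (1/2) ^ k)"
      by (intro sum_mono) (auto simp: nth_iter_delete intro!: C)
    finally have "real N * d (iter As (Suc k) ! 0) (?B ! 0) \<le> real N * (C * (1/2) ^ k)"
      using B0 by (simp add: iter_Suc M_idem del: mean_iter.simps)
    then show ?thesis using N d_sym by (simp del: mean_iter.simps)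
  qed
  have "\<exists>L\<in>P. (\<lambda>k. d (iter As k ! 0) L) \<longlonglongrightarrow> 0"
    by (rule d_complete[OF iter_nth_in step]) simp
  then obtain L where L: "L \<in> P" "(\<lambda>k. d (iter As k ! 0) L) \<longlonglongrightarrow> 0" by blast
  have "(\<lambda>k. d (iter As k ! i) L) \<longlonglongrightarrow> 0" if i: "i < Suc N" for i
  proof (rule Lim_null_comparison[OF always_eventually])
    show "\<forall>k. norm (d (iter As k ! i) L) \<le> C * (1/2) ^ k + d (iter As k ! 0) L"
    proof
      fix k
      have "d (iter As k ! i) L
          \<le> d (iter As k ! i) (iter As k ! 0) + d (iter As k ! 0) L"
        using i L(1) by (intro d_tri iter_nth_in) auto
      moreover have "0 \<le> d (iter As k ! i) L" using i L(1) by (intro d_nonneg iter_nth_in)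
      ultimately show "norm (d (iter As k ! i) L) \<le> C * (1/2) ^ k + d (iter As k ! 0) L"
        using C(2)[OF i, of 0 k] by simp
    qed
    have "(\<lambda>k. (1/2 :: real) ^ k) \<longlonglongrightarrow> 0" by (rule LIMSEQ_power_zero) simp
    from tendsto_add[OF tendsto_mult[OF tendsto_const this] L(2)]
    show "(\<lambda>k. C * (1/2) ^ k + d (iter As k ! 0) L) \<longlonglongrightarrow> 0" by simp
  qed
  then show ?thesis using L(1) by blast
qed

end

text \<open>\<open>G\<close> enters through its defining equation alone, to be supplied by
  \<open>gmean_Suc\<close>.\<close>

lemma iter_mean:
  assumes len: "length As = Suc N" and As: "set As \<subseteq> P"
    and G: "\<And>As. G As = (THE L. \<forall>i<length As. (\<lambda>k. iter As k ! i) \<longlonglongrightarrow> L)"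
  shows "G As \<in> P" "i < Suc N \<Longrightarrow> (\<lambda>k. d (iter As k ! i) (G As)) \<longlonglongrightarrow> 0"
    "i < Suc N \<Longrightarrow> (\<lambda>k. iter As k ! i) \<longlonglongrightarrow> G As"
proof -
  obtain L where L: "L \<in> P" "\<And>i. i < Suc N \<Longrightarrow> (\<lambda>k. d (iter As k ! i) L) \<longlonglongrightarrow> 0"
    using iter_limit[OF len As] by blast
  have lim: "(\<lambda>k. iter As k ! i) \<longlonglongrightarrow> L" if "i < Suc N" for i
    by (rule d_LIMSEQ[OF iter_nth_in[OF len As that] L(1) L(2)[OF that]])
  have "G As = L" unfolding G
    by (rule the_equality) (use lim len in \<open>auto dest!: spec[of _ 0] intro: LIMSEQ_unique\<close>)
  with L lim show "G As \<in> P" "i < Suc N \<Longrightarrow> (\<lambda>k. d (iter As k ! i) (G As)) \<longlonglongrightarrow> 0"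
    "i < Suc N \<Longrightarrow> (\<lambda>k. iter As k ! i) \<longlonglongrightarrow> G As" by auto
qed

text \<open>Each position survives in \<open>N\<close> of the \<open>N + 1\<close> deleted lists, so
  summing the contraction estimates gives back \<open>N\<close> times the total distance.\<close>

lemma iter_sum_mono:
  assumes "length As = Suc N" "set As \<subseteq> P" "length Bs = Suc N" "set Bs \<subseteq> P"
  shows "(\<Sum>i<Suc N. d (iter As k ! i) (iter Bs k ! i))
    \<le> (\<Sum>i<Suc N. d (As ! i) (Bs ! i))"
proof (induction k)
  case (Suc k)
  let ?A = "iter As k" and ?B = "iter Bs k"
  let ?f = "\<lambda>j. d (?A ! j) (?B ! j)"
  have "real N * d (iter As (Suc k) ! i) (iter Bs (Suc k) ! i)
      \<le> (\<Sum>j<Suc N. ?f j) - ?f i" if i: "i < Suc N" for i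
  proof -
    have "real N * d (M (delete_nth i ?A)) (M (delete_nth i ?B))
        \<le> (\<Sum>l<N. d (delete_nth i ?A ! l) (delete_nth i ?B ! l))"
      using i assms by (intro M_contr iter_delete)
    also have "\<dots> = (\<Sum>l<N. ?f (if l < i then l else Suc l))"
      using i assms by (intro sum.cong refl) (simp add: nth_iter_delete)
    also have "\<dots> = (\<Sum>j<Suc N. ?f j) - ?f i" using i by (intro sum_skip) simp
    finally show ?thesis using i assms by (simp only: iter_Suc)
  qed
  then have "(\<Sum>i<Suc N. real N * d (iter As (Suc k) ! i) (iter Bs (Suc k) ! i))
      \<le> (\<Sum>i<Suc N. (\<Sum>j<Suc N. ?f j) - ?f i)" by (intro sum_mono) blast
  also have "\<dots> = real N * (\<Sum>j<Suc N. ?f j)"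
    by (simp add: sum_subtractf algebra_simps del: sum.lessThan_Suc)
  finally have "real N * (\<Sum>i<Suc N. d (iter As (Suc k) ! i) (iter Bs (Suc k) ! i))
      \<le> real N * (\<Sum>j<Suc N. ?f j)" by (simp only: sum_distrib_left)
  then have "(\<Sum>i<Suc N. d (iter As (Suc k) ! i) (iter Bs (Suc k) ! i))
      \<le> (\<Sum>j<Suc N. ?f j)" by (rule mult_left_le_imp_le) (use N in simp)
  then show ?case using Suc by (rule order_trans)
qed simp

lemma contracting_mean_iter:
  assumes G: "\<And>As. G As = (THE L. \<forall>i<length As. (\<lambda>k. iter As k ! i) \<longlonglongrightarrow> L)"
  shows "contracting_mean (Suc N) G"
  unfolding contracting_mean_def
proof (intro conjI allI impI ballI)
  fix As assume "length As = Suc N \<and> set As \<subseteq> P"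
  then show "G As \<in> P" using iter_mean(1)[OF _ _ G] by blast
next
  fix x assume x: "x \<in> P"
  let ?R = "replicate (Suc N) x"
  have c: "iter ?R k = ?R" for k
  proof (induction k)
    case (Suc k)
    show ?case
      by (rule nth_equalityI)
        (use x in \<open>simp_all add: iter_Suc Suc delete_nth_replicate M_idem del: mean_iter.simps replicate_Suc\<close>)
  qed simp
  have "(\<lambda>k. iter ?R k ! 0) \<longlonglongrightarrow> G ?R"
    by (rule iter_mean(3)[OF _ _ G]) (use x in auto)
  then show "G ?R = x" unfolding c by (simp add: LIMSEQ_const_iff)
next
  fix As Bs assume *: "length As = Suc N \<and> length Bs = Suc N \<and> set As \<subseteq> P \<and> set Bs \<subseteq> P"
  then have As: "length As = Suc N" "set As \<subseteq> P" and Bs: "length Bs = Suc N" "set Bs \<subseteq> P" by auto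
  let ?S = "\<Sum>i<Suc N. d (As ! i) (Bs ! i)"
  \<comment> \<open>The cost of replacing iterates by their limits; it vanishes as \<open>k\<close>
    grows, and \<open>iter_sum_mono\<close> becomes the contraction bound for
    \<open>G\<close>.\<close>
  let ?e = "\<lambda>k. \<Sum>i<Suc N. d (iter As k ! i) (G As) + d (iter Bs k ! i) (G Bs)"
  show "real (Suc N) * d (G As) (G Bs) \<le> ?S"
  proof (rule LIMSEQ_le_const)
    have "?e \<longlonglongrightarrow> (\<Sum>i<Suc N. 0 + 0)"
      by (intro tendsto_sum tendsto_add iter_mean(2)[OF As G] iter_mean(2)[OF Bs G]) auto
    from tendsto_add[OF this tendsto_const[of ?S]] show "(\<lambda>k. ?e k + ?S) \<longlonglongrightarrow> ?S" by simp
    have "real (Suc N) * d (G As) (G Bs) \<le> ?e k + ?S" for k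
    proof -
      have "d (G As) (G Bs) \<le> (d (iter As k ! i) (G As) + d (iter Bs k ! i) (G Bs))
          + d (iter As k ! i) (iter Bs k ! i)" if i: "i < Suc N" for i
      proof -
        note A = iter_nth_in[OF As i, of k] and B = iter_nth_in[OF Bs i, of k]
          and GA = iter_mean(1)[OF As G] and GB = iter_mean(1)[OF Bs G]
        show ?thesis using d_tri[OF GA A GB] d_tri[OF A B GB] d_sym[of "G As" "iter As k ! i"]
          by linarith
      qed
      then have "(\<Sum>i<Suc N. d (G As) (G Bs))
          \<le> (\<Sum>i<Suc N. (d (iter As k ! i) (G As) + d (iter Bs k ! i) (G Bs))
          + d (iter As k ! i) (iter Bs k ! i))" by (intro sum_mono) blast
      also have "\<dots> \<le> ?e k + ?S"
        using iter_sum_mono[OF As Bs, of k] by (simp only: sum.distrib add_le_cancel_left)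
      finally show ?thesis by (simp del: sum.lessThan_Suc)
    qed
    then show "\<exists>K. \<forall>k\<ge>K. real (Suc N) * d (G As) (G Bs) \<le> ?e k + ?S" by blast
  qed
qed

end

lemma contracting_mean_gmean: "contracting_mean (n + 2) (gmean m (ones_half n))"
proof (induction n)
  case 0
  have *: "\<exists>x\<in>P. \<exists>y\<in>P. As = [x, y]" if "length As = 2" "set As \<subseteq> P" for As
    using that by (auto simp: length_Suc_conv numeral_2_eq_2)
  have r: "replicate 2 x = [x, x]" for x :: 'a by (simp add: numeral_2_eq_2)
  show ?case unfolding contracting_mean_def
  proof (intro conjI allI impI ballI)
    fix As assume "length As = 0 + 2 \<and> set As \<subseteq> P"
    then show "gmean m (ones_half 0) As \<in> P" using *[of As] by (auto simp: m_half_in)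
  next
    fix x assume "x \<in> P" then show "gmean m (ones_half 0) (replicate (0 + 2) x) = x"
      by (simp add: r m_half_idem)
  next
    fix As Bs assume "length As = 0 + 2 \<and> length Bs = 0 + 2 \<and> set As \<subseteq> P \<and> set Bs \<subseteq> P"
    then obtain x y x' y' where "x \<in> P" "y \<in> P" "x' \<in> P" "y' \<in> P" "As = [x, y]" "Bs = [x', y']"
      using *[of As] *[of Bs] by auto
    then show "real (0 + 2) * d (gmean m (ones_half 0) As) (gmean m (ones_half 0) Bs)
        \<le> (\<Sum>i<0 + 2. d (As ! i) (Bs ! i))"
      using m_half_contr[of x y x' y'] by (simp add: numeral_2_eq_2)
  qed
next
  case (Suc n)
  show ?case using contracting_mean_iter[OF _ Suc gmean_Suc] by simp
qed

lemma gmean_in: "length As = n + 2 \<Longrightarrow> set As \<subseteq> P \<Longrightarrow> gmean m (ones_half n) As \<in> P"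
  using contracting_mean_gmean[of n] unfolding contracting_mean_def by blast

lemma mean_iter_LIMSEQ_gmean:
  "length As = n + 3 \<Longrightarrow> set As \<subseteq> P \<Longrightarrow> i < n + 3 \<Longrightarrow>
    (\<lambda>k. mean_iter m 1 (gmean m (ones_half n)) As k ! i)
      \<longlonglongrightarrow> gmean m (ones_half (Suc n)) As"
  by (rule iter_mean(3)[OF _ contracting_mean_gmean _ _ gmean_Suc]) auto

end

section \<open>Compact operators\<close>

lemma compact_opI: "compact C \<Longrightarrow> op_apply A ` cball 0 1 \<subseteq> C \<Longrightarrow> compact_op A"
proof -
  assume C: "compact C" and sub: "op_apply A ` cball 0 1 \<subseteq> C"
  then have "closure (op_apply A ` cball 0 1) = C \<inter> closure (op_apply A ` cball 0 1)"
    using closure_minimal compact_imp_closed by blast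
  then show ?thesis unfolding compact_op_def using C by (metis closed_closure compact_Int_closed)
qed

lemma compact_op_zero: "compact_op 0"
  by (rule compact_opI[of "{0}"]) auto

lemma compact_op_image:
  assumes "compact_op A" obtains C where "compact C" "op_apply A ` cball 0 1 \<subseteq> C"
  by (rule that[OF _ closure_subset]) (use assms in \<open>simp add: compact_op_def\<close>)

lemma compact_op_add: assumes "compact_op A" "compact_op B" shows "compact_op (A + B)"
proof -
  obtain C where C: "compact C" "op_apply A ` cball 0 1 \<subseteq> C" using compact_op_image assms by blast
  obtain D where D: "compact D" "op_apply B ` cball 0 1 \<subseteq> D" using compact_op_image assms by blast
  show ?thesis
    by (rule compact_opI[OF compact_sums[OF C(1) D(1)]]) (use C D in \<open>auto simp: image_subset_iff\<close>)
qed

lemma compact_op_mult_left: assumes "compact_op K" shows "compact_op (A * K)"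
proof -
  obtain C where C: "compact C" "op_apply K ` cball 0 1 \<subseteq> C" using compact_op_image assms by blast
  have "compact (op_apply A ` C)"
    using C(1) linear_continuous_on[OF bounded_linear_op_apply] by (intro compact_continuous_image)
  then show ?thesis by (rule compact_opI) (use C in \<open>auto simp: image_subset_iff\<close>)
qed

lemma compact_op_scaleR: assumes "compact_op K" shows "compact_op (r *\<^sub>R K)"
  using compact_op_mult_left[OF assms, of "r *\<^sub>R 1"] by simp

lemma compact_op_diff: "compact_op A \<Longrightarrow> compact_op B \<Longrightarrow> compact_op (A - B)"
  using compact_op_add[of A "-1 *\<^sub>R B"] compact_op_scaleR[of B "-1"] by simp

lemma compact_op_mult_right: assumes "compact_op K" shows "compact_op (K * A)"
proof -
  \<comment> \<open>\<open>A\<close> maps the unit ball into the ball of radius \<open>s\<close>;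
    the scale is absorbed into \<open>K\<close>, and the 1 makes it invertible.\<close>
  define s where "s = norm A + 1"
  have s: "s > 0" by (simp add: s_def add_nonneg_pos)
  obtain C where C: "compact C" "op_apply (s *\<^sub>R K) ` cball 0 1 \<subseteq> C"
    using compact_op_image[OF compact_op_scaleR[OF assms]] by metis
  show ?thesis
  proof (rule compact_opI[OF C(1)], rule image_subsetI)
    fix x :: ell2 assume "x \<in> cball 0 1"
    then have "norm (op_apply A x) \<le> norm A * 1"
      by (intro order_trans[OF norm_op_apply_le] mult_left_mono) auto
    then have "norm (op_apply A x) \<le> s" by (simp add: s_def)
    then have "(1 / s) *\<^sub>R op_apply A x \<in> cball 0 1" using s by (simp add: field_simps)
    then have "op_apply (s *\<^sub>R K) ((1 / s) *\<^sub>R op_apply A x) \<in> C" using C(2) by blast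
    then show "op_apply (K * A) x \<in> C" using s by simp
  qed
qed

text \<open>A finite net for the image under a nearby \<open>X n\<close> is, with a larger radius, a
  net for the image under \<open>A\<close>: total boundedness passes to norm limits.\<close>

lemma compact_op_limit:
  assumes "\<And>n. compact_op (X n)" "X \<longlonglongrightarrow> A"
  shows "compact_op A"
proof -
  let ?S = "closure (op_apply A ` cball 0 1)"
  have "\<exists>F. finite F \<and> ?S \<subseteq> (\<Union>x\<in>F. ball x e)" if e: "e > 0" for e
  proof -
    obtain n where n: "norm (X n - A) < e / 4"
      using metric_LIMSEQ_D[OF assms(2), of "e/4"] e by (auto simp: dist_norm)
    have "compact (closure (op_apply (X n) ` cball 0 1))"
      using assms(1) by (simp add: compact_op_def)
    then obtain F where F: "finite F" "closure (op_apply (X n) ` cball 0 1) \<subseteq> (\<Union>x\<in>F. ball x (e/4))"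
      unfolding compact_eq_totally_bounded using e by (meson divide_pos_pos zero_less_numeral)
    have "op_apply A ` cball 0 1 \<subseteq> (\<Union>x\<in>F. cball x (e/2))"
    proof (rule image_subsetI)
      fix y :: ell2 assume y: "y \<in> cball 0 1"
      then have "op_apply (X n) y \<in> closure (op_apply (X n) ` cball 0 1)"
        by (intro subsetD[OF closure_subset] imageI)
      then obtain x where x: "x \<in> F" "dist x (op_apply (X n) y) < e / 4" using F(2) by auto
      have "norm (op_apply (X n - A) y) \<le> norm (X n - A) * 1"
        using y by (intro order_trans[OF norm_op_apply_le] mult_left_mono) auto
      then have "dist (op_apply (X n) y) (op_apply A y) < e / 4" using n by (simp add: dist_norm)
      then have "dist x (op_apply A y) < e / 2"
        using x(2) dist_triangle_half_r[of "op_apply (X n) y" x "e/2" "op_apply A y"]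
        by (simp add: dist_commute)
      then show "op_apply A y \<in> (\<Union>x\<in>F. cball x (e/2))" using x(1) by force
    qed
    \<comment> \<open>Closed balls of half the radius extend the cover to the closure.\<close>
    moreover have "closed (\<Union>x\<in>F. cball x (e/2))" using F(1) by (intro closed_UN) auto
    ultimately have "?S \<subseteq> (\<Union>x\<in>F. cball x (e/2))" by (rule closure_minimal)
    also have "\<dots> \<subseteq> (\<Union>x\<in>F. ball x e)" using e by fastforce
    finally show ?thesis using F(1) by blast
  qed
  then show ?thesis unfolding compact_op_def compact_eq_totally_bounded
    by (simp add: complete_eq_closed)
qed

section \<open>Fourier coefficients and matrices of operators\<close>

lemma fourier_coeff_has_integral:
  assumes "continuous_on {0..2 * pi} a"
  shows "((\<lambda>t. a t * exp (- (\<i> * of_int k * of_real t))) has_integral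
    of_real (2 * pi) * fourier_coeff a k) {0..2 * pi}"
proof -
  have "(\<lambda>t. a t * exp (- (\<i> * of_int k * of_real t))) integrable_on {0..2 * pi}"
    by (intro integrable_continuous_real continuous_intros assms)
  then show ?thesis by (simp add: fourier_coeff_def has_integral_integrable_integral)
qed

lemma fourier_coeff_unique:
  "((\<lambda>t. a t * exp (- (\<i> * of_int k * of_real t))) has_integral of_real (2 * pi) * c) {0..2 * pi}
    \<Longrightarrow> fourier_coeff a k = c"
  unfolding fourier_coeff_def by (subst integral_unique) auto

lemma fourier_coeff_add:
  "continuous_on {0..2 * pi} a \<Longrightarrow> continuous_on {0..2 * pi} b \<Longrightarrow>
    fourier_coeff (\<lambda>t. a t + b t) k = fourier_coeff a k + fourier_coeff b k"
  by (rule fourier_coeff_unique)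
    (use has_integral_add[OF fourier_coeff_has_integral[of a k] fourier_coeff_has_integral[of b k]]
      in \<open>simp add: distrib_left distrib_right\<close>)

lemma fourier_coeff_cmult: "fourier_coeff (\<lambda>t. c * a t) k = c * fourier_coeff a k"
  by (simp add: fourier_coeff_def mult.assoc)

lemma fourier_coeff_cong:
  "(\<And>t. t \<in> {0..2 * pi} \<Longrightarrow> a t = b t) \<Longrightarrow> fourier_coeff a k = fourier_coeff b k"
  unfolding fourier_coeff_def by (intro arg_cong2[where f = "(/)"] integral_cong refl) auto

lemma fourier_coeff_shift:
  "fourier_coeff (\<lambda>t. exp (\<i> * of_real t) * a t) k = fourier_coeff a (k - 1)"
  "fourier_coeff (\<lambda>t. exp (- (\<i> * of_real t)) * a t) k = fourier_coeff a (k + 1)"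
proof -
  have "exp (\<i> * of_real t) * a t * exp (- (\<i> * of_int k * of_real t))
      = a t * exp (- (\<i> * of_int (k - 1) * of_real t))" for t
    by (simp add: algebra_simps exp_diff exp_minus divide_simps flip: exp_add)
  moreover have "exp (- (\<i> * of_real t)) * a t * exp (- (\<i> * of_int k * of_real t))
      = a t * exp (- (\<i> * of_int (k + 1) * of_real t))" for t
    by (simp add: algebra_simps exp_diff exp_minus divide_simps flip: exp_add)
  ultimately show "fourier_coeff (\<lambda>t. exp (\<i> * of_real t) * a t) k = fourier_coeff a (k - 1)"
    "fourier_coeff (\<lambda>t. exp (- (\<i> * of_real t)) * a t) k = fourier_coeff a (k + 1)"
    by (simp_all only: fourier_coeff_def)
qed

lemma fourier_coeff_const: "fourier_coeff (\<lambda>t. c) k = (if k = 0 then c else 0)"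
proof (cases "k = 0")
  case False
  let ?F = "\<lambda>z. c * exp (- (\<i> * of_int k * z)) / (- (\<i> * of_int k))"
  have "(?F has_field_derivative c * exp (- (\<i> * of_int k * z))) (at z)" for z
    using False by (auto intro!: derivative_eq_intros simp: field_simps)
  then have "((\<lambda>t. ?F (of_real t)) has_vector_derivative c * exp (- (\<i> * of_int k * of_real t)))
      (at t within {0..2 * pi})" for t
    by (intro has_vector_derivative_real_field)
  then have "((\<lambda>t. c * exp (- (\<i> * of_int k * of_real t))) has_integral
      ?F (of_real (2 * pi)) - ?F (of_real 0)) {0..2 * pi}"
    by (intro fundamental_theorem_of_calculus) auto
  moreover have "exp (- (\<i> * of_int k * of_real (2 * pi))) = (1 :: complex)"
  proof -
    have "- (\<i> * of_int k * of_real (2 * pi)) = (2 * of_int (- k) * of_real pi) * \<i>" by simp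
    then show ?thesis using exp_integer_2pi[of "of_int (- k)"]
      by (simp only: Ints_of_int of_real_mult of_real_of_int_eq of_real_numeral)
  qed
  ultimately show ?thesis using False by (intro fourier_coeff_unique) simp
qed (simp add: fourier_coeff_def scaleR_conv_of_real)

text \<open>The matrix condition of \<open>toeplitz\<close> as a relation, usable before an operator
  with that matrix is known to exist.\<close>

definition has_symbol :: "l2op \<Rightarrow> (real \<Rightarrow> complex) \<Rightarrow> bool" where
  "has_symbol T a \<longleftrightarrow> (\<forall>i j. ell2_nth (op_apply T (unit_ell2 j)) i = fourier_coeff a (int j - int i))"

lemma ell2_nth_sum: "ell2_nth (sum f S) i = (\<Sum>j\<in>S. ell2_nth (f j) i)"
  by (induction S rule: infinite_finite_induct) auto

definition trunc_ell2 :: "nat \<Rightarrow> ell2 \<Rightarrow> ell2" where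
  "trunc_ell2 n x = (\<Sum>j<n. ell2_nth x j *\<^sub>C unit_ell2 j)"

lemma nth_trunc_ell2: "ell2_nth (trunc_ell2 n x) i = (if i < n then ell2_nth x i else 0)"
proof -
  have "ell2_nth (trunc_ell2 n x) i = (\<Sum>j<n. if i = j then ell2_nth x j else 0)"
    unfolding trunc_ell2_def ell2_nth_sum by (intro sum.cong) (auto simp: unit_ell2.rep_eq)
  then show ?thesis by (simp add: sum.delta')
qed

lemma trunc_ell2_LIMSEQ: "(\<lambda>n. trunc_ell2 n x) \<longlonglongrightarrow> x"
proof -
  let ?f = "\<lambda>i. (cmod (ell2_nth x i))\<^sup>2"
  have s: "?f sums (norm x)\<^sup>2"
    unfolding norm_power2_ell2 by (rule summable_sums[OF summable_square_ell2])
  have "(norm (x - trunc_ell2 n x))\<^sup>2 = (norm x)\<^sup>2 - (\<Sum>i<n. ?f i)" for n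
  proof -
    have "(\<lambda>i. ?f i - (if i \<in> {..<n} then ?f i else 0)) sums ((norm x)\<^sup>2 - (\<Sum>i<n. ?f i))"
      by (intro sums_diff s sums_If_finite_set) simp
    moreover have "(\<lambda>i. ?f i - (if i \<in> {..<n} then ?f i else 0))
        = (\<lambda>i. (cmod (ell2_nth (x - trunc_ell2 n x) i))\<^sup>2)"
      by (auto simp: nth_trunc_ell2)
    ultimately show ?thesis unfolding norm_power2_ell2[of "x - trunc_ell2 n x"]
      by (simp only: sums_unique[symmetric])
  qed
  moreover have "(\<lambda>n. (norm x)\<^sup>2 - (\<Sum>i<n. ?f i)) \<longlonglongrightarrow> (norm x)\<^sup>2 - (norm x)\<^sup>2"
    using s unfolding sums_def by (intro tendsto_intros)
  ultimately have "(\<lambda>n. (norm (x - trunc_ell2 n x))\<^sup>2) \<longlonglongrightarrow> 0" by simp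
  then have "(\<lambda>n. sqrt ((norm (x - trunc_ell2 n x))\<^sup>2)) \<longlonglongrightarrow> sqrt 0" by (rule tendsto_real_sqrt)
  then have "(\<lambda>n. x - trunc_ell2 n x) \<longlonglongrightarrow> 0" by (simp add: tendsto_norm_zero_iff)
  from tendsto_diff[OF tendsto_const[of x] this] show ?thesis by simp
qed

lemma nth_op_apply_trunc:
  "has_symbol T a \<Longrightarrow> ell2_nth (op_apply T (trunc_ell2 n x)) i
     = (\<Sum>j<n. ell2_nth x j * fourier_coeff a (int j - int i))"
  by (simp add: trunc_ell2_def op_apply_sum_right ell2_nth_sum has_symbol_def)

lemma tendsto_op_apply_right: "(f \<longlongrightarrow> x) F \<Longrightarrow> ((\<lambda>n. op_apply A (f n)) \<longlongrightarrow> op_apply A x) F"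
  by (rule bounded_linear.tendsto[OF bounded_linear_op_apply])

text \<open>Finitely supported vectors are dense, so the matrix determines a bounded
  operator.\<close>

lemma has_symbol_unique: assumes "has_symbol S a" "has_symbol T a" shows "S = T"
proof (rule l2op_eqI)
  fix x
  have "op_apply S (trunc_ell2 n x) = op_apply T (trunc_ell2 n x)" for n
    by (rule ell2_eqI) (simp add: nth_op_apply_trunc[OF assms(1)] nth_op_apply_trunc[OF assms(2)])
  then show "op_apply S x = op_apply T x"
    using tendsto_op_apply_right[OF trunc_ell2_LIMSEQ, of S x]
      tendsto_op_apply_right[OF trunc_ell2_LIMSEQ, of T x] LIMSEQ_unique by simp
qed

text \<open>The form of a Toeplitz matrix is an integral against the symbol, which bounds the norm.\<close>

lemma toeplitz_form_has_integral:
  assumes a: "continuous_on {0..2 * pi} a"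
  shows "((\<lambda>t. cnj (\<Sum>i<n. y i * exp (- (\<i> * of_nat i * of_real t))) * a t
        * (\<Sum>j<n. x j * exp (- (\<i> * of_nat j * of_real t)))) has_integral
      of_real (2 * pi) * (\<Sum>i<n. cnj (y i) * (\<Sum>j<n. x j * fourier_coeff a (int j - int i)))) {0..2 * pi}"
proof -
  have "((\<lambda>t. \<Sum>i<n. \<Sum>j<n. (cnj (y i) * x j) * (a t * exp (- (\<i> * of_int (int j - int i) * of_real t))))
      has_integral (\<Sum>i<n. \<Sum>j<n. (cnj (y i) * x j) * (of_real (2 * pi) * fourier_coeff a (int j - int i)))) {0..2 * pi}"
    by (intro has_integral_sum has_integral_mult_right fourier_coeff_has_integral a) auto
  moreover have "(\<Sum>i<n. \<Sum>j<n. (cnj (y i) * x j) * (a t * exp (- (\<i> * of_int (int j - int i) * of_real t))))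
      = cnj (\<Sum>i<n. y i * exp (- (\<i> * of_nat i * of_real t))) * a t
        * (\<Sum>j<n. x j * exp (- (\<i> * of_nat j * of_real t)))" for t
  proof -
    have "(cnj (y i) * x j) * (a t * exp (- (\<i> * of_int (int j - int i) * of_real t)))
        = cnj (y i * exp (- (\<i> * of_nat i * of_real t))) * a t * (x j * exp (- (\<i> * of_nat j * of_real t)))" for i j
      by (simp add: exp_cnj algebra_simps flip: exp_add)
    then show ?thesis by (simp only: cnj_sum sum_distrib_left sum_distrib_right) (rule sum.swap)
  qed
  moreover have "(\<Sum>i<n. \<Sum>j<n. (cnj (y i) * x j) * (of_real (2 * pi) * fourier_coeff a (int j - int i)))
      = of_real (2 * pi) * (\<Sum>i<n. cnj (y i) * (\<Sum>j<n. x j * fourier_coeff a (int j - int i)))"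
    by (simp add: sum_distrib_left mult_ac)
  ultimately show ?thesis by simp
qed

text \<open>Parseval's identity for finite sums, read off from the Toeplitz form with constant
  symbol 1.\<close>

lemma trig_sum_square_has_integral:
  "((\<lambda>t. (cmod (\<Sum>j<n. x j * exp (- (\<i> * of_nat j * of_real t))))\<^sup>2) has_integral
    2 * pi * (\<Sum>j<n. (cmod (x j))\<^sup>2)) {0..2 * pi}"
proof -
  let ?X = "\<lambda>t. \<Sum>j<n. x j * exp (- (\<i> * of_nat j * of_real t))"
  have "((\<lambda>t. cnj (?X t) * 1 * ?X t) has_integral
      of_real (2 * pi) * (\<Sum>i<n. cnj (x i) * (\<Sum>j<n. x j * fourier_coeff (\<lambda>t. 1) (int j - int i)))) {0..2 * pi}"
    by (rule toeplitz_form_has_integral) simp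
  moreover have "(\<Sum>j<n. x j * fourier_coeff (\<lambda>t. 1) (int j - int i)) = x i" if "i < n" for i
  proof -
    have "(\<Sum>j<n. x j * fourier_coeff (\<lambda>t. 1) (int j - int i)) = (\<Sum>j<n. if j = i then x j else 0)"
      by (intro sum.cong) (auto simp: fourier_coeff_const)
    then show ?thesis using that by simp
  qed
  ultimately have "((\<lambda>t. cnj (?X t) * 1 * ?X t) has_integral
      of_real (2 * pi) * (\<Sum>i<n. cnj (x i) * x i)) {0..2 * pi}" by simp
  moreover have cn: "cnj z * z = of_real ((cmod z)\<^sup>2)" for z
    by (simp only: complex_norm_square mult.commute)
  ultimately have "((\<lambda>t. complex_of_real ((cmod (?X t))\<^sup>2)) has_integral
      of_real (2 * pi * (\<Sum>j<n. (cmod (x j))\<^sup>2))) {0..2 * pi}"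
    by (simp only: mult_1_right cn of_real_sum of_real_mult)
  from has_integral_linear[OF this bounded_linear_Re] show ?thesis by (simp only: o_def Re_complex_of_real)
qed

text \<open>The integrand of the form is at most \<open>c\<close> times the mean of two squares,
  which Parseval integrates; the bound passes from truncations to all vectors because
  \<open>T\<close> is continuous.\<close>

lemma norm_le_of_has_symbol:
  assumes T: "has_symbol T a" and a: "continuous_on {0..2 * pi} a"
    and c: "\<And>t. t \<in> {0..2 * pi} \<Longrightarrow> cmod (a t) \<le> c"
  shows "norm T \<le> c"
proof (rule norm_op_le_of_form)
  show c0: "0 \<le> c" by (rule order_trans[OF norm_ge_zero c[of 0]]) simp
  fix x y
  have "inner (trunc_ell2 n y) (op_apply T (trunc_ell2 n x)) \<le> c * ((norm x)\<^sup>2 + (norm y)\<^sup>2) / 2" for n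
  proof -
    let ?x = "ell2_nth x" and ?y = "ell2_nth y"
    let ?X = "\<lambda>t. \<Sum>j<n. ?x j * exp (- (\<i> * of_nat j * of_real t))"
    let ?Y = "\<lambda>t. \<Sum>j<n. ?y j * exp (- (\<i> * of_nat j * of_real t))"
    let ?F = "\<Sum>i<n. cnj (?y i) * (\<Sum>j<n. ?x j * fourier_coeff a (int j - int i))"
    have "cinner (trunc_ell2 n y) (op_apply T (trunc_ell2 n x)) = ?F"
      unfolding cinner_def
      by (subst suminf_finite[of "{..<n}"]) (auto simp: nth_trunc_ell2 nth_op_apply_trunc[OF T])
    then have F: "inner (trunc_ell2 n y) (op_apply T (trunc_ell2 n x)) = Re ?F"
      by (simp add: inner_ell2_def)
    have "Re (of_real (2 * pi) * ?F) \<le> c * (2 * pi * (\<Sum>j<n. (cmod (?x j))\<^sup>2) + 2 * pi * (\<Sum>j<n. (cmod (?y j))\<^sup>2)) / 2"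
    proof (rule has_integral_le)
      show "((\<lambda>t. Re (cnj (?Y t) * a t * ?X t)) has_integral Re (of_real (2 * pi) * ?F)) {0..2 * pi}"
        using has_integral_linear[OF toeplitz_form_has_integral[OF a] bounded_linear_Re] by (simp only: o_def)
      show "((\<lambda>t. c * ((cmod (?X t))\<^sup>2 + (cmod (?Y t))\<^sup>2) / 2) has_integral
          c * (2 * pi * (\<Sum>j<n. (cmod (?x j))\<^sup>2) + 2 * pi * (\<Sum>j<n. (cmod (?y j))\<^sup>2)) / 2) {0..2 * pi}"
        by (intro has_integral_divide has_integral_mult_right has_integral_add trig_sum_square_has_integral)
      fix t assume t: "t \<in> {0..2 * pi}"
      have "Re (cnj (?Y t) * a t * ?X t) \<le> cmod (?Y t) * cmod (a t) * cmod (?X t)"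
        using complex_Re_le_cmod[of "cnj (?Y t) * a t * ?X t"] by (simp only: norm_mult complex_mod_cnj)
      also have "\<dots> = cmod (a t) * (cmod (?Y t) * cmod (?X t))" by (simp only: mult_ac)
      also have "\<dots> \<le> c * (((cmod (?X t))\<^sup>2 + (cmod (?Y t))\<^sup>2) / 2)"
        using c[OF t] c0 sum_squares_bound[of "cmod (?X t)" "cmod (?Y t)"] by (intro mult_mono) (auto simp: mult_ac)
      finally show "Re (cnj (?Y t) * a t * ?X t) \<le> c * ((cmod (?X t))\<^sup>2 + (cmod (?Y t))\<^sup>2) / 2" by simp
    qed
    also have "Re (of_real (2 * pi) * ?F) = 2 * pi * Re ?F" by (simp only: Re_complex_of_real times_complex.sel Im_complex_of_real)
    also have "c * (2 * pi * (\<Sum>j<n. (cmod (?x j))\<^sup>2) + 2 * pi * (\<Sum>j<n. (cmod (?y j))\<^sup>2)) / 2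
        = 2 * pi * (c * ((\<Sum>j<n. (cmod (?x j))\<^sup>2) + (\<Sum>j<n. (cmod (?y j))\<^sup>2)) / 2)"
      by (simp add: algebra_simps)
    finally have "Re ?F \<le> c * ((\<Sum>j<n. (cmod (?x j))\<^sup>2) + (\<Sum>j<n. (cmod (?y j))\<^sup>2)) / 2"
      by (rule mult_left_le_imp_le) simp
    also have "\<dots> \<le> c * ((norm x)\<^sup>2 + (norm y)\<^sup>2) / 2"
      using c0 by (intro divide_right_mono mult_left_mono add_mono sum_le_norm_ell2) auto
    finally show ?thesis by (simp only: F)
  qed
  then show "inner y (op_apply T x) \<le> c * ((norm x)\<^sup>2 + (norm y)\<^sup>2) / 2"
    by (intro LIMSEQ_le_const2[OF tendsto_inner[OF trunc_ell2_LIMSEQ tendsto_op_apply_right[OF trunc_ell2_LIMSEQ]]]) auto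
qed

section \<open>Shifts and trigonometric polynomials\<close>

lemma shift_bwd_ex: "\<exists>S. \<forall>x n. ell2_nth (op_apply S x) n = ell2_nth x (Suc n)"
proof -
  have "\<exists>y. ell2_nth y = (\<lambda>n. ell2_nth x (Suc n)) \<and> norm y \<le> norm x" for x
  proof (rule ell2_ofI)
    fix N
    have "(\<Sum>n<N. (cmod (ell2_nth x (Suc n)))\<^sup>2) = (\<Sum>n\<in>Suc ` {..<N}. (cmod (ell2_nth x n))\<^sup>2)"
      by (simp add: sum.reindex)
    also have "\<dots> \<le> (norm x)\<^sup>2" by (rule sum_le_norm_ell2) simp
    finally show "(\<Sum>n<N. (cmod (ell2_nth x (Suc n)))\<^sup>2) \<le> (norm x)\<^sup>2" .
  qed auto
  then obtain f where f: "\<And>x. ell2_nth (f x) = (\<lambda>n. ell2_nth x (Suc n))" "\<And>x. norm (f x) \<le> norm x" by metis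
  obtain S where "op_apply S = f"
    by (rule l2op_ofI[of f 1]) (auto intro!: ell2_eqI simp: f)
  then show ?thesis using f(1) by (intro exI[of _ S]) simp
qed

lemma shift_fwd_ex: "\<exists>S. \<forall>x n. ell2_nth (op_apply S x) n = (case n of 0 \<Rightarrow> 0 | Suc k \<Rightarrow> ell2_nth x k)"
proof -
  have "\<exists>y. ell2_nth y = (\<lambda>n. case n of 0 \<Rightarrow> 0 | Suc k \<Rightarrow> ell2_nth x k) \<and> norm y \<le> norm x" for x
  proof (rule ell2_ofI)
    fix N
    have "(\<Sum>n<N. (cmod (case n of 0 \<Rightarrow> 0 | Suc k \<Rightarrow> ell2_nth x k))\<^sup>2) \<le>
        (\<Sum>n<Suc N. (cmod (case n of 0 \<Rightarrow> 0 | Suc k \<Rightarrow> ell2_nth x k))\<^sup>2)"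
      by simp
    also have "\<dots> = (\<Sum>n<N. (cmod (ell2_nth x n))\<^sup>2)"
      by (subst sum.lessThan_Suc_shift) simp
    also have "\<dots> \<le> (norm x)\<^sup>2" by (rule sum_le_norm_ell2) simp
    finally show "(\<Sum>n<N. (cmod (case n of 0 \<Rightarrow> 0 | Suc k \<Rightarrow> ell2_nth x k))\<^sup>2) \<le> (norm x)\<^sup>2" .
  qed auto
  then obtain f where f: "\<And>x. ell2_nth (f x) = (\<lambda>n. case n of 0 \<Rightarrow> 0 | Suc k \<Rightarrow> ell2_nth x k)"
    "\<And>x. norm (f x) \<le> norm x" by metis
  obtain S where "op_apply S = f"
    by (rule l2op_ofI[of f 1]) (auto intro!: ell2_eqI simp: f split: nat.splits)
  then show ?thesis using f(1) by (intro exI[of _ S]) simp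
qed

text \<open>As the matrix entries are a_(j-i), this is the Toeplitz operator of
  \<open>exp (\<i> * of_real t)\<close>.\<close>

definition shift_bwd :: l2op where
  "shift_bwd = (SOME S. \<forall>x n. ell2_nth (op_apply S x) n = ell2_nth x (Suc n))"

definition shift_fwd :: l2op where
  "shift_fwd = (SOME S. \<forall>x n. ell2_nth (op_apply S x) n = (case n of 0 \<Rightarrow> 0 | Suc k \<Rightarrow> ell2_nth x k))"

lemma nth_shift_bwd [simp]: "ell2_nth (op_apply shift_bwd x) n = ell2_nth x (Suc n)"
  using someI_ex[OF shift_bwd_ex] by (simp add: shift_bwd_def)

lemma nth_shift_fwd [simp]: "ell2_nth (op_apply shift_fwd x) n = (case n of 0 \<Rightarrow> 0 | Suc k \<Rightarrow> ell2_nth x k)"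
  using someI_ex[OF shift_fwd_ex] by (simp add: shift_fwd_def)

lemma norm_shift_fwd: "norm (op_apply shift_fwd x) = norm x"
proof -
  have "(\<lambda>n. (cmod (ell2_nth (op_apply shift_fwd x) n))\<^sup>2) sums (norm x)\<^sup>2"
  proof -
    have "(\<lambda>n. (cmod (ell2_nth x n))\<^sup>2) sums (norm x)\<^sup>2"
      unfolding norm_power2_ell2 by (rule summable_sums[OF summable_square_ell2])
    then show ?thesis
      using sums_Suc_iff[of "\<lambda>n. (cmod (ell2_nth (op_apply shift_fwd x) n))\<^sup>2" "(norm x)\<^sup>2"] by simp
  qed
  then have "(norm (op_apply shift_fwd x))\<^sup>2 = (norm x)\<^sup>2"
    unfolding norm_power2_ell2[of "op_apply shift_fwd x"] by (rule sums_unique[symmetric])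
  then show ?thesis by simp
qed

text \<open>The defect is the rank-one projection onto the first coordinate, so the unit ball goes
  into a compact disc.\<close>

lemma compact_shift_defect: "compact_op (1 - shift_fwd * shift_bwd)"
proof (rule compact_opI)
  have "bounded_linear (\<lambda>c :: complex. c *\<^sub>C unit_ell2 0)"
    by (rule bounded_linear_intro[where K = "norm (unit_ell2 0)"])
      (auto simp: scaleC_add_left_ell2 norm_scaleC_ell2 scaleR_conv_of_real intro!: ell2_eqI)
  then show "compact ((\<lambda>c. c *\<^sub>C unit_ell2 0) ` cball (0 :: complex) 1)"
    by (intro compact_continuous_image linear_continuous_on) auto
  have "op_apply (1 - shift_fwd * shift_bwd) x = ell2_nth x 0 *\<^sub>C unit_ell2 0" for x
    by (rule ell2_eqI) (auto simp: unit_ell2.rep_eq split: nat.splits)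
  then show "op_apply (1 - shift_fwd * shift_bwd) ` cball 0 1 \<subseteq> (\<lambda>c. c *\<^sub>C unit_ell2 0) ` cball (0 :: complex) 1"
    using nth_le_norm_ell2 order_trans by (fastforce simp: image_iff)
qed

text \<open>Frequencies change by one at a time because these are the factors with exact product
  rules. Rule \<open>fwd\<close> raises the frequency, and its operator is
  \<open>shift_bwd\<close>.\<close>

inductive trigpoly :: "(real \<Rightarrow> complex) \<Rightarrow> bool" where
  const: "trigpoly (\<lambda>t. c)"
| fwd: "trigpoly a \<Longrightarrow> trigpoly (\<lambda>t. exp (\<i> * of_real t) * a t)"
| bwd: "trigpoly a \<Longrightarrow> trigpoly (\<lambda>t. exp (- (\<i> * of_real t)) * a t)"
| add: "trigpoly a \<Longrightarrow> trigpoly b \<Longrightarrow> trigpoly (\<lambda>t. a t + b t)"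

lemma trigpoly_cmult: "trigpoly a \<Longrightarrow> trigpoly (\<lambda>t. c * a t)"
proof (induction rule: trigpoly.induct)
  case (fwd a)
  then show ?case using trigpoly.fwd[OF fwd(2)] by (simp add: mult_ac)
next
  case (bwd a)
  then show ?case using trigpoly.bwd[OF bwd(2)] by (simp add: mult_ac)
qed (auto intro: trigpoly.intros simp: distrib_left)

lemma trigpoly_mult: "trigpoly a \<Longrightarrow> trigpoly b \<Longrightarrow> trigpoly (\<lambda>t. a t * b t)"
proof (induction rule: trigpoly.induct)
  case (fwd a)
  then show ?case using trigpoly.fwd[OF fwd(2)[OF fwd(3)]] by (simp add: mult_ac)
next
  case (bwd a)
  then show ?case using trigpoly.bwd[OF bwd(2)[OF bwd(3)]] by (simp add: mult_ac)
qed (auto intro: trigpoly_cmult trigpoly.intros simp: distrib_right)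

section \<open>Periodic functions and the density of trigonometric polynomials\<close>

lemma exp_2pi: "exp (\<i> * of_real (2 * pi)) = 1" "exp (- (\<i> * of_real (2 * pi))) = 1"
  using exp_integer_2pi[of 1] by (simp_all add: mult_ac exp_minus)

lemma C2pi_const: "(\<lambda>t. c) \<in> C2pi"
  and C2pi_add: "a \<in> C2pi \<Longrightarrow> b \<in> C2pi \<Longrightarrow> (\<lambda>t. a t + b t) \<in> C2pi"
  and C2pi_diff: "a \<in> C2pi \<Longrightarrow> b \<in> C2pi \<Longrightarrow> (\<lambda>t. a t - b t) \<in> C2pi"
  and C2pi_mult: "a \<in> C2pi \<Longrightarrow> b \<in> C2pi \<Longrightarrow> (\<lambda>t. a t * b t) \<in> C2pi"
  by (simp_all add: C2pi_def continuous_on_add continuous_on_diff continuous_on_mult)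

lemma C2pi_exp: "(\<lambda>t. exp (\<i> * of_real t)) \<in> C2pi" "(\<lambda>t. exp (- (\<i> * of_real t))) \<in> C2pi"
  unfolding C2pi_def mem_Collect_eq exp_2pi by (auto intro!: continuous_intros)

lemma C2pi_trigpoly: "trigpoly a \<Longrightarrow> a \<in> C2pi"
  by (induction rule: trigpoly.induct) (simp_all add: C2pi_const C2pi_add C2pi_mult C2pi_exp)

text \<open>\<open>Arg2pi\<close> jumps at 1, so continuity is obtained from closed sets: their
  preimages on the circle are images of compact subsets of the parameter interval.\<close>

lemma continuous_on_circle_of_C2pi:
  assumes a: "a \<in> C2pi"
  obtains f where "continuous_on (sphere 0 1) f" "\<And>t. t \<in> {0..2 * pi} \<Longrightarrow> f (exp (\<i> * of_real t)) = a t"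
proof -
  define f where "f = (\<lambda>z. a (Arg2pi z))"
  have fa: "f (exp (\<i> * of_real t)) = a t" if t: "t \<in> {0..2 * pi}" for t
  proof (cases "t = 2 * pi")
    case True
    have e: "exp (\<i> * of_real (2 * pi)) = 1" by (rule exp_2pi)
    \<comment> \<open>At the right end the angle falls back to 0, where
      \<open>a 0 = a (2 * pi)\<close> closes the gap.\<close>
    have "Arg2pi 1 = 0" using Arg2pi_of_real[of 1] by simp
    then show ?thesis using a unfolding True f_def e by (simp add: C2pi_def)
  next
    case False
    then have "Arg2pi (exp (\<i> * of_real t)) = t" using t by (intro Arg2pi_unique[of 1]) auto
    then show ?thesis by (simp add: f_def)
  qed
  have "continuous_on (sphere 0 1) f"
    unfolding continuous_on_closed_vimage[OF closed_sphere]
  proof (intro allI impI)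
    fix B :: "complex set" assume B: "closed B"
    let ?g = "\<lambda>t. exp (\<i> * complex_of_real t)"
    have "f -` B \<inter> sphere 0 1 = ?g ` ({0..2 * pi} \<inter> a -` B)"
    proof (intro equalityI subsetI)
      fix z assume z: "z \<in> f -` B \<inter> sphere 0 1"
      then have "?g (Arg2pi z) = z" by (simp flip: complex_norm_eq_1_exp)
      moreover have "Arg2pi z \<in> {0..2 * pi}" using Arg2pi[of z] by auto
      ultimately show "z \<in> ?g ` ({0..2 * pi} \<inter> a -` B)" using z by (force simp: f_def)
    qed (use fa in auto)
    moreover have "compact (?g ` ({0..2 * pi} \<inter> a -` B))"
    proof (rule compact_continuous_image)
      show "compact ({0..2 * pi} \<inter> a -` B)"
        using a B continuous_closed_preimage[of "{0..2 * pi}" a B]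
        by (auto simp: C2pi_def compact_eq_bounded_closed intro: bounded_subset[of "{0..2 * pi}"])
    qed (intro continuous_intros)
    ultimately show "closed (f -` B \<inter> sphere 0 1)" by (simp add: compact_imp_closed)
  qed
  then show thesis using that fa by blast
qed

lemma trigpoly_real_polynomial:
  "real_polynomial_function (f :: complex \<Rightarrow> real) \<Longrightarrow> trigpoly (\<lambda>t. of_real (f (exp (\<i> * of_real t))))"
proof (induction rule: real_polynomial_function.induct)
  case (linear f)
  have f: "f z = Re z * f 1 + Im z * f \<i>" for z
  proof -
    have "f z = f (Re z *\<^sub>R 1 + Im z *\<^sub>R \<i>)" by (rule arg_cong[where f = f]) (simp add: complex_eq_iff)
    then show ?thesis using linear by (simp add: linear_add linear_scale bounded_linear.linear)
  qed
  let ?e = "\<lambda>t. exp (\<i> * of_real t)" and ?e' = "\<lambda>t. exp (- (\<i> * of_real t))"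
  \<comment> \<open>Real and imaginary part on the circle, written through \<open>?e t\<close> and
    its conjugate \<open>?e' t\<close>.\<close>
  have "of_real (f (?e t)) = (of_real (f 1) / 2 + of_real (f \<i>) / (2 * \<i>)) * (?e t * 1)
      + (of_real (f 1) / 2 - of_real (f \<i>) / (2 * \<i>)) * (?e' t * 1)" for t
  proof -
    have c: "?e' t = cnj (?e t)" by (simp add: exp_cnj)
    show ?thesis unfolding c by (subst f) (simp add: complex_eq_iff)
  qed
  then show ?case
    by (simp only:) (intro trigpoly.add trigpoly_cmult trigpoly.fwd trigpoly.bwd trigpoly.const)
next
  case (add f g)
  then show ?case using trigpoly.add[OF add(3,4)] by simp
next
  case (mult f g)
  then show ?case using trigpoly_mult[OF mult(3,4)] by simp
qed (auto intro: trigpoly.const)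

text \<open>Stone-Weierstrass is applied on the circle, where periodicity is built in and real
  polynomials restrict to trigonometric ones.\<close>

lemma trigpoly_uniform_limit:
  assumes a: "a \<in> C2pi"
  obtains q where "\<And>n. trigpoly (q n)" "uniform_limit {0..2 * pi} q a sequentially"
proof -
  obtain f where f: "continuous_on (sphere 0 1) f" "\<And>t. t \<in> {0..2 * pi} \<Longrightarrow> f (exp (\<i> * of_real t)) = a t"
    using continuous_on_circle_of_C2pi[OF a] by blast
  obtain g where g: "uniform_limit (sphere 0 1) g f sequentially" "\<And>n. polynomial_function (g n)"
    using Stone_Weierstrass_uniform_limit[OF compact_sphere f(1)] by blast
  have "trigpoly (\<lambda>t. g n (exp (\<i> * of_real t)))" for n
  proof -
    have re: "real_polynomial_function (\<lambda>z. Re (g n z))" "real_polynomial_function (\<lambda>z. Im (g n z))"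
      using g(2) bounded_linear_Re bounded_linear_Im by (auto simp: polynomial_function_def o_def)
    have "trigpoly (\<lambda>t. of_real (Re (g n (exp (\<i> * of_real t)))) + \<i> * of_real (Im (g n (exp (\<i> * of_real t)))))"
      by (intro trigpoly.add trigpoly_cmult trigpoly_real_polynomial[OF re(1)] trigpoly_real_polynomial[OF re(2)])
    then show ?thesis by (simp flip: complex_eq)
  qed
  moreover have "uniform_limit {0..2 * pi} (\<lambda>n t. g n (exp (\<i> * of_real t))) a sequentially"
  proof (rule uniform_limitI)
    fix e :: real assume "0 < e"
    from uniform_limitD[OF g(1) this]
    show "\<forall>\<^sub>F n in sequentially. \<forall>t\<in>{0..2 * pi}. dist (g n (exp (\<i> * of_real t))) (a t) < e"
    proof eventually_elim
      case (elim n)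
      show ?case
      proof
        fix t :: real assume "t \<in> {0..2 * pi}"
        then show "dist (g n (exp (\<i> * of_real t))) (a t) < e"
          using elim f(2)[of t] by (metis mem_sphere_0 norm_exp_i_times)
      qed
    qed
  qed
  ultimately show thesis by (rule that)
qed

section \<open>Toeplitz operators\<close>

lemma has_symbol_add:
  assumes "has_symbol S a" "has_symbol T b" "a \<in> C2pi" "b \<in> C2pi"
  shows "has_symbol (S + T) (\<lambda>t. a t + b t)"
  using assms by (simp add: has_symbol_def fourier_coeff_add C2pi_def)

lemma has_symbol_scaleC: "has_symbol T a \<Longrightarrow> has_symbol (c *\<^sub>C T) (\<lambda>t. c * a t)"
  by (simp add: has_symbol_def fourier_coeff_cmult)

lemma has_symbol_diff:
  assumes "has_symbol S a" "has_symbol T b" "a \<in> C2pi" "b \<in> C2pi"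
  shows "has_symbol (S - T) (\<lambda>t. a t - b t)"
  using has_symbol_add[OF assms(1) has_symbol_scaleC[OF assms(2), of "-1"] assms(3)]
    C2pi_mult[OF C2pi_const[of "-1"] assms(4)]
  by (simp add: scaleC_l2op_simps)

lemma has_symbol_const: "has_symbol (c *\<^sub>C 1) (\<lambda>t. c)"
  by (auto simp: has_symbol_def fourier_coeff_const unit_ell2.rep_eq)

lemma has_symbol_bwd: "has_symbol T a \<Longrightarrow> has_symbol (shift_bwd * T) (\<lambda>t. exp (\<i> * of_real t) * a t)"
  by (simp add: has_symbol_def fourier_coeff_shift diff_diff_eq add.commute)

text \<open>Right multiplication drops the first column and keeps the diagonals constant; on the
  left the forward shift would insert a zero row.\<close>

lemma has_symbol_fwd: "has_symbol T a \<Longrightarrow> has_symbol (T * shift_fwd) (\<lambda>t. exp (- (\<i> * of_real t)) * a t)"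
proof -
  assume T: "has_symbol T a"
  have "op_apply shift_fwd (unit_ell2 j) = unit_ell2 (Suc j)" for j
    by (rule ell2_eqI) (auto simp: unit_ell2.rep_eq split: nat.splits)
  then show ?thesis using T by (simp add: has_symbol_def fourier_coeff_shift diff_add_eq add_diff_eq add.commute)
qed

lemma has_symbol_trigpoly_ex: "trigpoly a \<Longrightarrow> \<exists>T. has_symbol T a"
proof (induction rule: trigpoly.induct)
  case (add a b)
  then show ?case using has_symbol_add C2pi_trigpoly by blast
qed (use has_symbol_const has_symbol_bwd has_symbol_fwd in blast)+

lemma norm_diff_le_of_has_symbol:
  assumes "has_symbol S a" "has_symbol T b" "a \<in> C2pi" "b \<in> C2pi"
    "\<And>t. t \<in> {0..2 * pi} \<Longrightarrow> cmod (a t - b t) \<le> c"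
  shows "norm (S - T) \<le> c"
  using norm_le_of_has_symbol[OF has_symbol_diff[OF assms(1-4)]] C2pi_diff[OF assms(3,4)] assms(5)
  by (simp add: C2pi_def)

lemma fourier_coeff_le:
  assumes "a \<in> C2pi" "b \<in> C2pi" "\<And>t. t \<in> {0..2 * pi} \<Longrightarrow> cmod (a t - b t) \<le> c"
  shows "cmod (fourier_coeff a k - fourier_coeff b k) \<le> c"
proof -
  have ab: "continuous_on {0..2 * pi} a" "continuous_on {0..2 * pi} b" using assms by (auto simp: C2pi_def)
  have "((\<lambda>t. (a t - b t) * exp (- (\<i> * of_int k * of_real t))) has_integral
      of_real (2 * pi) * (fourier_coeff a k - fourier_coeff b k)) {0..2 * pi}"
    using has_integral_diff[OF fourier_coeff_has_integral[OF ab(1)] fourier_coeff_has_integral[OF ab(2)]]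
    by (simp add: left_diff_distrib right_diff_distrib)
  moreover have "0 \<le> c" by (rule order_trans[OF norm_ge_zero assms(3)[of 0]]) simp
  ultimately have "cmod (of_real (2 * pi) * (fourier_coeff a k - fourier_coeff b k)) \<le> c * measure lborel {0..2 * pi}"
    by (intro has_integral_bound_real[where S = "{}"]) (use assms(3) in \<open>auto simp: norm_mult\<close>)
  then show ?thesis by (simp add: norm_mult)
qed

lemma tendsto_ell2_nth:
  assumes "X \<longlonglongrightarrow> x" shows "(\<lambda>n. ell2_nth (X n) j) \<longlonglongrightarrow> ell2_nth x j"
proof -
  have "(\<lambda>n. norm (X n - x)) \<longlonglongrightarrow> 0" using assms by (simp add: LIM_zero tendsto_norm_zero)
  then have "(\<lambda>n. ell2_nth (X n) j - ell2_nth x j) \<longlonglongrightarrow> 0"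
  proof (rule Lim_null_comparison[OF always_eventually, rotated], intro allI)
    show "cmod (ell2_nth (X n) j - ell2_nth x j) \<le> norm (X n - x)" for n
      using nth_le_norm_ell2[of "X n - x" j] by simp
  qed
  then show ?thesis by (simp add: LIM_zero_iff)
qed

text \<open>Boundedness of the matrix is not visible from its entries, so the operator is built as
  the norm limit for approximating trigonometric polynomials; Fourier coefficients follow the
  uniform limit.\<close>

lemma has_symbol_ex:
  assumes a: "a \<in> C2pi" shows "\<exists>T. has_symbol T a"
proof -
  obtain q where q: "\<And>n. trigpoly (q n)" "uniform_limit {0..2 * pi} q a sequentially"
    using trigpoly_uniform_limit[OF a] by metis
  have qC: "q n \<in> C2pi" for n by (rule C2pi_trigpoly[OF q(1)])
  have "\<forall>n. \<exists>T. has_symbol T (q n)" using has_symbol_trigpoly_ex q(1) by blast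
  from choice[OF this] obtain T where T: "\<And>n. has_symbol (T n) (q n)" by blast
  have "Cauchy T"
  proof (rule metric_CauchyI)
    fix e :: real assume e: "0 < e"
    then obtain N where N: "\<And>n t. n \<ge> N \<Longrightarrow> t \<in> {0..2 * pi} \<Longrightarrow> dist (q n t) (a t) < e / 4"
      using uniform_limit_le[OF q(2), of "e/4"] by auto
    have "norm (T m - T n) \<le> e / 2" if "m \<ge> N" "n \<ge> N" for m n
    proof (rule norm_diff_le_of_has_symbol[OF T T qC qC])
      fix t assume "t \<in> {0..2 * pi}"
      then show "cmod (q m t - q n t) \<le> e / 2"
        using N[OF that(1), of t] N[OF that(2), of t] dist_triangle2[of "q m t" "q n t" "a t"]
        by (simp add: dist_norm)
    qed
    then have "dist (T m) (T n) < e" if "m \<ge> N" "n \<ge> N" for m n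
      using that e by (fastforce simp: dist_norm)
    then show "\<exists>M. \<forall>m\<ge>M. \<forall>n\<ge>M. dist (T m) (T n) < e" by blast
  qed
  then obtain L where L: "T \<longlonglongrightarrow> L" using Cauchy_convergent_iff convergent_def by blast
  have "ell2_nth (op_apply L (unit_ell2 j)) i = fourier_coeff a (int j - int i)" for i j
  proof (rule LIMSEQ_unique)
    show "(\<lambda>n. ell2_nth (op_apply (T n) (unit_ell2 j)) i) \<longlonglongrightarrow> ell2_nth (op_apply L (unit_ell2 j)) i"
      by (intro tendsto_ell2_nth tendsto_op_apply L)
    show "(\<lambda>n. ell2_nth (op_apply (T n) (unit_ell2 j)) i) \<longlonglongrightarrow> fourier_coeff a (int j - int i)"
    proof (rule metric_LIMSEQ_I)
      fix e :: real assume e: "0 < e"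
      then obtain N where N: "\<And>n t. n \<ge> N \<Longrightarrow> t \<in> {0..2 * pi} \<Longrightarrow> dist (q n t) (a t) < e / 2"
        using uniform_limit_le[OF q(2), of "e/2"] by auto
      have "dist (ell2_nth (op_apply (T n) (unit_ell2 j)) i) (fourier_coeff a (int j - int i)) < e"
        if "n \<ge> N" for n
      proof -
        have "cmod (fourier_coeff (q n) (int j - int i) - fourier_coeff a (int j - int i)) \<le> e / 2"
          by (rule fourier_coeff_le[OF qC a]) (use N[OF that] in \<open>simp add: dist_norm less_imp_le\<close>)
        then show ?thesis using T[of n] e by (simp add: has_symbol_def dist_norm)
      qed
      then show "\<exists>no. \<forall>n\<ge>no. dist (ell2_nth (op_apply (T n) (unit_ell2 j)) i)
          (fourier_coeff a (int j - int i)) < e" by blast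
    qed
  qed
  then show ?thesis unfolding has_symbol_def by blast
qed

lemma toeplitz_eqI: "has_symbol T a \<Longrightarrow> toeplitz a = T"
  unfolding toeplitz_def has_symbol_def[symmetric] using has_symbol_unique by blast

lemma has_symbol_toeplitz: "a \<in> C2pi \<Longrightarrow> has_symbol (toeplitz a) a"
  using has_symbol_ex toeplitz_eqI by metis

lemma toeplitz_cong: "(\<And>t. t \<in> {0..2 * pi} \<Longrightarrow> a t = b t) \<Longrightarrow> toeplitz a = toeplitz b"
  unfolding toeplitz_def using fourier_coeff_cong[of a b] by presburger

lemma toeplitz_add: "a \<in> C2pi \<Longrightarrow> b \<in> C2pi \<Longrightarrow> toeplitz (\<lambda>t. a t + b t) = toeplitz a + toeplitz b"
  by (intro toeplitz_eqI has_symbol_add has_symbol_toeplitz)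

lemma toeplitz_const: "toeplitz (\<lambda>t. c) = c *\<^sub>C 1"
  by (intro toeplitz_eqI has_symbol_const)

lemma toeplitz_bwd: "a \<in> C2pi \<Longrightarrow> toeplitz (\<lambda>t. exp (\<i> * of_real t) * a t) = shift_bwd * toeplitz a"
  by (intro toeplitz_eqI has_symbol_bwd has_symbol_toeplitz)

lemma toeplitz_fwd: "a \<in> C2pi \<Longrightarrow> toeplitz (\<lambda>t. exp (- (\<i> * of_real t)) * a t) = toeplitz a * shift_fwd"
  by (intro toeplitz_eqI has_symbol_fwd has_symbol_toeplitz)

lemma norm_toeplitz_diff_le:
  "a \<in> C2pi \<Longrightarrow> b \<in> C2pi \<Longrightarrow> (\<And>t. t \<in> {0..2 * pi} \<Longrightarrow> cmod (a t - b t) \<le> c)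
    \<Longrightarrow> norm (toeplitz a - toeplitz b) \<le> c"
  by (rule norm_diff_le_of_has_symbol[OF has_symbol_toeplitz has_symbol_toeplitz])

lemma toeplitz_LIMSEQ:
  assumes q: "\<And>n. q n \<in> C2pi" and a: "a \<in> C2pi" and lim: "uniform_limit {0..2 * pi} q a sequentially"
  shows "(\<lambda>n. toeplitz (q n)) \<longlonglongrightarrow> toeplitz a"
proof (rule metric_LIMSEQ_I)
  fix e :: real assume e: "0 < e"
  then obtain N where N: "\<And>n t. n \<ge> N \<Longrightarrow> t \<in> {0..2 * pi} \<Longrightarrow> dist (q n t) (a t) < e / 2"
    using uniform_limit_le[OF lim, of "e/2"] by auto
  have "norm (toeplitz (q n) - toeplitz a) \<le> e / 2" if "n \<ge> N" for n
    by (rule norm_toeplitz_diff_le[OF q a]) (use N[OF that] in \<open>auto simp: dist_norm less_imp_le\<close>)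
  then show "\<exists>no. \<forall>n\<ge>no. dist (toeplitz (q n)) (toeplitz a) < e"
    using e by (intro exI[of _ N]) (fastforce simp: dist_norm)
qed

lemma uniform_limit_mult_right:
  assumes "uniform_limit {0..2 * pi} q a sequentially" "b \<in> C2pi" "a \<in> C2pi"
  shows "uniform_limit {0..2 * pi} (\<lambda>n t. q n t * b t) (\<lambda>t. a t * b t) sequentially"
proof (rule uniform_lim_mult[OF assms(1)])
  have "compact (c ` {0..2 * pi})" if "c \<in> C2pi" for c
    using that by (intro compact_continuous_image) (auto simp: C2pi_def)
  then show "bounded (a ` {0..2 * pi})" "bounded (b ` {0..2 * pi})"
    using assms(2,3) compact_imp_bounded by blast+
qed (rule uniform_limit_const)

text \<open>\<open>T(e\<^sup>i\<^sup>t a) = T(e\<^sup>i\<^sup>t) T(a)\<close> and \<open>T(a e\<^sup>-\<^sup>i\<^sup>t) = T(a) T(e\<^sup>-\<^sup>i\<^sup>t)\<close> hold exactly; the compact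
  error comes from \<open>1 - T(e\<^sup>-\<^sup>i\<^sup>t) T(e\<^sup>i\<^sup>t)\<close>, the projection onto the first coordinate.\<close>

lemma compact_toeplitz_mult:
  assumes a: "a \<in> C2pi" and b: "b \<in> C2pi"
  shows "compact_op (toeplitz a * toeplitz b - toeplitz (\<lambda>t. a t * b t))"
proof -
  have trig: "compact_op (toeplitz q * toeplitz b - toeplitz (\<lambda>t. q t * b t))"
    if "trigpoly q" "b \<in> C2pi" for q b
    using that
  proof (induction arbitrary: b rule: trigpoly.induct)
    case (const c)
    have "toeplitz (\<lambda>t. c * b t) = c *\<^sub>C toeplitz b"
      by (intro toeplitz_eqI has_symbol_scaleC has_symbol_toeplitz const)
    then have "toeplitz (\<lambda>t. c) * toeplitz b - toeplitz (\<lambda>t. c * b t) = 0"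
      by (simp add: toeplitz_const flip: scaleC_l2op_simps(1))
    then show ?case by (simp only: compact_op_zero)
  next
    case (fwd q)
    note q = C2pi_trigpoly[OF fwd(1)]
    have "toeplitz (\<lambda>t. exp (\<i> * of_real t) * q t * b t) = shift_bwd * toeplitz (\<lambda>t. q t * b t)"
      using toeplitz_bwd[OF C2pi_mult[OF q fwd(3)]] by (simp add: mult.assoc)
    then have "toeplitz (\<lambda>t. exp (\<i> * of_real t) * q t) * toeplitz b - toeplitz (\<lambda>t. exp (\<i> * of_real t) * q t * b t)
        = shift_bwd * (toeplitz q * toeplitz b - toeplitz (\<lambda>t. q t * b t))"
      by (simp add: toeplitz_bwd[OF q] right_diff_distrib mult.assoc)
    then show ?case using compact_op_mult_left[OF fwd(2)[OF fwd(3)]] by simp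
  next
    case (bwd q)
    note q = C2pi_trigpoly[OF bwd(1)]
    \<comment> \<open>Moving the factor onto \<open>b\<close> gives \<open>b\<close> as
      \<open>exp (\<i> * of_real t)\<close> times \<open>c\<close>, so \<open>toeplitz b\<close>
      splits off \<open>shift_bwd\<close> and the two shifts meet in the middle.\<close>
    define c where "c = (\<lambda>t. exp (- (\<i> * of_real t)) * b t)"
    have c: "c \<in> C2pi" unfolding c_def by (intro C2pi_mult C2pi_exp bwd)
    have "b = (\<lambda>t. exp (\<i> * of_real t) * c t)"
      by (simp add: c_def fun_eq_iff mult.assoc[symmetric] flip: exp_add)
    then have Tb: "toeplitz b = shift_bwd * toeplitz c" using toeplitz_bwd[OF c] by simp
    have "compact_op (toeplitz q * (1 - shift_fwd * shift_bwd) * toeplitz c)"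
      by (intro compact_op_mult_right compact_op_mult_left compact_shift_defect)
    then have "compact_op ((toeplitz q * toeplitz c - toeplitz (\<lambda>t. q t * c t))
        - toeplitz q * (1 - shift_fwd * shift_bwd) * toeplitz c)"
      by (intro compact_op_diff bwd(2)[OF c])
    moreover have "(toeplitz q * toeplitz c - toeplitz (\<lambda>t. q t * c t))
        - toeplitz q * (1 - shift_fwd * shift_bwd) * toeplitz c
        = toeplitz (\<lambda>t. exp (- (\<i> * of_real t)) * q t) * toeplitz b
          - toeplitz (\<lambda>t. exp (- (\<i> * of_real t)) * q t * b t)"
    proof -
      have "(\<lambda>t. exp (- (\<i> * of_real t)) * q t * b t) = (\<lambda>t. q t * c t)"
        by (simp add: c_def mult_ac)
      then show ?thesis unfolding toeplitz_fwd[OF q] Tb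
        by (simp add: right_diff_distrib left_diff_distrib mult.assoc)
    qed
    ultimately show ?case by simp
  next
    case (add p q)
    note C = C2pi_trigpoly[OF add(1)] C2pi_trigpoly[OF add(2)]
    have "toeplitz (\<lambda>t. p t + q t) * toeplitz b - toeplitz (\<lambda>t. (p t + q t) * b t)
        = (toeplitz p * toeplitz b - toeplitz (\<lambda>t. p t * b t)) + (toeplitz q * toeplitz b - toeplitz (\<lambda>t. q t * b t))"
      using toeplitz_add[OF C] toeplitz_add[OF C2pi_mult[OF C(1) add(5)] C2pi_mult[OF C(2) add(5)]]
      by (simp add: distrib_right)
    then show ?case using compact_op_add[OF add(3,4)[OF add(5)]] by simp
  qed
  obtain q where q: "\<And>n. trigpoly (q n)" "uniform_limit {0..2 * pi} q a sequentially"
    using trigpoly_uniform_limit[OF a] by blast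
  have "(\<lambda>n. toeplitz (q n) * toeplitz b - toeplitz (\<lambda>t. q n t * b t))
      \<longlonglongrightarrow> toeplitz a * toeplitz b - toeplitz (\<lambda>t. a t * b t)"
    by (intro tendsto_intros toeplitz_LIMSEQ C2pi_trigpoly[OF q(1)] a b q(2) C2pi_mult uniform_limit_mult_right)
  then show ?thesis by (rule compact_op_limit[rotated]) (rule trig[OF q(1) b])
qed

section \<open>Approximate eigenvectors\<close>

text \<open>Geometric sequences are eigenvectors of the backward shift and, as \<open>r\<close> tends to 1,
  approximate eigenvectors of the forward shift.\<close>

lemma geometric_vector_ex:
  assumes r: "0 < r" "r < 1"
  obtains v where "norm v = 1" "op_apply shift_bwd v = (of_real r * exp (\<i> * of_real s)) *\<^sub>C v"
    "norm (op_apply shift_fwd v - exp (- (\<i> * of_real s)) *\<^sub>C v) \<le> (1 - r) + sqrt (1 - r\<^sup>2) * norm (unit_ell2 0)"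
    "\<And>j. cmod (ell2_nth v j) \<le> sqrt (1 - r\<^sup>2)"
proof -
  let ?w = "of_real r * exp (\<i> * of_real s) :: complex" and ?e = "exp (- (\<i> * of_real s)) :: complex"
  have r2: "0 < 1 - r\<^sup>2" using r by (simp add: power_less_one_iff)
  \<comment> \<open>The normalization, from the sum of the geometric series with ratio
    \<open>r\<^sup>2\<close>.\<close>
  define c where "c = sqrt (1 - r\<^sup>2)"
  have c: "c\<^sup>2 = 1 - r\<^sup>2" "0 < c" using r2 by (simp_all add: c_def)
  define f where "f = (\<lambda>j. of_real c * ?w ^ j)"
  have nf: "cmod (f j) = c * r ^ j" for j using r c by (simp add: f_def norm_mult norm_power)
  have "(\<lambda>j. (r\<^sup>2) ^ j) sums (1 / (1 - r\<^sup>2))"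
    by (rule geometric_sums) (use r in \<open>simp add: power_less_one_iff\<close>)
  then have "(\<lambda>j. c\<^sup>2 * (r\<^sup>2) ^ j) sums (c\<^sup>2 * (1 / (1 - r\<^sup>2)))" by (rule sums_mult)
  then have sf: "(\<lambda>j. (cmod (f j))\<^sup>2) sums 1"
    using r2 by (simp add: nf c power_mult_distrib power_mult[symmetric] mult.commute)
  define v where "v = Abs_ell2 f"
  have nth: "ell2_nth v = f" unfolding v_def using sf by (subst Abs_ell2_inverse) (auto simp: sums_iff)
  have "(norm v)\<^sup>2 = 1" unfolding norm_power2_ell2 nth using sf by (simp add: sums_iff)
  then have v: "norm v = 1" using norm_ge_zero[of v] unfolding power2_eq_1_iff by linarith
  have bwd: "op_apply shift_bwd v = ?w *\<^sub>C v"
    by (rule ell2_eqI) (simp add: nth f_def)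
  have ee: "?e * exp (\<i> * of_real s) = 1" by (simp flip: exp_add)
  \<comment> \<open>Two errors arise: \<open>r\<close> in place of 1 along the sequence, and the
    missing term in coordinate 0.\<close>
  have "op_apply shift_fwd v - ?e *\<^sub>C v = (1 - r) *\<^sub>R op_apply shift_fwd v - (?e * of_real c) *\<^sub>C unit_ell2 0"
  proof (rule ell2_eqI)
    fix n show "ell2_nth (op_apply shift_fwd v - ?e *\<^sub>C v) n
        = ell2_nth ((1 - r) *\<^sub>R op_apply shift_fwd v - (?e * of_real c) *\<^sub>C unit_ell2 0) n"
    proof (cases n)
      case 0 then show ?thesis by (simp add: nth f_def unit_ell2.rep_eq)
    next
      case (Suc k)
      have "?e * f (Suc k) = (?e * exp (\<i> * of_real s)) * of_real r * f k" by (simp add: f_def mult_ac)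
      then show ?thesis using ee by (simp add: Suc nth unit_ell2.rep_eq left_diff_distrib)
    qed
  qed
  then have "norm (op_apply shift_fwd v - ?e *\<^sub>C v)
      \<le> norm ((1 - r) *\<^sub>R op_apply shift_fwd v) + norm ((?e * of_real c) *\<^sub>C unit_ell2 0)"
    by (metis norm_triangle_ineq4)
  also have "\<dots> = (1 - r) + c * norm (unit_ell2 0)"
    using r c v by (simp add: norm_shift_fwd norm_scaleC_ell2 norm_mult)
  finally have "norm (op_apply shift_fwd v - ?e *\<^sub>C v) \<le> (1 - r) + sqrt (1 - r\<^sup>2) * norm (unit_ell2 0)"
    by (simp add: c_def)
  moreover have "cmod (ell2_nth v j) \<le> sqrt (1 - r\<^sup>2)" for j
    using r c by (simp add: nth nf c_def mult_left_le power_le_one)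
  ultimately show thesis using that v bwd by blast
qed

text \<open>Lower bounds on \<open>norm (v n)\<close> are stated separately; the zero sequence
  satisfies the condition for every \<open>z\<close>.\<close>

definition approx_eigen :: "(nat \<Rightarrow> ell2) \<Rightarrow> l2op \<Rightarrow> complex \<Rightarrow> bool" where
  "approx_eigen v A z \<longleftrightarrow> (\<lambda>n. op_apply A (v n) - z *\<^sub>C v n) \<longlonglongrightarrow> 0"

lemma approx_eigen_add: "approx_eigen v A z \<Longrightarrow> approx_eigen v B w \<Longrightarrow> approx_eigen v (A + B) (z + w)"
  unfolding approx_eigen_def by (drule (1) tendsto_add) (simp add: scaleC_add_left_ell2 algebra_simps)

lemma tendsto_scaleC_zero: "(\<lambda>n. v n :: ell2) \<longlonglongrightarrow> 0 \<Longrightarrow> (\<lambda>n. c *\<^sub>C v n) \<longlonglongrightarrow> 0"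
  using bounded_linear.tendsto[OF bounded_linear_scaleC_ell2, of v 0] by (simp add: scaleC_ell2_simps)

lemma approx_eigen_mult: "approx_eigen v A z \<Longrightarrow> approx_eigen v B w \<Longrightarrow> approx_eigen v (A * B) (z * w)"
proof -
  assume A: "approx_eigen v A z" and B: "approx_eigen v B w"
  have "(\<lambda>n. op_apply A (op_apply B (v n) - w *\<^sub>C v n) + w *\<^sub>C (op_apply A (v n) - z *\<^sub>C v n)) \<longlonglongrightarrow> 0 + 0"
    using tendsto_op_apply_right[OF B[unfolded approx_eigen_def], of A] tendsto_scaleC_zero[OF A[unfolded approx_eigen_def]]
    by (intro tendsto_add) simp_all
  then show ?thesis unfolding approx_eigen_def by (simp add: scaleC_ell2_simps mult.commute algebra_simps)
qed

lemma approx_eigen_const: "approx_eigen v (c *\<^sub>C 1) c"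
  by (simp add: approx_eigen_def)

text \<open>Sums and products of approximate eigenvalue relations cover trigonometric polynomials;
  operator and value both depend contractively on the symbol, which gives the general case.\<close>

lemma approx_eigen_toeplitz:
  assumes v: "\<And>n. norm (v n) = 1" and a: "a \<in> C2pi" and s: "s \<in> {0..2 * pi}"
    and bwd: "approx_eigen v shift_bwd (exp (\<i> * of_real s))"
    and fwd: "approx_eigen v shift_fwd (exp (- (\<i> * of_real s)))"
  shows "approx_eigen v (toeplitz a) (a s)"
proof -
  have trig: "approx_eigen v (toeplitz q) (q s)" if "trigpoly q" for q
    using that
  proof (induction rule: trigpoly.induct)
    case (const c)
    show ?case by (simp add: toeplitz_const approx_eigen_const)
  next
    case (fwd q)
    show ?case unfolding toeplitz_bwd[OF C2pi_trigpoly[OF fwd(1)]]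
      by (intro approx_eigen_mult bwd fwd)
  next
    case (bwd q)
    show ?case unfolding toeplitz_fwd[OF C2pi_trigpoly[OF bwd(1)]]
      by (subst mult.commute) (intro approx_eigen_mult bwd fwd)
  next
    case (add p q)
    then show ?case by (simp add: toeplitz_add C2pi_trigpoly approx_eigen_add)
  qed
  show ?thesis unfolding approx_eigen_def
  proof (rule metric_LIMSEQ_I)
    fix e :: real assume e: "0 < e"
    obtain p where p: "\<And>n. trigpoly (p n)" "uniform_limit {0..2 * pi} p a sequentially"
      using trigpoly_uniform_limit[OF a] by metis
    obtain M where M: "\<And>n t. n \<ge> M \<Longrightarrow> t \<in> {0..2 * pi} \<Longrightarrow> dist (p n t) (a t) < e / 4"
      using uniform_limit_le[OF p(2), of "e/4"] e by auto
    define q where "q = p M"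
    have q: "trigpoly q" "\<And>t. t \<in> {0..2 * pi} \<Longrightarrow> cmod (a t - q t) < e / 4"
      using p(1) M[of M] by (simp_all add: q_def dist_norm norm_minus_commute)
    note qC = C2pi_trigpoly[OF q(1)]
    have T: "norm (toeplitz a - toeplitz q) \<le> e / 4"
      by (rule norm_toeplitz_diff_le[OF a qC]) (use q(2) less_imp_le in blast)
    obtain N where N: "\<And>n. n \<ge> N \<Longrightarrow> norm (op_apply (toeplitz q) (v n) - q s *\<^sub>C v n) < e / 4"
      using metric_LIMSEQ_D[OF trig[OF q(1), unfolded approx_eigen_def], of "e/4"] e by auto
    have "norm (op_apply (toeplitz a) (v n) - a s *\<^sub>C v n) < e" if n: "n \<ge> N" for n
    proof -
      have "op_apply (toeplitz a) (v n) - a s *\<^sub>C v n = op_apply (toeplitz a - toeplitz q) (v n)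
          + (op_apply (toeplitz q) (v n) - q s *\<^sub>C v n) - (a s - q s) *\<^sub>C v n"
        by (rule ell2_eqI) (simp add: algebra_simps)
      moreover have "norm (x + y - z) \<le> norm x + norm y + norm z" for x y z :: ell2
        using norm_triangle_ineq4[of "x + y" z] norm_triangle_ineq[of x y] by linarith
      ultimately have "norm (op_apply (toeplitz a) (v n) - a s *\<^sub>C v n) \<le> norm (op_apply (toeplitz a - toeplitz q) (v n))
          + norm (op_apply (toeplitz q) (v n) - q s *\<^sub>C v n) + norm ((a s - q s) *\<^sub>C v n)"
        by presburger
      moreover have "norm (op_apply (toeplitz a - toeplitz q) (v n)) \<le> e / 4"
        using norm_op_apply_le[of "toeplitz a - toeplitz q" "v n"] T v by simp
      moreover have "norm ((a s - q s) *\<^sub>C v n) < e / 4"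
        using q(2)[OF s] by (simp add: norm_scaleC_ell2 v)
      ultimately show ?thesis using N[OF n] e by linarith
    qed
    then show "\<exists>no. \<forall>n\<ge>no. dist (op_apply (toeplitz a) (v n) - a s *\<^sub>C v n) 0 < e" by auto
  qed
qed

lemma shift_approx_eigen_ex:
  obtains v where "\<And>n. norm (v n) = 1" "approx_eigen v shift_bwd (exp (\<i> * of_real s))"
    "approx_eigen v shift_fwd (exp (- (\<i> * of_real s)))" "\<And>j. (\<lambda>n. ell2_nth (v n) j) \<longlonglongrightarrow> 0"
proof -
  \<comment> \<open>The shift by 2 keeps the ratio strictly between 0 and 1 already at
    \<open>n = 0\<close>.\<close>
  define r where "r = (\<lambda>n. 1 - inverse (real (Suc (Suc n))))"
  have r: "0 < r n" "r n < 1" for n unfolding r_def by (simp_all add: inverse_less_1_iff)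
  have "(\<lambda>n. inverse (real (Suc (Suc n)))) \<longlonglongrightarrow> 0" using LIMSEQ_Suc[OF LIMSEQ_inverse_real_of_nat] .
  from tendsto_diff[OF tendsto_const[of 1] this] have r1: "r \<longlonglongrightarrow> 1" unfolding r_def by simp
  have "(\<lambda>n. sqrt (1 - (r n)\<^sup>2)) \<longlonglongrightarrow> sqrt (1 - 1\<^sup>2)" by (intro tendsto_intros r1)
  then have c0: "(\<lambda>n. sqrt (1 - (r n)\<^sup>2)) \<longlonglongrightarrow> 0" by simp
  have "\<forall>n. \<exists>v. norm v = 1 \<and> op_apply shift_bwd v = (of_real (r n) * exp (\<i> * of_real s)) *\<^sub>C v \<and>
    norm (op_apply shift_fwd v - exp (- (\<i> * of_real s)) *\<^sub>C v) \<le> (1 - r n) + sqrt (1 - (r n)\<^sup>2) * norm (unit_ell2 0) \<and>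
    (\<forall>j. cmod (ell2_nth v j) \<le> sqrt (1 - (r n)\<^sup>2))"
    using geometric_vector_ex[OF r] by (metis (no_types, lifting))
  then obtain v where v: "\<And>n. norm (v n) = 1"
    "\<And>n. op_apply shift_bwd (v n) = (of_real (r n) * exp (\<i> * of_real s)) *\<^sub>C v n"
    "\<And>n. norm (op_apply shift_fwd (v n) - exp (- (\<i> * of_real s)) *\<^sub>C v n) \<le> (1 - r n) + sqrt (1 - (r n)\<^sup>2) * norm (unit_ell2 0)"
    "\<And>n j. cmod (ell2_nth (v n) j) \<le> sqrt (1 - (r n)\<^sup>2)" by metis
  have 1: "(\<lambda>n. 1 - r n) \<longlonglongrightarrow> 0" using tendsto_diff[OF tendsto_const[of 1] r1] by simp
  show thesis
  proof (rule that[of v])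
    show "norm (v n) = 1" for n by (rule v)
    show "approx_eigen v shift_bwd (exp (\<i> * of_real s))" unfolding approx_eigen_def
    proof (rule Lim_null_comparison[OF always_eventually 1], intro allI)
      fix n
      have "op_apply shift_bwd (v n) - exp (\<i> * of_real s) *\<^sub>C v n = (- (1 - r n)) *\<^sub>R (exp (\<i> * of_real s) *\<^sub>C v n)"
        unfolding v(2) by (rule ell2_eqI) (simp add: algebra_simps)
      then show "norm (op_apply shift_bwd (v n) - exp (\<i> * of_real s) *\<^sub>C v n) \<le> 1 - r n"
        using r[of n] by (simp only: norm_scaleR norm_scaleC_ell2 v(1) norm_exp_i_times) simp
    qed
    show "approx_eigen v shift_fwd (exp (- (\<i> * of_real s)))" unfolding approx_eigen_def
    proof (rule Lim_null_comparison[OF always_eventually], intro allI)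
      show "norm (op_apply shift_fwd (v n) - exp (- (\<i> * of_real s)) *\<^sub>C v n) \<le> (1 - r n) + sqrt (1 - (r n)\<^sup>2) * norm (unit_ell2 0)" for n
        by (rule v)
      show "(\<lambda>n. (1 - r n) + sqrt (1 - (r n)\<^sup>2) * norm (unit_ell2 0)) \<longlonglongrightarrow> 0"
        using tendsto_add[OF 1 tendsto_mult_right_zero[OF c0, of "norm (unit_ell2 0)"]] by (simp add: mult.commute)
    qed
    show "(\<lambda>n. ell2_nth (v n) j) \<longlonglongrightarrow> 0" for j
      by (rule Lim_null_comparison[OF always_eventually c0]) (use v(4) in blast)
  qed
qed

text \<open>Truncations approximate \<open>x\<close>, and on finitely many coordinates the
  convergence is given.\<close>

lemma weakly_null:
  assumes v: "\<And>n. norm (v n) = 1" and nth: "\<And>j. (\<lambda>n. ell2_nth (v n) j) \<longlonglongrightarrow> 0"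
  shows "(\<lambda>n. inner x (v n)) \<longlonglongrightarrow> 0"
proof (rule metric_LIMSEQ_I)
  fix e :: real assume e: "0 < e"
  obtain m where m: "norm (trunc_ell2 m x - x) < e / 2"
    using metric_LIMSEQ_D[OF trunc_ell2_LIMSEQ, of "e/2" x] e by (auto simp: dist_norm)
  have "inner (trunc_ell2 m x) (v n) = Re (\<Sum>j<m. cnj (ell2_nth x j) * ell2_nth (v n) j)" for n
    unfolding inner_ell2_def cinner_def
    by (subst suminf_finite[of "{..<m}"]) (auto simp: nth_trunc_ell2)
  moreover have "(\<lambda>n. Re (\<Sum>j<m. cnj (ell2_nth x j) * ell2_nth (v n) j)) \<longlonglongrightarrow> Re (\<Sum>j<m. cnj (ell2_nth x j) * 0)"
    by (intro tendsto_intros nth)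
  ultimately have "(\<lambda>n. inner (trunc_ell2 m x) (v n)) \<longlonglongrightarrow> 0" by simp
  then obtain N where N: "\<And>n. n \<ge> N \<Longrightarrow> \<bar>inner (trunc_ell2 m x) (v n)\<bar> < e / 2"
    using metric_LIMSEQ_D[of "\<lambda>n. inner (trunc_ell2 m x) (v n)" 0 "e/2"] e by (auto simp: dist_norm)
  have "\<bar>inner x (v n)\<bar> < e" if "n \<ge> N" for n
  proof -
    have "inner x (v n) = inner (trunc_ell2 m x) (v n) - inner (trunc_ell2 m x - x) (v n)"
      by (simp add: inner_diff_left)
    moreover have "\<bar>inner (trunc_ell2 m x - x) (v n)\<bar> \<le> norm (trunc_ell2 m x - x)"
      using Cauchy_Schwarz_ineq2[of "trunc_ell2 m x - x" "v n"] by (simp add: v)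
    ultimately show ?thesis using N[OF that] m by linarith
  qed
  then show "\<exists>no. \<forall>n\<ge>no. dist (inner x (v n)) 0 < e" by (auto simp: dist_norm)
qed

text \<open>A compact operator maps the unit vectors to a sequence with a convergent subsequence, so it
  annihilates differences of far apart members in the limit; weak nullity keeps these
  differences away from \<open>0\<close>.\<close>

lemma qt_approx_eigen:
  assumes a: "a \<in> C2pi" and K: "compact_op (A - toeplitz a)" and s: "s \<in> {0..2 * pi}"
  obtains u where "\<And>n. 1 \<le> norm (u n)" "approx_eigen u A (a s)"
proof -
  obtain v where v: "\<And>n. norm (v n) = 1" "approx_eigen v shift_bwd (exp (\<i> * of_real s))"
    "approx_eigen v shift_fwd (exp (- (\<i> * of_real s)))" "\<And>j. (\<lambda>n. ell2_nth (v n) j) \<longlonglongrightarrow> 0"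
    using shift_approx_eigen_ex by metis
  have T: "(\<lambda>n. op_apply (toeplitz a) (v n) - a s *\<^sub>C v n) \<longlonglongrightarrow> 0"
    using approx_eigen_toeplitz[OF v(1) a s v(2,3)] by (simp add: approx_eigen_def)
  let ?K = "A - toeplitz a"
  have sc: "seq_compact (closure (op_apply ?K ` cball 0 1))"
    using K by (simp add: compact_op_def compact_eq_seq_compact_metric)
  have "op_apply ?K (v n) \<in> closure (op_apply ?K ` cball 0 1)" for n
    by (intro subsetD[OF closure_subset] imageI) (simp add: v)
  then obtain w r where r: "strict_mono r" "((\<lambda>n. op_apply ?K (v n)) \<circ> r) \<longlonglongrightarrow> w"
    using sc[unfolded seq_compact_def, rule_format, of "\<lambda>n. op_apply ?K (v n)"] by blast
  let ?x = "\<lambda>n. v (r n)"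
  have x1: "norm (?x n) = 1" for n by (rule v)
  have "\<exists>m\<ge>n. 1 \<le> norm (?x n - ?x m)" for n
  proof -
    have "(\<lambda>m. inner (?x n) (?x m)) \<longlonglongrightarrow> 0"
      using LIMSEQ_subseq_LIMSEQ[OF weakly_null[OF v(1,4)] r(1)] by (simp add: o_def)
    then obtain N where N: "\<And>m. m \<ge> N \<Longrightarrow> \<bar>inner (?x n) (?x m)\<bar> < 1 / 2"
      using metric_LIMSEQ_D[of "\<lambda>m. inner (?x n) (?x m)" 0 "1/2"] by (auto simp: dist_norm)
    define m where "m = max N n"
    \<comment> \<open>For unit vectors this is 2 minus twice the inner product, hence at least 1
      once the latter is below 1/2.\<close>
    have "(norm (?x n - ?x m))\<^sup>2 = (norm (?x n))\<^sup>2 + (norm (?x m))\<^sup>2 - 2 * inner (?x n) (?x m)"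
      unfolding power2_norm_eq_inner by (simp add: inner_diff_left inner_diff_right inner_commute)
    then have "1\<^sup>2 \<le> (norm (?x n - ?x m))\<^sup>2" using N[of m] by (simp add: x1 m_def)
    then have "1 \<le> norm (?x n - ?x m)" by (rule power2_le_imp_le) simp
    then show ?thesis by (intro exI[of _ m]) (simp add: m_def)
  qed
  then obtain m where m: "\<And>n. n \<le> m n" "\<And>n. 1 \<le> norm (?x n - ?x (m n))" by metis
  have mlim: "filterlim m at_top sequentially"
    by (rule filterlim_at_top_mono[OF filterlim_ident]) (use m(1) in simp)
  define g where "g = (\<lambda>n. op_apply A (?x n) - a s *\<^sub>C ?x n)"
  have "(\<lambda>n. op_apply ?K (?x n) + (op_apply (toeplitz a) (?x n) - a s *\<^sub>C ?x n)) \<longlonglongrightarrow> w + 0"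
    using r(2) LIMSEQ_subseq_LIMSEQ[OF T r(1)] by (intro tendsto_add) (simp_all add: o_def)
  then have g: "g \<longlonglongrightarrow> w" by (simp add: g_def)
  \<comment> \<open>Both terms tend to the same \<open>w\<close>, the limit contributed by the
    compact part, and it cancels.\<close>
  have "(\<lambda>n. g n - g (m n)) \<longlonglongrightarrow> w - w"
    by (intro tendsto_diff g filterlim_compose[OF g mlim])
  then have "approx_eigen (\<lambda>n. ?x n - ?x (m n)) A (a s)"
    unfolding approx_eigen_def by (simp add: g_def scaleC_ell2_simps algebra_simps)
  then show thesis by (rule that[OF m(2)])
qed

section \<open>Quasi-Toeplitz operators\<close>

text \<open>Carrying the symbol as an argument lets each closure rule record how the symbol
  changes.\<close>

definition quasi_toeplitz :: "l2op \<Rightarrow> (real \<Rightarrow> complex) \<Rightarrow> bool" where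
  "quasi_toeplitz A a \<longleftrightarrow> a \<in> C2pi \<and> compact_op (A - toeplitz a)"

lemma C2pi_cong:
  assumes "\<And>t. t \<in> {0..2 * pi} \<Longrightarrow> a t = b t" shows "a \<in> C2pi \<longleftrightarrow> b \<in> C2pi"
  using assms continuous_on_cong[of "{0..2 * pi}" "{0..2 * pi}" a b] by (simp add: C2pi_def)

lemma qt_cong:
  assumes "\<And>t. t \<in> {0..2 * pi} \<Longrightarrow> a t = b t" shows "quasi_toeplitz A a \<longleftrightarrow> quasi_toeplitz A b"
  using C2pi_cong[of a b] toeplitz_cong[of a b] assms by (simp add: quasi_toeplitz_def)

lemma qt_const: "quasi_toeplitz (c *\<^sub>C 1) (\<lambda>t. c)"
  by (simp add: quasi_toeplitz_def toeplitz_const C2pi_const compact_op_zero)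

lemma qt_add:
  assumes "quasi_toeplitz A a" "quasi_toeplitz B b" shows "quasi_toeplitz (A + B) (\<lambda>t. a t + b t)"
  using assms compact_op_add[of "A - toeplitz a" "B - toeplitz b"]
  by (simp add: quasi_toeplitz_def toeplitz_add C2pi_add algebra_simps)

lemma qt_mult:
  assumes "quasi_toeplitz A a" "quasi_toeplitz B b" shows "quasi_toeplitz (A * B) (\<lambda>t. a t * b t)"
proof -
  have ab: "a \<in> C2pi" "b \<in> C2pi" using assms by (auto simp: quasi_toeplitz_def)
  \<comment> \<open>A telescoping of \<open>A * B - toeplitz (\<lambda>t. a t * b t)\<close> in
    which every summand is compact.\<close>
  have "compact_op ((A - toeplitz a) * B + toeplitz a * (B - toeplitz b)
      + (toeplitz a * toeplitz b - toeplitz (\<lambda>t. a t * b t)))"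
    using assms by (intro compact_op_add compact_op_mult_left compact_op_mult_right compact_toeplitz_mult)
      (auto simp: quasi_toeplitz_def)
  then show ?thesis using ab by (simp add: quasi_toeplitz_def C2pi_mult algebra_simps)
qed

lemma qt_diff:
  assumes "quasi_toeplitz A a" "quasi_toeplitz B b" shows "quasi_toeplitz (A - B) (\<lambda>t. a t - b t)"
  using qt_add[OF assms(1) qt_mult[OF qt_const[of "-1"] assms(2)]]
  by (simp add: scaleC_l2op_simps)

lemma C2pi_uniform_limit:
  assumes "\<And>n. q n \<in> C2pi" "uniform_limit {0..2 * pi} q a sequentially"
  shows "a \<in> C2pi"
proof -
  have "continuous_on {0..2 * pi} a"
    by (rule uniform_limit_theorem[OF _ assms(2)]) (use assms(1) in \<open>auto simp: C2pi_def\<close>)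
  moreover have "a 0 = a (2 * pi)"
  proof (rule LIMSEQ_unique)
    show "(\<lambda>n. q n 0) \<longlonglongrightarrow> a 0" by (rule tendsto_uniform_limitI[OF assms(2)]) simp
    have "(\<lambda>n. q n (2 * pi)) \<longlonglongrightarrow> a (2 * pi)" by (rule tendsto_uniform_limitI[OF assms(2)]) simp
    then show "(\<lambda>n. q n 0) \<longlonglongrightarrow> a (2 * pi)" using assms(1) by (simp add: C2pi_def)
  qed
  ultimately show ?thesis by (simp add: C2pi_def)
qed

lemma qt_limit:
  assumes X: "\<And>n. quasi_toeplitz (X n) (q n)" "X \<longlonglongrightarrow> A"
    and q: "uniform_limit {0..2 * pi} q a sequentially"
  shows "quasi_toeplitz A a"
proof -
  have qC: "q n \<in> C2pi" for n using X(1) by (simp add: quasi_toeplitz_def)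
  note a = C2pi_uniform_limit[OF qC q]
  have "(\<lambda>n. X n - toeplitz (q n)) \<longlonglongrightarrow> A - toeplitz a"
    by (intro tendsto_diff X toeplitz_LIMSEQ[OF qC a q])
  then have "compact_op (A - toeplitz a)"
    by (rule compact_op_limit[rotated]) (use X(1) in \<open>simp add: quasi_toeplitz_def\<close>)
  then show ?thesis using a by (simp add: quasi_toeplitz_def)
qed

lemma qt_poly:
  assumes "quasi_toeplitz A a" shows "quasi_toeplitz (poly_op p A) (\<lambda>t. poly p (a t))"
proof (induction p)
  case 0
  show ?case using qt_const[of 0] by (simp add: scaleC_l2op_simps)
next
  case (pCons c p)
  then show ?case
    using qt_add[OF qt_const[of c] qt_mult[OF assms pCons(2)]]
    by (simp add: poly_op_pCons)
qed

lemma qt_not_bounded_below: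
  assumes A: "quasi_toeplitz A a" and s: "s \<in> {0..2 * pi}"
  shows "\<not> bounded_below (A - a s *\<^sub>C 1)"
proof
  assume "bounded_below (A - a s *\<^sub>C 1)"
  then obtain c where c: "c > 0" "\<And>x. c * norm x \<le> norm (op_apply (A - a s *\<^sub>C 1) x)"
    unfolding bounded_below_def by blast
  obtain u where u: "\<And>n. 1 \<le> norm (u n)" "approx_eigen u A (a s)"
    using qt_approx_eigen[OF _ _ s] A by (metis quasi_toeplitz_def)
  obtain n where "norm (op_apply A (u n) - a s *\<^sub>C u n) < c"
    using metric_LIMSEQ_D[OF u(2)[unfolded approx_eigen_def] c(1)] by auto
  moreover have "c * 1 \<le> c * norm (u n)" using c(1) u(1) by (intro mult_left_mono) auto
  ultimately show False using c(2)[of "u n"] by simp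
qed

text \<open>An approximate eigenvalue cannot exceed the norm: otherwise the difference would be a
  lower bound for \<open>A - a s *\<^sub>C 1\<close>.\<close>

lemma qt_symbol_le_norm:
  assumes "quasi_toeplitz A a" "s \<in> {0..2 * pi}" shows "cmod (a s) \<le> norm A"
proof (rule ccontr)
  assume "\<not> cmod (a s) \<le> norm A"
  moreover have "(cmod (a s) - norm A) * norm x \<le> norm (op_apply (A - a s *\<^sub>C 1) x)" for x
  proof -
    have "norm (a s *\<^sub>C x) - norm (op_apply A x) \<le> norm (op_apply A x - a s *\<^sub>C x)"
      by (metis norm_minus_commute norm_triangle_ineq2)
    then show ?thesis using norm_op_apply_le[of A x] by (simp add: norm_scaleC_ell2 left_diff_distrib)
  qed
  ultimately show False using qt_not_bounded_below[OF assms]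
    unfolding bounded_below_def by (metis diff_gt_0_iff_gt not_le)
qed

lemma qt_symbol_between:
  assumes "quasi_toeplitz A a" "op_between l u A" "s \<in> {0..2 * pi}"
  shows "a s \<in> complex_of_real ` {l..u}"
  using not_bounded_below_in_spectrum[OF qt_not_bounded_below[OF assms(1,3)]]
    op_between_spectrum[OF assms(2)] by blast

text \<open>The symbol takes its values in the interval on which the polynomials converge, so
  operators and symbols pass to the limit along the same sequence.\<close>

lemma qt_cfc:
  assumes A: "quasi_toeplitz A a" and lu: "op_between l u A" and g: "continuous_on {l..u} g"
  shows "quasi_toeplitz (cfc (\<lambda>z. complex_of_real (g (Re z))) A) (\<lambda>t. complex_of_real (g (Re (a t))))"
proof -
  obtain q where q: "uniform_limit (complex_of_real ` {l..u}) (\<lambda>n. poly (q n))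
      (\<lambda>z. complex_of_real (g (Re z))) sequentially"
    using real_poly_approx[OF g] by metis
  have "uniform_limit {0..2 * pi} (\<lambda>n t. poly (q n) (a t)) (\<lambda>t. complex_of_real (g (Re (a t)))) sequentially"
  proof (rule uniform_limitI)
    fix e :: real assume "0 < e"
    from uniform_limitD[OF q this]
    show "\<forall>\<^sub>F n in sequentially. \<forall>t\<in>{0..2 * pi}. dist (poly (q n) (a t)) (complex_of_real (g (Re (a t)))) < e"
      by eventually_elim (use qt_symbol_between[OF A lu] in blast)
  qed
  then show ?thesis
    using qt_limit[OF qt_poly[OF A] cfc_LIMSEQ[OF lu q]] by blast
qed

lemma qt_op_powr:
  assumes A: "quasi_toeplitz A a" and pd: "positive_definite A"
  shows "quasi_toeplitz (op_powr A t) (\<lambda>s. complex_of_real (Re (a s) powr t))"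
proof -
  obtain l u where lu: "0 < l" "op_between l u A" using posdef_between[OF pd] by metis
  show ?thesis unfolding op_powr_eq_cfc[OF lu(2,1)]
    by (rule qt_cfc[OF A lu(2) continuous_on_powr_pos[OF lu(1)]])
qed

lemma qt_symbol_positive:
  assumes A: "quasi_toeplitz A a" and pd: "positive_definite A" and s: "s \<in> {0..2 * pi}"
  shows "0 < Re (a s)" "a s = complex_of_real (Re (a s))"
proof -
  obtain l u where lu: "0 < l" "op_between l u A" using posdef_between[OF pd] by metis
  obtain x where x: "x \<in> {l..u}" "a s = complex_of_real x"
    using qt_symbol_between[OF A lu(2) s] by blast
  show "0 < Re (a s)" "a s = complex_of_real (Re (a s))" using x lu by auto
qed

lemma strictly_positive_symbol:
  "quasi_toeplitz A a \<Longrightarrow> positive_definite A \<Longrightarrow> strictly_positive a"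
  unfolding strictly_positive_def using qt_symbol_positive by (metis Reals_of_real)

text \<open>The symbol is computed factor by factor; the values are positive scalars, so the outer
  and inner powers of the first symbol combine.\<close>

lemma qt_gm:
  assumes A: "quasi_toeplitz A a" "positive_definite A" and B: "quasi_toeplitz B b" "positive_definite B"
  shows "quasi_toeplitz (op_gm (1/2) A B) (fun_gm (1/2) a b)"
proof -
  let ?R = "op_powr A (-1/2)"
  have SR: "op_powr A (1/2) * ?R = 1" using op_powr_inverse(1)[OF A(2), of "1/2"] by simp
  have "positive_definite (?R * B * ?R)"
    by (rule posdef_sandwich[OF self_adjoint_op_powr[OF A(2)] SR B(2)])
  moreover have "quasi_toeplitz (?R * B * ?R)
      (\<lambda>s. complex_of_real (Re (a s) powr (-1/2)) * b s * complex_of_real (Re (a s) powr (-1/2)))"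
    by (intro qt_mult qt_op_powr A B)
  ultimately have "quasi_toeplitz (op_powr (?R * B * ?R) (1/2))
      (\<lambda>s. complex_of_real (Re (complex_of_real (Re (a s) powr (-1/2)) * b s * complex_of_real (Re (a s) powr (-1/2))) powr (1/2)))"
    by (intro qt_op_powr)
  then have "quasi_toeplitz (op_gm (1/2) A B) (\<lambda>s. complex_of_real (Re (a s) powr (1/2)) *
      complex_of_real (Re (complex_of_real (Re (a s) powr (-1/2)) * b s * complex_of_real (Re (a s) powr (-1/2))) powr (1/2))
      * complex_of_real (Re (a s) powr (1/2)))" (is "quasi_toeplitz _ ?f")
    unfolding op_gm_def by (intro qt_mult qt_op_powr[OF A])
  moreover have "?f s = fun_gm (1/2) a b s" if s: "s \<in> {0..2 * pi}" for s
  proof -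
    define x y where "x = Re (a s)" and "y = Re (b s)"
    have x: "0 < x" and y: "0 < y" "b s = complex_of_real y"
      using qt_symbol_positive[OF A s] qt_symbol_positive[OF B s] by (auto simp: x_def y_def)
    have "(x powr (-1/2) * y * x powr (-1/2)) powr (1/2) = x powr (-1/2) * y powr (1/2)"
      using x y by (simp add: powr_mult powr_powr flip: powr_add)
    then have "x powr (1/2) * (x powr (-1/2) * y * x powr (-1/2)) powr (1/2) * x powr (1/2)
        = (x powr (1/2) * x powr (-1/2)) * (x powr (1/2) * y powr (1/2))" by simp
    also have "x powr (1/2) * x powr (-1/2) = 1" using x by (simp flip: powr_add)
    finally show ?thesis
      by (simp add: fun_gm_def real_gm_def y(2) flip: x_def of_real_mult)
  qed
  ultimately show ?thesis by (rule qt_cong[THEN iffD1, rotated])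
qed

section \<open>The iteration\<close>

interpretation pd: alm_space "{A. positive_definite A}" thompson op_gm
proof (unfold_locales, unfold mem_Collect_eq)
  show "\<exists>L\<in>{A. positive_definite A}. (\<lambda>k. thompson (X k) L) \<longlonglongrightarrow> 0"
    if "\<And>k. positive_definite (X k)" "\<And>k. thompson (X k) (X (Suc k)) \<le> C * (1/2) ^ k" for X C
    using thompson_complete[OF that] by simp
  show "X \<longlonglongrightarrow> L" if "\<And>k. positive_definite (X k)" "positive_definite L"
    "(\<lambda>k. thompson (X k) L) \<longlonglongrightarrow> 0" for X L
    by (rule thompson_tendsto_imp_LIMSEQ[OF that])
qed (rule thompson_attained thompson_self thompson_sym thompson_triangle op_gm_one
      posdef_gm op_gm_idem thompson_gm; assumption)+

section \<open>Symbols of the iterates and of their limit\<close>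

lemma Re_fun_gm: "Re (fun_gm s a b t) = real_gm s (Re (a t)) (Re (b t))"
  by (simp add: fun_gm_def)

lemma Re_fun_gmean: "Re (fun_gmean ss as t) = gmean real_gm ss (map (\<lambda>a. Re (a t)) as)"
  by (simp add: fun_gmean_def)

text \<open>\<open>fun_gmean\<close> takes its limits at one point at a time; this identifies the
  iteration of functions, evaluated at \<open>t\<close>, with the real iteration under those
  limits.\<close>

lemma Re_mean_iter:
  "map (\<lambda>a. Re (a t)) (mean_iter fun_gm s (fun_gmean ss) as k)
    = mean_iter real_gm s (gmean real_gm ss) (map (\<lambda>a. Re (a t)) as) k"
proof (induction k)
  case (Suc k)
  show ?case
  proof (rule nth_equalityI)
    fix i assume "i < length (map (\<lambda>a. Re (a t)) (mean_iter fun_gm s (fun_gmean ss) as (Suc k)))"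
    then have i: "i < length as" by (simp del: mean_iter.simps)
    let ?b = "mean_iter fun_gm s (fun_gmean ss) as k"
    have "Re ((?b ! i) t) = map (\<lambda>a. Re (a t)) ?b ! i" using i by simp
    then show "map (\<lambda>a. Re (a t)) (mean_iter fun_gm s (fun_gmean ss) as (Suc k)) ! i
        = mean_iter real_gm s (gmean real_gm ss) (map (\<lambda>a. Re (a t)) as) (Suc k) ! i"
      using i by (simp add: nth_mean_iter_Suc Re_fun_gm Re_fun_gmean map_delete_nth Suc del: mean_iter.simps)
  qed (simp del: mean_iter.simps)
qed simp

definition symbols :: "nat \<Rightarrow> l2op list \<Rightarrow> (real \<Rightarrow> complex) list \<Rightarrow> bool" where
  "symbols N As as \<longleftrightarrow> length As = N \<and> length as = N \<and>
     (\<forall>i<N. positive_definite (As ! i) \<and> quasi_toeplitz (As ! i) (as ! i))"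

lemma symbols_set: "symbols N As as \<Longrightarrow> set As \<subseteq> {A. positive_definite A}"
  by (auto simp: symbols_def in_set_conv_nth)

lemma symbols_delete_nth:
  assumes "symbols (Suc N) As as" "i < Suc N" shows "symbols N (delete_nth i As) (delete_nth i as)"
  using assms by (auto simp: symbols_def length_delete_nth nth_delete_nth)

text \<open>\<open>M\<close> is the induction hypothesis of \<open>qt_gmean\<close>; it supplies the
  symbol of the mean of the remaining operators.\<close>

lemma symbols_mean_iter:
  assumes M: "\<And>As as. symbols (n + 2) As as \<Longrightarrow>
      quasi_toeplitz (gmean op_gm (ones_half n) As) (fun_gmean (ones_half n) as)"
    and S: "symbols (n + 3) As as"
  shows "symbols (n + 3) (mean_iter op_gm 1 (gmean op_gm (ones_half n)) As k)
    (mean_iter fun_gm 1 (fun_gmean (ones_half n)) as k)"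
proof (induction k)
  case 0
  show ?case using S by simp
next
  case (Suc k)
  let ?A = "mean_iter op_gm 1 (gmean op_gm (ones_half n)) As"
    and ?a = "mean_iter fun_gm 1 (fun_gmean (ones_half n)) as"
  have len: "length As = n + 3" "length as = n + 3" using S by (auto simp: symbols_def)
  have "positive_definite (?A (Suc k) ! i) \<and> quasi_toeplitz (?A (Suc k) ! i) (?a (Suc k) ! i)"
    if i: "i < n + 3" for i
  proof -
    let ?G = "gmean op_gm (ones_half n) (delete_nth i (?A k))"
      and ?g = "fun_gmean (ones_half n) (delete_nth i (?a k))"
    have d: "symbols (n + 2) (delete_nth i (?A k)) (delete_nth i (?a k))"
      using Suc i by (intro symbols_delete_nth) (simp_all add: numeral_3_eq_3)
    have G: "positive_definite ?G" using pd.gmean_in[of "delete_nth i (?A k)" n] d symbols_set[OF d]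
      by (simp add: symbols_def)
    have Ai: "positive_definite (?A k ! i)" "quasi_toeplitz (?A k ! i) (?a k ! i)"
      using Suc i by (auto simp: symbols_def)
    have A: "?A (Suc k) ! i = ?G"
      using i len by (simp add: nth_mean_iter_Suc op_gm_one Ai G del: mean_iter.simps)
    \<comment> \<open>With weight 1 the first value enters as \<open>x powr 0\<close>, which is 1
      because the symbol is nonzero; positivity is known on the parameter interval, whence the
      detour through \<open>qt_cong\<close>.\<close>
    have "fun_gm 1 (?a k ! i) ?g t = ?g t" if t: "t \<in> {0..2 * pi}" for t
      using qt_symbol_positive[OF Ai(2,1) t] qt_symbol_positive[OF M[OF d] G t]
      by (simp add: fun_gm_def real_gm_def)
    then have "quasi_toeplitz ?G (fun_gm 1 (?a k ! i) ?g)"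
      using qt_cong[of "fun_gm 1 (?a k ! i) ?g" ?g] M[OF d] by blast
    then show ?thesis using i len unfolding A
      by (simp add: nth_mean_iter_Suc G del: mean_iter.simps)
  qed
  then show ?case using len by (simp add: symbols_def del: mean_iter.simps)
qed

text \<open>The symbol map is contractive, so norm convergence of the operators forces uniform convergence
  of their symbols.\<close>

lemma symbol_mean_limit:
  assumes M: "\<And>As as. symbols (n + 2) As as \<Longrightarrow>
      quasi_toeplitz (gmean op_gm (ones_half n) As) (fun_gmean (ones_half n) as)"
    and S: "symbols (n + 3) As as" and i: "i < n + 3"
  shows "uniform_limit {0..2 * pi} (\<lambda>k. mean_iter fun_gm 1 (fun_gmean (ones_half n)) as k ! i)
    (fun_gmean (ones_half (Suc n)) as) sequentially"
proof -
  define X where "X = mean_iter op_gm 1 (gmean op_gm (ones_half n)) As"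
  define x where "x = mean_iter fun_gm 1 (fun_gmean (ones_half n)) as"
  define G where "G = gmean op_gm (ones_half (Suc n)) As"
  have len: "length As = n + 3" "length as = n + 3" using S by (auto simp: symbols_def)
  have X: "(\<lambda>k. X k ! i) \<longlonglongrightarrow> G" if "i < n + 3" for i
    unfolding X_def G_def by (rule pd.mean_iter_LIMSEQ_gmean[OF len(1) symbols_set[OF S] that])
  have "symbols (n + 3) (X k) (x k)" for k
    unfolding X_def x_def by (rule symbols_mean_iter[OF M S])
  then have Xx: "positive_definite (X k ! i)" "quasi_toeplitz (X k ! i) (x k ! i)" if "i < n + 3" for i k
    using that by (auto simp: symbols_def)
  have le: "cmod ((x k ! i) t - (x l ! j) t) \<le> norm (X k ! i - X l ! j)"
    if "i < n + 3" "j < n + 3" "t \<in> {0..2 * pi}" for i j k l t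
    by (rule qt_symbol_le_norm[OF qt_diff]) (use that Xx in auto)
  have XG: "(\<lambda>k. norm (X k ! i - G)) \<longlonglongrightarrow> 0" if "i < n + 3" for i
    using X[OF that] by (simp add: LIM_zero tendsto_norm_zero)
  \<comment> \<open>The symbols inherit the Cauchy property from the operators through
    \<open>le\<close>; letting \<open>l\<close> grow in \<open>le\<close> bounds the error at
    \<open>t\<close> by a quantity independent of \<open>t\<close>.\<close>
  have "\<exists>h. \<forall>i<n + 3. \<forall>k. (\<lambda>l. (x l ! i) t) \<longlonglongrightarrow> h \<and> cmod ((x k ! i) t - h) \<le> norm (X k ! i - G)"
    if t: "t \<in> {0..2 * pi}" for t
  proof -
    have "Cauchy (\<lambda>l. (x l ! 0) t)"
    proof (rule metric_CauchyI)
      fix e :: real assume e: "0 < e"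
      have "Cauchy (\<lambda>l. X l ! 0)" using X[of 0] by (simp add: LIMSEQ_imp_Cauchy)
      from metric_CauchyD[OF this e] show "\<exists>M. \<forall>m\<ge>M. \<forall>n\<ge>M. dist ((x m ! 0) t) ((x n ! 0) t) < e"
        using le[of 0 0 t] t by (simp add: dist_norm) (meson order_le_less_trans)
    qed
    then obtain h where h: "(\<lambda>l. (x l ! 0) t) \<longlonglongrightarrow> h"
      using Cauchy_convergent_iff convergent_def by blast
    have hi: "(\<lambda>l. (x l ! i) t) \<longlonglongrightarrow> h" if i: "i < n + 3" for i
    proof -
      have "(\<lambda>l. norm (X l ! i - X l ! 0)) \<longlonglongrightarrow> 0"
        using tendsto_norm[OF tendsto_diff[OF X[OF i] X[of 0]]] by simp
      then have "(\<lambda>l. (x l ! i) t - (x l ! 0) t) \<longlonglongrightarrow> 0"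
        by (rule Lim_null_comparison[OF always_eventually, rotated]) (use le[OF i _ t, of 0] in simp)
      from tendsto_add[OF this h] show ?thesis by simp
    qed
    moreover have "cmod ((x k ! i) t - h) \<le> norm (X k ! i - G)" if i: "i < n + 3" for i k
    proof (rule LIMSEQ_le)
      show "(\<lambda>l. cmod ((x k ! i) t - (x l ! i) t)) \<longlonglongrightarrow> cmod ((x k ! i) t - h)"
        by (intro tendsto_intros hi i)
      show "(\<lambda>l. norm (X k ! i - X l ! i)) \<longlonglongrightarrow> norm (X k ! i - G)"
        by (intro tendsto_intros X i)
    qed (use le[OF i i t] in blast)
    ultimately show ?thesis by blast
  qed
  then obtain h where h: "\<And>t i. t \<in> {0..2 * pi} \<Longrightarrow> i < n + 3 \<Longrightarrow> (\<lambda>l. (x l ! i) t) \<longlonglongrightarrow> h t"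
    "\<And>t i k. t \<in> {0..2 * pi} \<Longrightarrow> i < n + 3 \<Longrightarrow> cmod ((x k ! i) t - h t) \<le> norm (X k ! i - G)"
    by metis
  \<comment> \<open>The limits found from the operators are the ones that the definite description
    in the real mean asks for.\<close>
  have hg: "fun_gmean (ones_half (Suc n)) as t = h t" if t: "t \<in> {0..2 * pi}" for t
  proof -
    let ?as = "map (\<lambda>a. Re (a t)) as"
    have nth: "mean_iter real_gm 1 (gmean real_gm (ones_half n)) ?as k ! i = Re ((x k ! i) t)"
      if "i < n + 3" for i k
      using that len unfolding Re_mean_iter[symmetric] x_def by simp
    have lim: "(\<lambda>k. mean_iter real_gm 1 (gmean real_gm (ones_half n)) ?as k ! i) \<longlonglongrightarrow> Re (h t)"
      if "i < n + 3" for i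
      unfolding nth[OF that] by (intro tendsto_intros h t that)
    have "gmean real_gm (ones_half (Suc n)) ?as = Re (h t)"
      unfolding gmean_Suc
      by (rule the_equality) (use lim len in \<open>auto dest!: spec[of _ 0] intro: LIMSEQ_unique\<close>)
    \<comment> \<open>\<open>fun_gmean\<close> sees real parts only; \<open>h t\<close> is real as a
      limit of real values.\<close>
    moreover have "complex_of_real (Re (h t)) = h t"
    proof (rule LIMSEQ_unique)
      show "(\<lambda>l. (x l ! 0) t) \<longlonglongrightarrow> h t" by (rule h) (use t in auto)
      then have "(\<lambda>l. complex_of_real (Re ((x l ! 0) t))) \<longlonglongrightarrow> complex_of_real (Re (h t))"
        by (intro tendsto_intros)
      then show "(\<lambda>l. (x l ! 0) t) \<longlonglongrightarrow> complex_of_real (Re (h t))"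
        using qt_symbol_positive(2)[OF Xx(2,1) t] by simp
    qed
    ultimately show ?thesis by (simp add: fun_gmean_def)
  qed
  show ?thesis unfolding x_def[symmetric]
  proof (rule uniform_limitI)
    fix e :: real assume "0 < e"
    with XG[OF i] have "\<forall>\<^sub>F k in sequentially. norm (X k ! i - G) < e" by (rule order_tendstoD(2))
    then show "\<forall>\<^sub>F k in sequentially. \<forall>t\<in>{0..2 * pi}. dist ((x k ! i) t) (fun_gmean (ones_half (Suc n)) as t) < e"
    proof eventually_elim
      case (elim k)
      show ?case
      proof
        fix t assume t: "t \<in> {0..2 * pi}"
        show "dist ((x k ! i) t) (fun_gmean (ones_half (Suc n)) as t) < e"
          using h(2)[OF t i, of k] elim unfolding hg[OF t] dist_norm by (rule order_le_less_trans)
      qed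
    qed
  qed
qed

lemma qt_gmean:
  "symbols (n + 2) As as \<Longrightarrow>
    quasi_toeplitz (gmean op_gm (ones_half n) As) (fun_gmean (ones_half n) as)"
proof (induction n arbitrary: As as)
  case 0
  then have "quasi_toeplitz (op_gm (1/2) (As ! 0) (As ! 1)) (fun_gm (1/2) (as ! 0) (as ! 1))"
    by (intro qt_gm) (auto simp: symbols_def)
  moreover have "fun_gmean [1/2] as = fun_gm (1/2) (as ! 0) (as ! 1)"
    using 0 by (auto simp: fun_gmean_def fun_gm_def symbols_def)
  ultimately show ?case by simp
next
  case (Suc n)
  have S: "symbols (n + 3) As as" using Suc(2) by (simp add: numeral_3_eq_3)
  have len: "length As = n + 3" using S by (simp add: symbols_def)
  show ?case
  \<comment> \<open>Index 0 may stand for any: all entries have the same limit.\<close>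
  proof (rule qt_limit)
    show "quasi_toeplitz (mean_iter op_gm 1 (gmean op_gm (ones_half n)) As k ! 0)
      (mean_iter fun_gm 1 (fun_gmean (ones_half n)) as k ! 0)" for k
      using symbols_mean_iter[OF Suc(1) S, of k] by (simp add: symbols_def)
    show "(\<lambda>k. mean_iter op_gm 1 (gmean op_gm (ones_half n)) As k ! 0)
        \<longlonglongrightarrow> gmean op_gm (ones_half (Suc n)) As"
      by (rule pd.mean_iter_LIMSEQ_gmean[OF len symbols_set[OF S]]) simp
    show "uniform_limit {0..2 * pi} (\<lambda>k. mean_iter fun_gm 1 (fun_gmean (ones_half n)) as k ! 0)
        (fun_gmean (ones_half (Suc n)) as) sequentially"
      by (rule symbol_mean_limit[OF Suc(1) S]) auto
  qed
qed

lemma sup_norm_tendsto_zero: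
  assumes "uniform_limit {0..2 * pi} q a sequentially"
  shows "(\<lambda>k. sup_norm (\<lambda>t. q k t - a t)) \<longlonglongrightarrow> 0"
proof (rule metric_LIMSEQ_I)
  fix e :: real assume e: "0 < e"
  then obtain N where N: "\<And>k t. k \<ge> N \<Longrightarrow> t \<in> {0..2 * pi} \<Longrightarrow> dist (q k t) (a t) < e / 2"
    using uniform_limit_le[OF assms, of "e/2"] by auto
  have "dist (sup_norm (\<lambda>t. q k t - a t)) 0 < e" if k: "k \<ge> N" for k
  proof -
    have b: "cmod (q k t - a t) \<le> e / 2" if "t \<in> {0..2 * pi}" for t
      using N[OF k that] by (simp add: dist_norm)
    have "sup_norm (\<lambda>t. q k t - a t) \<le> e / 2"
      unfolding sup_norm_def by (rule cSUP_least) (use b in auto)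
    \<comment> \<open>A value of the function shows that the supremum is nonnegative, so its
      distance to 0 is the supremum itself.\<close>
    moreover have "cmod (q k 0 - a 0) \<le> sup_norm (\<lambda>t. q k t - a t)"
      unfolding sup_norm_def
      by (rule cSUP_upper[OF _ bdd_aboveI2[where M = "e / 2"]]) (use b in auto)
    ultimately show ?thesis using e norm_ge_zero[of "q k 0 - a 0"] by (simp only: dist_real_def)
  qed
  then show "\<exists>no. \<forall>k\<ge>no. dist (sup_norm (\<lambda>t. q k t - a t)) 0 < e" by blast
qed

theorem theorem15:
  fixes p :: nat
    and A E :: "nat \<Rightarrow> l2op"
    and a :: "nat \<Rightarrow> real \<Rightarrow> complex"
    and s1 :: real and ss :: "real list"
    and Ak :: "nat \<Rightarrow> nat \<Rightarrow> l2op"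
    and G :: l2op
  assumes p: "p \<ge> 3"
    and symbol: "\<And>i. i < p \<Longrightarrow> a i \<in> C2pi"
    and comp: "\<And>i. i < p \<Longrightarrow> compact_op (E i)"
    and QT: "\<And>i. i < p \<Longrightarrow> A i = toeplitz (a i) + E i"
    and posdef: "\<And>i. i < p \<Longrightarrow> positive_definite (A i)"
    and weights: "s1 # ss = alm_weights p"
    and Ak: "\<And>i k. Ak i k = mean_iter op_gm s1 (gmean op_gm ss) (map A [0..<p]) k ! i"
    and G: "G = gmean op_gm (alm_weights p) (map A [0..<p])"
  shows "\<exists>(ak :: nat \<Rightarrow> nat \<Rightarrow> real \<Rightarrow> complex) (K :: nat \<Rightarrow> nat \<Rightarrow> l2op) g KG.
    (\<forall>k. \<forall>i<p. ak i k \<in> C2pi \<and> compact_op (K i k) \<and> Ak i k = toeplitz (ak i k) + K i k) \<and>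
    (g \<in> C2pi \<and> compact_op KG \<and> G = toeplitz g + KG) \<and>
    (\<forall>i<p. (\<lambda>k. sup_norm (\<lambda>t. ak i k t - g t)) \<longlonglongrightarrow> 0 \<and>
            (\<lambda>k. norm (K i k - KG)) \<longlonglongrightarrow> 0) \<and>
    (\<forall>k. \<forall>i<p. strictly_positive (ak i k)) \<and>
    (\<forall>k. \<forall>i<p. \<forall>t\<in>{0..2 * pi}. ak i (Suc k) t =
        fun_gm s1 (ak i k) (fun_gmean ss (delete_nth i (map (\<lambda>j. ak j k) [0..<p]))) t)"
proof -
  \<comment> \<open>The mean of the other \<open>p - 1 = n + 2\<close> operators then has weights
    \<open>ones_half n\<close>.\<close>
  define n where "n = p - 3"
  have pn: "p = n + 3" using p by (simp add: n_def)
  have al: "alm_weights p = ones_half (Suc n)" by (simp add: alm_weights_def pn numeral_3_eq_3)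
  then have s1: "s1 = 1" and ss: "ss = ones_half n" using weights by auto
  define As as where "As = map A [0..<p]" and "as = map a [0..<p]"
  have S: "symbols (n + 3) As as"
    using posdef symbol comp QT by (auto simp: symbols_def As_def as_def pn quasi_toeplitz_def)
  \<comment> \<open>With the iteration of symbols as witness the recursion in the last clause is an
    unfolding; the substance is \<open>Sk\<close>, that these functions are symbols of the
    iterates.\<close>
  define x where "x = mean_iter fun_gm s1 (fun_gmean ss) as"
  define g where "g = fun_gmean (alm_weights p) as"
  have len: "length As = n + 3" "length as = n + 3" by (simp_all add: As_def as_def pn)
  have Sk: "symbols (n + 3) (mean_iter op_gm s1 (gmean op_gm ss) As k) (x k)" for k
    unfolding x_def s1 ss by (rule symbols_mean_iter[OF qt_gmean S])
  have pdk: "positive_definite (Ak i k)" and qtk: "quasi_toeplitz (Ak i k) (x k ! i)" if "i < p" for i k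
    using Sk[of k] that by (simp_all add: symbols_def Ak pn As_def)
  have xC: "x k ! i \<in> C2pi" if "i < p" for i k using qtk[OF that] by (simp add: quasi_toeplitz_def)
  have qtG: "quasi_toeplitz G g"
    unfolding G g_def al As_def[symmetric]
    by (rule qt_gmean) (use S in \<open>simp add: numeral_3_eq_3\<close>)
  have AG: "(\<lambda>k. Ak i k) \<longlonglongrightarrow> G" if "i < p" for i
    unfolding Ak G al s1 ss As_def[symmetric]
    by (rule pd.mean_iter_LIMSEQ_gmean[OF len(1) symbols_set[OF S]]) (use that pn in simp)
  have xg: "uniform_limit {0..2 * pi} (\<lambda>k. x k ! i) g sequentially" if "i < p" for i
    unfolding x_def g_def al s1 ss
    by (rule symbol_mean_limit[OF qt_gmean S]) (use that pn in auto)
  have xs: "map (\<lambda>j. x k ! j) [0..<p] = x k" for k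
    using map_nth[of "x k"] len(2) by (simp add: x_def pn)
  show ?thesis
  proof (intro exI[of _ "\<lambda>i k. x k ! i"] exI[of _ "\<lambda>i k. Ak i k - toeplitz (x k ! i)"] exI[of _ g]
      exI[of _ "G - toeplitz g"] conjI allI impI ballI)
    fix i k assume i: "i < p"
    show "x k ! i \<in> C2pi" "compact_op (Ak i k - toeplitz (x k ! i))"
      using qtk[OF i] by (auto simp: quasi_toeplitz_def)
    show "Ak i k = toeplitz (x k ! i) + (Ak i k - toeplitz (x k ! i))" by simp
    show "strictly_positive (x k ! i)" by (rule strictly_positive_symbol[OF qtk[OF i] pdk[OF i]])
    fix t
    show "(x (Suc k) ! i) t = fun_gm s1 (x k ! i) (fun_gmean ss (delete_nth i (map (\<lambda>j. x k ! j) [0..<p]))) t"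
      unfolding xs using i len(2) by (simp add: x_def nth_mean_iter_Suc pn del: mean_iter.simps)
  next
    show "g \<in> C2pi" "compact_op (G - toeplitz g)" using qtG by (auto simp: quasi_toeplitz_def)
    show "G = toeplitz g + (G - toeplitz g)" by simp
  next
    fix i assume i: "i < p"
    show "(\<lambda>k. sup_norm (\<lambda>t. (x k ! i) t - g t)) \<longlonglongrightarrow> 0" by (rule sup_norm_tendsto_zero[OF xg[OF i]])
    have "(\<lambda>k. Ak i k - toeplitz (x k ! i)) \<longlonglongrightarrow> G - toeplitz g"
      by (intro tendsto_diff AG i toeplitz_LIMSEQ xC xg) (use qtG in \<open>simp add: quasi_toeplitz_def\<close>)
    then show "(\<lambda>k. norm (Ak i k - toeplitz (x k ! i) - (G - toeplitz g))) \<longlonglongrightarrow> 0"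
      by (simp add: LIM_zero tendsto_norm_zero)
  qed
qed

end
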